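(* For every $n\geq 0$, $C\Sigma_n\subseteq I\Sigma_{n+1}$, i.e. every theorem of $C\Sigma_n$ is a theorem of $I\Sigma_{n+1}$.
   Context: Language of arithmetic $\{0,\mathsf{s},+,\times,<\}$, formulae in De Morgan normal form. $\Sigma_0=\Pi_0$ are bounded formulae; $\Sigma_{n+1}$: $\exists\vec x.\phi$ with $\phi\in\Pi_n$; $\Pi_{n+1}$: $\forall\vec x.\phi$ with $\phi\in\Sigma_n$. $\mathsf{Q}$ is Robinson arithmetic with inequality ($\mathsf{s}x\neq 0$; $\mathsf{s}x=\mathsf{s}y\supset x=y$; $x\neq0\supset\exists y.x=\mathsf{s}y$; $x+0=x$; $x+\mathsf{s}y=\mathsf{s}(x+y)$; $x\cdot0=0$; $x\cdot\mathsf{s}y=x\cdot y+x$; $x<y\equiv\exists z.(x+\mathsf{s}z=y)$); $I\Sigma_n$ is $\mathsf{Q}$ plus induction for $\Sigma_n$ formulae. Cyclic proofs: sequent calculus for first-order logic with equality (cedents finite sets; identity, equality and negation axioms, weakening, cut, left/right rules for $\wedge,\vee,\forall,\exists$ with fresh eigenvariables, substitution rule from $\Gamma\Rightarrow\Delta$ to $\theta(\Gamma)\Rightarrow\theta(\Delta)$, initial sequents for instances of axioms of $\mathsf{Q}$). A preproof is a possibly infinite locally correct labelled tree; regular if finitely many distinct subtrees. Along an infinite branch $(\Gamma_i\Rightarrow\Delta_i)_i$, $t'$ is a precursor of $t$ at $i$ if the step at $i$ is a substitution $\theta$ with $t=\theta(t')$, or another step and $t'=t$ occurs in $\Gamma_i$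 or $t'$ is $t$. A trace $(t_i)_{i\ge m}$ has $t_i$ in the $i$-th sequent and either $t_{i+1}$ a precursor of $t_i$ at $i$ or $t_{i+1}<t\in\Gamma_{i+1}$ for some precursor $t$ of $t_i$ at $i$ (progress). A cyclic proof is a regular preproof whose every infinite branch has an infinitely progressing trace. $C\Sigma_n$ is the theory axiomatised by universal closures of conclusions of cyclic proofs containing only $\Sigma_n$ formulae. *)

theory Defs
  imports Main "HOL-Library.FSet"
begin

section \<open>Syntax of first-order arithmetic\<close>

text \<open>
  Bound variables are de Bruijn indices, so formulae are identified up to renaming of bound
  variables. An index pointing beyond all enclosing quantifiers is a free variable.
\<close>

datatype trm = Var nat | Zero | Succ trm | Add trm trm | Mul trm trm

datatype atm = Eq trm trm | Less trm trm

text \<open>De Morgan normal form: negation occurs on atoms only.\<close>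

datatype fm =
    Pos atm
  | Neg atm
  | And fm fm
  | Or fm fm
  | All fm
  | Ex fm

type_synonym sub = "nat \<Rightarrow> trm"

primrec subst_trm :: "sub \<Rightarrow> trm \<Rightarrow> trm" where
  "subst_trm \<theta> (Var i) = \<theta> i"
| "subst_trm \<theta> Zero = Zero"
| "subst_trm \<theta> (Succ t) = Succ (subst_trm \<theta> t)"
| "subst_trm \<theta> (Add t u) = Add (subst_trm \<theta> t) (subst_trm \<theta> u)"
| "subst_trm \<theta> (Mul t u) = Mul (subst_trm \<theta> t) (subst_trm \<theta> u)"

definition lift_trm :: "trm \<Rightarrow> trm" where
  "lift_trm = subst_trm (\<lambda>i. Var (Suc i))"

definition up :: "sub \<Rightarrow> sub" where
  "up \<theta> = case_nat (Var 0) (\<lambda>i. lift_trm (\<theta> i))"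

primrec subst_atm :: "sub \<Rightarrow> atm \<Rightarrow> atm" where
  "subst_atm \<theta> (Eq t u) = Eq (subst_trm \<theta> t) (subst_trm \<theta> u)"
| "subst_atm \<theta> (Less t u) = Less (subst_trm \<theta> t) (subst_trm \<theta> u)"

primrec subst_fm :: "sub \<Rightarrow> fm \<Rightarrow> fm" where
  "subst_fm \<theta> (Pos a) = Pos (subst_atm \<theta> a)"
| "subst_fm \<theta> (Neg a) = Neg (subst_atm \<theta> a)"
| "subst_fm \<theta> (And A B) = And (subst_fm \<theta> A) (subst_fm \<theta> B)"
| "subst_fm \<theta> (Or A B) = Or (subst_fm \<theta> A) (subst_fm \<theta> B)"
| "subst_fm \<theta> (All A) = All (subst_fm (up \<theta>) A)"
| "subst_fm \<theta> (Ex A) = Ex (subst_fm (up \<theta>) A)"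

text \<open>\<open>inst A t\<close> replaces index 0 by \<open>t\<close> and lowers the other free indices: if \<open>All A\<close> stands for
  \<open>\<forall>x. A(x)\<close>, then \<open>inst A t\<close> stands for \<open>A(t)\<close>.\<close>

definition inst :: "fm \<Rightarrow> trm \<Rightarrow> fm" where
  "inst A t = subst_fm (case_nat t Var) A"

primrec fv_trm :: "trm \<Rightarrow> nat set" where
  "fv_trm (Var i) = {i}"
| "fv_trm Zero = {}"
| "fv_trm (Succ t) = fv_trm t"
| "fv_trm (Add t u) = fv_trm t \<union> fv_trm u"
| "fv_trm (Mul t u) = fv_trm t \<union> fv_trm u"

primrec fv_atm :: "atm \<Rightarrow> nat set" where
  "fv_atm (Eq t u) = fv_trm t \<union> fv_trm u"
| "fv_atm (Less t u) = fv_trm t \<union> fv_trm u"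

primrec fv_fm :: "fm \<Rightarrow> nat set" where
  "fv_fm (Pos a) = fv_atm a"
| "fv_fm (Neg a) = fv_atm a"
| "fv_fm (And A B) = fv_fm A \<union> fv_fm B"
| "fv_fm (Or A B) = fv_fm A \<union> fv_fm B"
| "fv_fm (All A) = {i. Suc i \<in> fv_fm A}"
| "fv_fm (Ex A) = {i. Suc i \<in> fv_fm A}"

primrec neg :: "fm \<Rightarrow> fm" where
  "neg (Pos a) = Neg a"
| "neg (Neg a) = Pos a"
| "neg (And A B) = Or (neg A) (neg B)"
| "neg (Or A B) = And (neg A) (neg B)"
| "neg (All A) = Ex (neg A)"
| "neg (Ex A) = All (neg A)"

definition Imp :: "fm \<Rightarrow> fm \<Rightarrow> fm" where
  "Imp A B = Or (neg A) B"

definition Iff :: "fm \<Rightarrow> fm \<Rightarrow> fm" where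
  "Iff A B = And (Imp A B) (Imp B A)"

definition closure :: "fm \<Rightarrow> fm" where
  "closure A = (All ^^ (LEAST k. fv_fm A \<subseteq> {..<k})) A"

text \<open>The language has no truth constants; the empty disjunction is rendered as \<open>0 \<noteq> 0\<close>.\<close>

fun Disj :: "fm list \<Rightarrow> fm" where
  "Disj [] = Neg (Eq Zero Zero)"
| "Disj [A] = A"
| "Disj (A # B # As) = Or A (Disj (B # As))"


section \<open>The arithmetical hierarchy\<close>

text \<open>Bounded quantifiers are \<open>\<forall>x. x < t \<supset> A\<close> and \<open>\<exists>x. x < t \<and> A\<close> with \<open>x\<close> not in \<open>t\<close>, whence
  the lifting of \<open>t\<close>.\<close>

inductive_set bounded :: "fm set" where
  "Pos a \<in> bounded"
| "Neg a \<in> bounded"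
| "A \<in> bounded \<Longrightarrow> B \<in> bounded \<Longrightarrow> And A B \<in> bounded"
| "A \<in> bounded \<Longrightarrow> B \<in> bounded \<Longrightarrow> Or A B \<in> bounded"
| "A \<in> bounded \<Longrightarrow> All (Or (Neg (Less (Var 0) (lift_trm t))) A) \<in> bounded"
| "A \<in> bounded \<Longrightarrow> Ex (And (Pos (Less (Var 0) (lift_trm t))) A) \<in> bounded"

text \<open>Quantifier blocks may be empty, so that both classes at level \<open>n\<close> are included in both
  classes at level \<open>n + 1\<close>.\<close>

fun Sigma_fms :: "nat \<Rightarrow> fm set" and Pi_fms :: "nat \<Rightarrow> fm set" where
  "Sigma_fms 0 = bounded"
| "Sigma_fms (Suc n) = {(Ex ^^ k) A | k A. A \<in> Pi_fms n}"
| "Pi_fms 0 = bounded"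
| "Pi_fms (Suc n) = {(All ^^ k) A | k A. A \<in> Sigma_fms n}"


section \<open>Sequent calculus for first-order logic with equality\<close>

datatype sequent = Sequent (ante: "fm fset") (succ: "fm fset")  (infix \<open>\<turnstile>\<close> 45)

definition fms :: "sequent \<Rightarrow> fm set" where
  "fms s = fset (ante s) \<union> fset (succ s)"

definition subst_seq :: "sub \<Rightarrow> sequent \<Rightarrow> sequent" where
  "subst_seq \<theta> s = (subst_fm \<theta> |`| ante s \<turnstile> subst_fm \<theta> |`| succ s)"

definition fv_seq :: "sequent \<Rightarrow> nat set" where
  "fv_seq s = (\<Union>A \<in> fms s. fv_fm A)"

text \<open>The label \<open>Sub \<theta>\<close> records the substitution, because traces depend on it.\<close>

datatype rule =
    Id | EqAx | NegAx | QAx | Wk | Cut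
  | AndL | AndR | OrL | OrR | AllL | AllR | ExL | ExR
  | Sub sub

text \<open>\<open>fol_step r ps s\<close>: the sequent \<open>s\<close> follows from the premises \<open>ps\<close> by \<open>r\<close>. As cedents are
  sets, a principal formula may also be a member of the side cedent (implicit contraction).\<close>

inductive fol_step :: "rule \<Rightarrow> sequent list \<Rightarrow> sequent \<Rightarrow> bool" where
  "fol_step Id [] ({|A|} \<turnstile> {|A|})"
| "fol_step EqAx [] ({||} \<turnstile> {|Pos (Eq t t)|})"
| "fol_step EqAx [] ({|Pos (Eq t u), inst A t|} \<turnstile> {|inst A u|})"
| "fol_step NegAx [] ({|A, neg A|} \<turnstile> {||})"
| "fol_step NegAx [] ({||} \<turnstile> {|A, neg A|})"
| "\<Gamma>' |\<subseteq>| \<Gamma> \<Longrightarrow> \<Delta>' |\<subseteq>| \<Delta> \<Longrightarrow> fol_step Wk [\<Gamma>' \<turnstile> \<Delta>'] (\<Gamma> \<turnstile> \<Delta>)"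
| "fol_step Cut [\<Gamma> \<turnstile> finsert A \<Delta>, finsert A \<Gamma> \<turnstile> \<Delta>] (\<Gamma> \<turnstile> \<Delta>)"
| "fol_step AndL [finsert A (finsert B \<Gamma>) \<turnstile> \<Delta>] (finsert (And A B) \<Gamma> \<turnstile> \<Delta>)"
| "fol_step AndR [\<Gamma> \<turnstile> finsert A \<Delta>, \<Gamma> \<turnstile> finsert B \<Delta>] (\<Gamma> \<turnstile> finsert (And A B) \<Delta>)"
| "fol_step OrL [finsert A \<Gamma> \<turnstile> \<Delta>, finsert B \<Gamma> \<turnstile> \<Delta>] (finsert (Or A B) \<Gamma> \<turnstile> \<Delta>)"
| "fol_step OrR [\<Gamma> \<turnstile> finsert A (finsert B \<Delta>)] (\<Gamma> \<turnstile> finsert (Or A B) \<Delta>)"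
| "fol_step AllL [finsert (inst A t) \<Gamma> \<turnstile> \<Delta>] (finsert (All A) \<Gamma> \<turnstile> \<Delta>)"
| "a \<notin> fv_seq (\<Gamma> \<turnstile> finsert (All A) \<Delta>) \<Longrightarrow>
     fol_step AllR [\<Gamma> \<turnstile> finsert (inst A (Var a)) \<Delta>] (\<Gamma> \<turnstile> finsert (All A) \<Delta>)"
| "a \<notin> fv_seq (finsert (Ex A) \<Gamma> \<turnstile> \<Delta>) \<Longrightarrow>
     fol_step ExL [finsert (inst A (Var a)) \<Gamma> \<turnstile> \<Delta>] (finsert (Ex A) \<Gamma> \<turnstile> \<Delta>)"
| "fol_step ExR [\<Gamma> \<turnstile> finsert (inst A t) \<Delta>] (\<Gamma> \<turnstile> finsert (Ex A) \<Delta>)"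
| "fol_step (Sub \<theta>) [s] (subst_seq \<theta> s)"

text \<open>\<open>derives T s\<close>: there is a (finite) derivation of \<open>s\<close> from initial sequents for the
  axioms in \<open>T\<close>. Because of \<open>Sub\<close> this is logical consequence only when \<open>T\<close> consists of
  sentences, as it does for the theories below.\<close>

inductive derives :: "fm set \<Rightarrow> sequent \<Rightarrow> bool" for T where
  "A \<in> T \<Longrightarrow> derives T ({||} \<turnstile> {|A|})"
| "fol_step r ps s \<Longrightarrow> (\<And>p. p \<in> set ps \<Longrightarrow> derives T p) \<Longrightarrow> derives T s"

definition theorem_of :: "fm set \<Rightarrow> fm \<Rightarrow> bool" where
  "theorem_of T A \<longleftrightarrow> derives T ({||} \<turnstile> {|A|})"


section \<open>Robinson arithmetic and fragments of induction\<close>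

text \<open>The axioms with \<open>x\<close>, \<open>y\<close> free as indices 0, 1 (indices 1, 2 under a quantifier).\<close>

definition Q_axioms :: "fm set" where
  "Q_axioms = {
     Neg (Eq (Succ (Var 0)) Zero),
     Imp (Pos (Eq (Succ (Var 0)) (Succ (Var 1)))) (Pos (Eq (Var 0) (Var 1))),
     Imp (Neg (Eq (Var 0) Zero)) (Ex (Pos (Eq (Var 1) (Succ (Var 0))))),
     Pos (Eq (Add (Var 0) Zero) (Var 0)),
     Pos (Eq (Add (Var 0) (Succ (Var 1))) (Succ (Add (Var 0) (Var 1)))),
     Pos (Eq (Mul (Var 0) Zero) Zero),
     Pos (Eq (Mul (Var 0) (Succ (Var 1))) (Add (Mul (Var 0) (Var 1)) (Var 0))),
     Iff (Pos (Less (Var 0) (Var 1)))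
         (Ex (Pos (Eq (Add (Var 1) (Succ (Var 0))) (Var 2))))}"

definition Q :: "fm set" where
  "Q = closure ` Q_axioms"

text \<open>\<open>A(0) \<and> \<forall>x. (A(x) \<supset> A(sx)) \<supset> \<forall>x. A(x)\<close>, the induction variable being index 0; the other
  free variables of \<open>A\<close> are parameters.\<close>

definition induction :: "fm \<Rightarrow> fm" where
  "induction A =
     Imp (And (inst A Zero)
              (All (Imp A (subst_fm (case_nat (Succ (Var 0)) (\<lambda>i. Var (Suc i))) A))))
         (All A)"

definition I_Sigma :: "nat \<Rightarrow> fm set" where
  "I_Sigma n = Q \<union> {closure (induction A) | A. A \<in> Sigma_fms n}"


section \<open>Cyclic proofs\<close>

text \<open>
  Initial sequents for instances of the axioms of Robinson arithmetic. The two axioms with an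
  existential quantifier below a connective are in no class \<open>Sigma_fms n\<close>, so in that form
  they could never occur in a proof containing only such formulae. Therefore they are also
  available as the sequents into which the propositional rules (and, in the last case, the
  left rule for \<open>\<exists>\<close>) decompose them.
\<close>

inductive Q_initial :: "sequent \<Rightarrow> bool" where
  "A \<in> Q_axioms \<Longrightarrow> Q_initial ({||} \<turnstile> {|subst_fm \<theta> A|})"
| "Q_initial ({||} \<turnstile> {|Pos (Eq t Zero), Ex (Pos (Eq (lift_trm t) (Succ (Var 0))))|})"
| "Q_initial ({|Pos (Less t u)|} \<turnstile>
     {|Ex (Pos (Eq (Add (lift_trm t) (Succ (Var 0))) (lift_trm u)))|})"
| "Q_initial ({|Pos (Eq (Add t (Succ r)) u)|} \<turnstile> {|Pos (Less t u)|})"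

inductive arith_step :: "rule \<Rightarrow> sequent list \<Rightarrow> sequent \<Rightarrow> bool" where
  "fol_step r ps s \<Longrightarrow> arith_step r ps s"
| "Q_initial s \<Longrightarrow> arith_step QAx [] s"

codatatype tree = Node (root: sequent) (label: rule) (children: "tree list")

inductive_set subtrees :: "tree \<Rightarrow> tree set" for P where
  "P \<in> subtrees P"
| "S \<in> subtrees P \<Longrightarrow> S' \<in> set (children S) \<Longrightarrow> S' \<in> subtrees P"

definition preproof :: "tree \<Rightarrow> bool" where
  "preproof P \<longleftrightarrow> (\<forall>S \<in> subtrees P. arith_step (label S) (map root (children S)) (root S))"

definition regular :: "tree \<Rightarrow> bool" where
  "regular P \<longleftrightarrow> finite (subtrees P)"

text \<open>A branch is given by the subtrees rooted at its nodes.\<close>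

definition branch :: "tree \<Rightarrow> (nat \<Rightarrow> tree) \<Rightarrow> bool" where
  "branch P b \<longleftrightarrow> b 0 = P \<and> (\<forall>i. b (Suc i) \<in> set (children (b i)))"

text \<open>Terms occurring in a formula. An occurrence of a term under a quantifier counts only if it
  does not involve the quantified variable.\<close>

primrec subterms :: "trm \<Rightarrow> trm set" where
  "subterms (Var i) = {Var i}"
| "subterms Zero = {Zero}"
| "subterms (Succ t) = insert (Succ t) (subterms t)"
| "subterms (Add t u) = insert (Add t u) (subterms t \<union> subterms u)"
| "subterms (Mul t u) = insert (Mul t u) (subterms t \<union> subterms u)"

primrec terms_atm :: "atm \<Rightarrow> trm set" where
  "terms_atm (Eq t u) = subterms t \<union> subterms u"
| "terms_atm (Less t u) = subterms t \<union> subterms u"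

primrec terms_fm :: "fm \<Rightarrow> trm set" where
  "terms_fm (Pos a) = terms_atm a"
| "terms_fm (Neg a) = terms_atm a"
| "terms_fm (And A B) = terms_fm A \<union> terms_fm B"
| "terms_fm (Or A B) = terms_fm A \<union> terms_fm B"
| "terms_fm (All A) = {t. lift_trm t \<in> terms_fm A}"
| "terms_fm (Ex A) = {t. lift_trm t \<in> terms_fm A}"

definition terms_seq :: "sequent \<Rightarrow> trm set" where
  "terms_seq s = (\<Union>A \<in> fms s. terms_fm A)"

text \<open>\<open>precursor S t' t\<close>: \<open>t'\<close> is a precursor of \<open>t\<close> at the step concluding the root of \<open>S\<close>.\<close>

definition precursor :: "tree \<Rightarrow> trm \<Rightarrow> trm \<Rightarrow> bool" where
  "precursor S t' t \<longleftrightarrow>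
     (case label S of
        Sub \<theta> \<Rightarrow> t = subst_trm \<theta> t'
      | _ \<Rightarrow> Pos (Eq t' t) |\<in>| ante (root S) \<or> t' = t)"

definition progress :: "(nat \<Rightarrow> tree) \<Rightarrow> (nat \<Rightarrow> trm) \<Rightarrow> nat \<Rightarrow> bool" where
  "progress b \<tau> i \<longleftrightarrow>
     (\<exists>t. precursor (b i) t (\<tau> i) \<and> Pos (Less (\<tau> (Suc i)) t) |\<in>| ante (root (b (Suc i))))"

text \<open>A trace starting at \<open>m\<close>; the values of \<open>\<tau>\<close> below \<open>m\<close> are irrelevant.\<close>

definition trace :: "(nat \<Rightarrow> tree) \<Rightarrow> nat \<Rightarrow> (nat \<Rightarrow> trm) \<Rightarrow> bool" where
  "trace b m \<tau> \<longleftrightarrow>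
     (\<forall>i \<ge> m. \<tau> i \<in> terms_seq (root (b i)) \<and>
       (precursor (b i) (\<tau> (Suc i)) (\<tau> i) \<or> progress b \<tau> i))"

definition cyclic_proof :: "tree \<Rightarrow> bool" where
  "cyclic_proof P \<longleftrightarrow>
     preproof P \<and> regular P \<and>
     (\<forall>b. branch P b \<longrightarrow> (\<exists>m \<tau>. trace b m \<tau> \<and> infinite {i. m \<le> i \<and> progress b \<tau> i}))"

text \<open>A sequent is read as the formula \<open>\<And>\<Gamma> \<supset> \<Or>\<Delta>\<close>, that is, the disjunction of the negations of the
  members of \<open>\<Gamma>\<close> and the members of \<open>\<Delta>\<close>. Cedents being sets, every enumeration of them is
  admitted.\<close>

definition C_Sigma :: "nat \<Rightarrow> fm set" where
  "C_Sigma n =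
     {closure (Disj (map neg As @ Bs)) | As Bs P.
        cyclic_proof P \<and> (\<forall>S \<in> subtrees P. fms (root S) \<subseteq> Sigma_fms n) \<and>
        root P = (fset_of_list As \<turnstile> fset_of_list Bs)}"

end

theory Submission
  imports Defs "HOL-Library.Countable_Set"
begin

text \<open>
  By soundness and completeness it suffices that the conclusion of a cyclic proof of \<open>\<Sigma>\<^sub>n\<close> formulae
  holds in every model \<open>M\<close> of \<open>I\<Sigma>\<^sub>n\<^sub>+\<^sub>1\<close>. A falsified sequent has a falsified premise, along which
  the values of traces do not increase and drop at progress points. Iterating this inside a
  nonstandard \<open>M\<close> is avoided: a Safra-style determinisation of traces turns the global trace condition
  into a parity condition on a finite graph of states, and a parity condition yields a lexicographic
  descent of fixed finite length. The least number principle for \<open>\<Sigma>\<^sub>n\<^sub>+\<^sub>1\<close> sets, applied once for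
  each priority, then excludes falsified sequents; these form a \<open>\<Sigma>\<^sub>n\<^sub>+\<^sub>1\<close> set because falsity of a
  sequent is a Boolean combination of \<open>\<Sigma>\<^sub>n\<close> formulae.
\<close>

section \<open>Semantics\<close>

text \<open>A nonstandard model is ill-founded, so an endless chain of falsified premises with ever
  smaller values is not contradictory in itself: least elements are only available for nonempty sets
  definable at the right level. Hence assignments are not iterated. One works with a definable
  family of sets of assignments in which every member has a successor in the family, and each round
  shrinks this family. Its complexity does not grow from round to round: a least value enters the
  next family as a parameter, and a restriction to certain states only replaces some of finitely
  many sets by the empty set.

  The trace condition concerns genuine infinite branches. It is therefore used outside the model,
  for paths in the finite graph of states, and only to show that steps of an even minimal priority
  cannot recur forever. Surviving names can be renumbered below the number \<open>names\<close> of
  terms in the proof; so priorities lie between 0 and \<open>2 * names\<close>, and one round per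
  priority suffices.\<close>

datatype 'a interp =
  Interp (Zer: 'a) (Suc_op: "'a \<Rightarrow> 'a") (Add_op: "'a \<Rightarrow> 'a \<Rightarrow> 'a") (Mul_op: "'a \<Rightarrow> 'a \<Rightarrow> 'a")
    (Less_rel: "'a \<Rightarrow> 'a \<Rightarrow> bool")

primrec eval :: "'a interp \<Rightarrow> (nat \<Rightarrow> 'a) \<Rightarrow> trm \<Rightarrow> 'a" where
  "eval M \<rho> (Var i) = \<rho> i"
| "eval M \<rho> Zero = Zer M"
| "eval M \<rho> (Succ t) = Suc_op M (eval M \<rho> t)"
| "eval M \<rho> (Add t u) = Add_op M (eval M \<rho> t) (eval M \<rho> u)"
| "eval M \<rho> (Mul t u) = Mul_op M (eval M \<rho> t) (eval M \<rho> u)"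

primrec sat_atm :: "'a interp \<Rightarrow> (nat \<Rightarrow> 'a) \<Rightarrow> atm \<Rightarrow> bool" where
  "sat_atm M \<rho> (Eq t u) \<longleftrightarrow> eval M \<rho> t = eval M \<rho> u"
| "sat_atm M \<rho> (Less t u) \<longleftrightarrow> Less_rel M (eval M \<rho> t) (eval M \<rho> u)"

primrec sat :: "'a interp \<Rightarrow> (nat \<Rightarrow> 'a) \<Rightarrow> fm \<Rightarrow> bool" where
  "sat M \<rho> (Pos a) \<longleftrightarrow> sat_atm M \<rho> a"
| "sat M \<rho> (Neg a) \<longleftrightarrow> \<not> sat_atm M \<rho> a"
| "sat M \<rho> (And A B) \<longleftrightarrow> sat M \<rho> A \<and> sat M \<rho> B"
| "sat M \<rho> (Or A B) \<longleftrightarrow> sat M \<rho> A \<or> sat M \<rho> B"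
| "sat M \<rho> (All A) \<longleftrightarrow> (\<forall>x. sat M (case_nat x \<rho>) A)"
| "sat M \<rho> (Ex A) \<longleftrightarrow> (\<exists>x. sat M (case_nat x \<rho>) A)"

definition sat_seq :: "'a interp \<Rightarrow> (nat \<Rightarrow> 'a) \<Rightarrow> sequent \<Rightarrow> bool" where
  "sat_seq M \<rho> s \<longleftrightarrow> ((\<forall>A \<in> fset (ante s). sat M \<rho> A) \<longrightarrow> (\<exists>A \<in> fset (succ s). sat M \<rho> A))"

definition valid :: "'a interp \<Rightarrow> fm \<Rightarrow> bool" where
  "valid M A \<longleftrightarrow> (\<forall>\<rho>. sat M \<rho> A)"

section \<open>Substitution and dependence on free variables\<close>

lemma eval_subst_trm: "eval M \<rho> (subst_trm \<theta> t) = eval M (\<lambda>i. eval M \<rho> (\<theta> i)) t"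
  by (induction t) auto

lemma eval_lift_trm [simp]: "eval M (case_nat x \<rho>) (lift_trm t) = eval M \<rho> t"
  by (simp add: lift_trm_def eval_subst_trm)

lemma sat_atm_subst: "sat_atm M \<rho> (subst_atm \<theta> a) = sat_atm M (\<lambda>i. eval M \<rho> (\<theta> i)) a"
  by (cases a) (auto simp: eval_subst_trm)

lemma eval_up: "(\<lambda>i. eval M (case_nat x \<rho>) (up \<theta> i)) = case_nat x (\<lambda>i. eval M \<rho> (\<theta> i))"
  by (auto simp: fun_eq_iff up_def split: nat.split)

lemma sat_subst_fm: "sat M \<rho> (subst_fm \<theta> A) = sat M (\<lambda>i. eval M \<rho> (\<theta> i)) A"
  by (induction A arbitrary: \<rho> \<theta>) (auto simp: sat_atm_subst eval_up)

lemma sat_inst: "sat M \<rho> (inst A t) = sat M (case_nat (eval M \<rho> t) \<rho>) A"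
proof -
  have "(\<lambda>i. eval M \<rho> (case_nat t Var i)) = case_nat (eval M \<rho> t) \<rho>"
    by (auto simp: fun_eq_iff split: nat.split)
  then show ?thesis by (simp add: inst_def sat_subst_fm)
qed

lemma eval_cong: "(\<And>i. i \<in> fv_trm t \<Longrightarrow> \<rho> i = \<sigma> i) \<Longrightarrow> eval M \<rho> t = eval M \<sigma> t"
  by (induction t) auto

lemma sat_atm_cong: "(\<And>i. i \<in> fv_atm a \<Longrightarrow> \<rho> i = \<sigma> i) \<Longrightarrow> sat_atm M \<rho> a = sat_atm M \<sigma> a"
proof (cases a)
  case (Eq t u)
  assume "\<And>i. i \<in> fv_atm a \<Longrightarrow> \<rho> i = \<sigma> i"
  then have "eval M \<rho> t = eval M \<sigma> t" "eval M \<rho> u = eval M \<sigma> u" using Eq by (intro eval_cong; simp)+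
  then show ?thesis using Eq by simp
next
  case (Less t u)
  assume "\<And>i. i \<in> fv_atm a \<Longrightarrow> \<rho> i = \<sigma> i"
  then have "eval M \<rho> t = eval M \<sigma> t" "eval M \<rho> u = eval M \<sigma> u" using Less by (intro eval_cong; simp)+
  then show ?thesis using Less by simp
qed

lemma sat_cong: "(\<And>i. i \<in> fv_fm A \<Longrightarrow> \<rho> i = \<sigma> i) \<Longrightarrow> sat M \<rho> A = sat M \<sigma> A"
proof (induction A arbitrary: \<rho> \<sigma>)
  case (All A)
  have "sat M (case_nat x \<rho>) A = sat M (case_nat x \<sigma>) A" for x
    by (rule All.IH) (use All.prems in \<open>auto split: nat.split\<close>)
  then show ?case by simp
next
  case (Ex A)
  have "sat M (case_nat x \<rho>) A = sat M (case_nat x \<sigma>) A" for x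
    by (rule Ex.IH) (use Ex.prems in \<open>auto split: nat.split\<close>)
  then show ?case by simp
next
  case (And A B)
  have "sat M \<rho> A = sat M \<sigma> A" by (rule And.IH) (use And.prems in auto)
  moreover have "sat M \<rho> B = sat M \<sigma> B" by (rule And.IH) (use And.prems in auto)
  ultimately show ?case by simp
next
  case (Or A B)
  have "sat M \<rho> A = sat M \<sigma> A" by (rule Or.IH) (use Or.prems in auto)
  moreover have "sat M \<rho> B = sat M \<sigma> B" by (rule Or.IH) (use Or.prems in auto)
  ultimately show ?case by simp
next
  case (Pos a)
  then show ?case using sat_atm_cong[of a \<rho> \<sigma>] by simp
next
  case (Neg a)
  then show ?case using sat_atm_cong[of a \<rho> \<sigma>] by simp
qed

lemma sat_neg [simp]: "sat M \<rho> (neg A) \<longleftrightarrow> \<not> sat M \<rho> A"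
  by (induction A arbitrary: \<rho>) auto

lemma sat_Imp [simp]: "sat M \<rho> (Imp A B) \<longleftrightarrow> (sat M \<rho> A \<longrightarrow> sat M \<rho> B)"
  by (auto simp: Imp_def)

lemma sat_Iff [simp]: "sat M \<rho> (Iff A B) \<longleftrightarrow> (sat M \<rho> A \<longleftrightarrow> sat M \<rho> B)"
  by (auto simp: Iff_def)

lemma sat_Disj: "sat M \<rho> (Disj As) \<longleftrightarrow> (\<exists>A \<in> set As. sat M \<rho> A)"
  by (induction As rule: Disj.induct) auto

lemma valid_All [simp]: "valid M (All A) \<longleftrightarrow> valid M A"
proof -
  have "sat M \<rho> A" if "valid M (All A)" for \<rho>
  proof -
    have "\<rho> = case_nat (\<rho> 0) (\<lambda>i. \<rho> (Suc i))" by (auto simp: fun_eq_iff split: nat.split)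
    then show ?thesis using that by (metis sat.simps(5) valid_def)
  qed
  then show ?thesis by (auto simp: valid_def)
qed

lemma valid_closure [simp]: "valid M (closure A) \<longleftrightarrow> valid M A"
proof -
  have "valid M ((All ^^ k) A) \<longleftrightarrow> valid M A" for k by (induction k) auto
  then show ?thesis by (simp add: closure_def)
qed

lemma finite_fv_trm [simp]: "finite (fv_trm t)"
  by (induction t) auto

lemma finite_fv_fm [simp]: "finite (fv_fm A)"
proof (induction A)
  case (Pos a) then show ?case by (cases a) auto
next
  case (Neg a) then show ?case by (cases a) auto
next
  case (All A)
  then have "finite (Suc -` fv_fm A)" by (intro finite_vimageI) auto
  then show ?case by (simp add: vimage_def)
next
  case (Ex A)
  then have "finite (Suc -` fv_fm A)" by (intro finite_vimageI) auto
  then show ?case by (simp add: vimage_def)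
qed auto

lemma finite_fms [simp]: "finite (fms s)"
  by (simp add: fms_def)

lemma finite_fv_seq [simp]: "finite (fv_seq s)"
  by (simp add: fv_seq_def)

lemma fv_closure [simp]: "fv_fm (closure A) = {}"
proof -
  have *: "fv_fm ((All ^^ k) A) = {i. i + k \<in> fv_fm A}" for k by (induction k) auto
  have "\<exists>k. fv_fm A \<subseteq> {..<k}"
    using finite_nat_iff_bounded finite_fv_fm by blast
  then have "fv_fm A \<subseteq> {..<(LEAST k. fv_fm A \<subseteq> {..<k})}" by (rule LeastI_ex)
  then show ?thesis unfolding closure_def * by auto
qed

lemma sat_seq_cong:
  assumes "\<And>i. i \<in> fv_seq s \<Longrightarrow> \<rho> i = \<sigma> i"
  shows "sat_seq M \<rho> s = sat_seq M \<sigma> s"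
proof -
  have "sat M \<rho> A = sat M \<sigma> A" if "A \<in> fms s" for A
    by (rule sat_cong) (use that assms in \<open>auto simp: fv_seq_def\<close>)
  then show ?thesis by (auto simp: sat_seq_def fms_def)
qed

lemma sat_seq_subst: "sat_seq M \<rho> (subst_seq \<theta> s) = sat_seq M (\<lambda>i. eval M \<rho> (\<theta> i)) s"
  by (auto simp: sat_seq_def subst_seq_def sat_subst_fm)

lemma sat_eigenvariable:
  assumes "a \<notin> {i. Suc i \<in> fv_fm A}"
  shows "sat M (\<rho>(a := x)) (inst A (Var a)) = sat M (case_nat x \<rho>) A"
  unfolding sat_inst by (rule sat_cong) (use assms in \<open>auto split: nat.split\<close>)

section \<open>Soundness of a single inference and of derivations\<close>

text \<open>The assignment falsifying the premise is kept explicit because it determines the values of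
  the terms on a trace.\<close>

definition successor :: "'a interp \<Rightarrow> rule \<Rightarrow> sequent \<Rightarrow> (nat \<Rightarrow> 'a) \<Rightarrow> (nat \<Rightarrow> 'a) \<Rightarrow> bool" where
  "successor M r s \<rho> \<rho>' \<longleftrightarrow>
     (case r of Sub \<theta> \<Rightarrow> \<rho>' = (\<lambda>i. eval M \<rho> (\<theta> i)) | _ \<Rightarrow> (\<forall>i \<in> fv_seq s. \<rho>' i = \<rho> i))"

text \<open>Local soundness read upwards. An axiom has no premises, so the claim says that it cannot
  be falsified. Apart from \<open>Sub\<close> and the two eigenvariable rules, \<open>\<rho>\<close>
  itself falsifies a premise.\<close>

lemma fol_step_falsified:
  assumes "fol_step r ps s" and "\<not> sat_seq M \<rho> s"
  shows "\<exists>p \<in> set ps. \<exists>\<rho>'. \<not> sat_seq M \<rho>' p \<and> successor M r s \<rho> \<rho>'"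
  using assms
proof cases
  case (13 a \<Gamma> A \<Delta>)
  obtain x where x: "\<not> sat M (case_nat x \<rho>) A"
    using assms(2) 13 by (auto simp: sat_seq_def)
  \<comment> \<open>The eigenvariable does not occur in the conclusion, so redirecting it to the
    counterexample \<open>x\<close> leaves the side formulae and the agreement required by
    \<open>successor\<close> intact.\<close>
  have *: "sat_seq M (\<rho>(a := x)) s = sat_seq M \<rho> s"
    by (rule sat_seq_cong) (use 13 in auto)
  have "a \<notin> {i. Suc i \<in> fv_fm A}" using 13 by (auto simp: fv_seq_def fms_def)
  then have "\<not> sat M (\<rho>(a := x)) (inst A (Var a))" using x by (subst sat_eigenvariable) auto
  then have "\<not> sat_seq M (\<rho>(a := x)) (\<Gamma> \<turnstile> finsert (inst A (Var a)) \<Delta>)"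
    using * assms(2) 13(3) by (auto simp: sat_seq_def)
  moreover have "successor M r s \<rho> (\<rho>(a := x))" using 13 by (auto simp: successor_def)
  ultimately show ?thesis using 13 by auto
next
  case (14 a A \<Gamma> \<Delta>)
  obtain x where x: "sat M (case_nat x \<rho>) A"
    using assms(2) 14 by (auto simp: sat_seq_def)
  have *: "sat_seq M (\<rho>(a := x)) s = sat_seq M \<rho> s"
    by (rule sat_seq_cong) (use 14 in auto)
  have "a \<notin> {i. Suc i \<in> fv_fm A}" using 14 by (auto simp: fv_seq_def fms_def)
  then have "sat M (\<rho>(a := x)) (inst A (Var a))" using x by (subst sat_eigenvariable) auto
  then have "\<not> sat_seq M (\<rho>(a := x)) (finsert (inst A (Var a)) \<Gamma> \<turnstile> \<Delta>)"
    using * assms(2) 14(3) by (auto simp: sat_seq_def)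
  moreover have "successor M r s \<rho> (\<rho>(a := x))" using 14 by (auto simp: successor_def)
  ultimately show ?thesis using 14 by auto
next
  case (16 \<theta> s')
  then show ?thesis using assms(2) by (auto simp: successor_def sat_seq_subst)
next
  case 1
  then show ?thesis using assms(2) by (fastforce simp: sat_seq_def successor_def sat_inst)
next
  case 2
  then show ?thesis using assms(2) by (fastforce simp: sat_seq_def successor_def sat_inst)
next
  case 3
  then show ?thesis using assms(2) by (fastforce simp: sat_seq_def successor_def sat_inst)
next
  case 4
  then show ?thesis using assms(2) by (fastforce simp: sat_seq_def successor_def sat_inst)
next
  case 5
  then show ?thesis using assms(2) by (fastforce simp: sat_seq_def successor_def sat_inst)
next
  case 6
  then show ?thesis using assms(2) by (fastforce simp: sat_seq_def successor_def sat_inst)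
next
  case 7
  then show ?thesis using assms(2) by (fastforce simp: sat_seq_def successor_def sat_inst)
next
  case 8
  then show ?thesis using assms(2) by (fastforce simp: sat_seq_def successor_def sat_inst)
next
  case 9
  then show ?thesis using assms(2) by (fastforce simp: sat_seq_def successor_def sat_inst)
next
  case 10
  then show ?thesis using assms(2) by (fastforce simp: sat_seq_def successor_def sat_inst)
next
  case 11
  then show ?thesis using assms(2) by (fastforce simp: sat_seq_def successor_def sat_inst)
next
  case 12
  then show ?thesis using assms(2) by (fastforce simp: sat_seq_def successor_def sat_inst)
next
  case 15
  then show ?thesis using assms(2) by (fastforce simp: sat_seq_def successor_def sat_inst)
qed

text \<open>Falsity may pass to a premise under another assignment, hence the induction over all
  \<open>\<rho>\<close>. Validity of \<open>T\<close>, rather than truth under one assignment, is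
  what survives \<open>Sub\<close>.\<close>

lemma derives_sound:
  assumes "derives T s" and "\<forall>A \<in> T. valid M A"
  shows "sat_seq M \<rho> s"
  using assms(1)
proof (induction arbitrary: \<rho> rule: derives.induct)
  case (1 A)
  then show ?case using assms(2) by (auto simp: sat_seq_def valid_def)
next
  case (2 r ps s)
  then show ?case using fol_step_falsified by blast
qed

section \<open>Completeness\<close>

instance trm :: countable by countable_datatype
instance atm :: countable by countable_datatype
instance fm :: countable by countable_datatype

section \<open>Composition of substitutions\<close>

lemma subst_trm_comp: "subst_trm \<sigma> (subst_trm \<theta> t) = subst_trm (\<lambda>i. subst_trm \<sigma> (\<theta> i)) t"
  by (induction t) auto

lemma subst_trm_lift [simp]: "subst_trm (case_nat t \<theta>) (lift_trm u) = subst_trm \<theta> u"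
  by (simp add: lift_trm_def subst_trm_comp)

lemma subst_trm_up_lift: "subst_trm (up \<theta>) (lift_trm u) = lift_trm (subst_trm \<theta> u)"
  by (simp add: up_def lift_trm_def subst_trm_comp)

lemma up_comp: "(\<lambda>i. subst_trm (up \<sigma>) (up \<theta> i)) = up (\<lambda>i. subst_trm \<sigma> (\<theta> i))"
proof
  fix i show "subst_trm (up \<sigma>) (up \<theta> i) = up (\<lambda>i. subst_trm \<sigma> (\<theta> i)) i"
  proof (cases i)
    case 0 then show ?thesis by (simp add: up_def)
  next
    case (Suc j)
    then show ?thesis using subst_trm_up_lift[of \<sigma> "\<theta> j"] by (simp add: up_def)
  qed
qed

lemma subst_atm_comp: "subst_atm \<sigma> (subst_atm \<theta> a) = subst_atm (\<lambda>i. subst_trm \<sigma> (\<theta> i)) a"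
  by (cases a) (auto simp: subst_trm_comp)

lemma subst_fm_comp: "subst_fm \<sigma> (subst_fm \<theta> A) = subst_fm (\<lambda>i. subst_trm \<sigma> (\<theta> i)) A"
  by (induction A arbitrary: \<sigma> \<theta>) (auto simp: subst_atm_comp up_comp)

lemma subst_trm_Var [simp]: "subst_trm Var t = t"
  by (induction t) auto

lemma up_Var [simp]: "up Var = Var"
  by (auto simp: fun_eq_iff up_def lift_trm_def split: nat.split)

lemma subst_atm_Var [simp]: "subst_atm Var a = a"
  by (cases a) auto

lemma subst_fm_Var [simp]: "subst_fm Var A = A"
  by (induction A) auto

lemma subst_trm_cong: "(\<And>i. i \<in> fv_trm t \<Longrightarrow> \<sigma> i = \<theta> i) \<Longrightarrow> subst_trm \<sigma> t = subst_trm \<theta> t"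
  by (induction t) auto

lemma subst_atm_cong:
  assumes "\<And>i. i \<in> fv_atm a \<Longrightarrow> \<sigma> i = \<theta> i"
  shows "subst_atm \<sigma> a = subst_atm \<theta> a"
proof (cases a)
  case (Eq t u)
  then have "subst_trm \<sigma> t = subst_trm \<theta> t" "subst_trm \<sigma> u = subst_trm \<theta> u"
    using assms by (intro subst_trm_cong; simp)+
  then show ?thesis using Eq by simp
next
  case (Less t u)
  then have "subst_trm \<sigma> t = subst_trm \<theta> t" "subst_trm \<sigma> u = subst_trm \<theta> u"
    using assms by (intro subst_trm_cong; simp)+
  then show ?thesis using Less by simp
qed

lemma subst_fm_cong: "(\<And>i. i \<in> fv_fm A \<Longrightarrow> \<sigma> i = \<theta> i) \<Longrightarrow> subst_fm \<sigma> A = subst_fm \<theta> A"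
proof (induction A arbitrary: \<sigma> \<theta>)
  case (And A B)
  have "subst_fm \<sigma> A = subst_fm \<theta> A" by (rule And.IH) (use And.prems in auto)
  moreover have "subst_fm \<sigma> B = subst_fm \<theta> B" by (rule And.IH) (use And.prems in auto)
  ultimately show ?case by simp
next
  case (Or A B)
  have "subst_fm \<sigma> A = subst_fm \<theta> A" by (rule Or.IH) (use Or.prems in auto)
  moreover have "subst_fm \<sigma> B = subst_fm \<theta> B" by (rule Or.IH) (use Or.prems in auto)
  ultimately show ?case by simp
next
  case (All A)
  have "subst_fm (up \<sigma>) A = subst_fm (up \<theta>) A"
    by (rule All.IH) (use All.prems in \<open>auto simp: up_def split: nat.split\<close>)
  then show ?case by simp
next
  case (Ex A)
  have "subst_fm (up \<sigma>) A = subst_fm (up \<theta>) A"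
    by (rule Ex.IH) (use Ex.prems in \<open>auto simp: up_def split: nat.split\<close>)
  then show ?case by simp
next
  case (Pos a)
  then show ?case using subst_atm_cong[of a \<sigma> \<theta>] by simp
next
  case (Neg a)
  then show ?case using subst_atm_cong[of a \<sigma> \<theta>] by simp
qed

lemma subst_fm_closed:
  assumes "fv_fm A = {}"
  shows "subst_fm \<theta> A = A"
proof -
  have "subst_fm \<theta> A = subst_fm Var A" by (rule subst_fm_cong) (use assms in auto)
  then show ?thesis by simp
qed

lemma inst_subst_up: "inst (subst_fm (up \<theta>) A) t = subst_fm (case_nat t \<theta>) A"
proof -
  have "(\<lambda>i. subst_trm (case_nat t Var) (up \<theta> i)) = case_nat t \<theta>"
    by (auto simp: fun_eq_iff up_def split: nat.split)
  then show ?thesis by (simp add: inst_def subst_fm_comp)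
qed

lemma derives_Id: "A |\<in>| \<Gamma> \<Longrightarrow> A |\<in>| \<Delta> \<Longrightarrow> derives T (\<Gamma> \<turnstile> \<Delta>)"
  by (rule derives.intros(2)[OF fol_step.intros(6)[of "{|A|}" _ "{|A|}"]])
    (auto intro: derives.intros(2)[OF fol_step.intros(1)])

lemma derives_Wk: "derives T (\<Gamma> \<turnstile> \<Delta>) \<Longrightarrow> \<Gamma> |\<subseteq>| \<Gamma>' \<Longrightarrow> \<Delta> |\<subseteq>| \<Delta>' \<Longrightarrow> derives T (\<Gamma>' \<turnstile> \<Delta>')"
  by (rule derives.intros(2)[OF fol_step.intros(6)]) auto

text \<open>The two halves of a maximal underivable, infinite sequent. Witnesses are terms of the
  given language: sequents being finite, free variables can play the role of Henkin
  constants.\<close>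

locale saturated =
  fixes T G D :: "fm set"
  assumes consistent: "fset \<Gamma> \<subseteq> G \<Longrightarrow> fset \<Delta> \<subseteq> D \<Longrightarrow> \<not> derives T (\<Gamma> \<turnstile> \<Delta>)"
    and total: "A \<in> G \<or> A \<in> D"
    and witness_Ex: "Ex A \<in> G \<Longrightarrow> \<exists>t. inst A t \<in> G"
    and witness_All: "All A \<in> D \<Longrightarrow> \<exists>t. inst A t \<in> D"
begin

lemma mem_succ: "derives T (\<Gamma> \<turnstile> \<Delta>) \<Longrightarrow> fset \<Gamma> \<subseteq> G \<Longrightarrow> \<exists>A \<in> fset \<Delta>. A \<in> G"
  using consistent total by blast

lemma D_iff: "A \<in> D \<longleftrightarrow> A \<notin> G"
  using consistent[of "{|A|}" "{|A|}"] total derives_Id[of A "{|A|}" "{|A|}"] by auto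

lemma axiom_mem: "A \<in> T \<Longrightarrow> A \<in> G"
  using mem_succ[of "{||}" "{|A|}"] derives.intros(1) by auto

lemma Neg_mem: "Neg a \<in> G \<longleftrightarrow> Pos a \<notin> G"
proof -
  have 1: "derives T ({|Pos a, Neg a|} \<turnstile> {||})"
    using derives.intros(2)[OF fol_step.intros(4)[of "Pos a"]] by simp
  have 2: "derives T ({||} \<turnstile> {|Pos a, Neg a|})"
    using derives.intros(2)[OF fol_step.intros(5)[of "Pos a"]] by simp
  show ?thesis using mem_succ[OF 1] mem_succ[OF 2] by auto
qed

lemma And_mem: "And A B \<in> G \<longleftrightarrow> A \<in> G \<and> B \<in> G"
proof -
  have 1: "derives T ({|And A B|} \<turnstile> {|A|})" "derives T ({|And A B|} \<turnstile> {|B|})"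
    by (rule derives.intros(2)[OF fol_step.intros(8)]; auto intro: derives_Id)+
  have 2: "derives T ({|A, B|} \<turnstile> {|And A B|})"
    by (rule derives.intros(2)[OF fol_step.intros(9)[of _ A "{||}" B]]) (auto intro: derives_Id)
  have "And A B \<in> G \<Longrightarrow> A \<in> G" "And A B \<in> G \<Longrightarrow> B \<in> G" using mem_succ[OF 1(1)] mem_succ[OF 1(2)] by simp_all
  moreover have "A \<in> G \<Longrightarrow> B \<in> G \<Longrightarrow> And A B \<in> G" using mem_succ[OF 2] by simp
  ultimately show ?thesis by blast
qed

lemma Or_mem: "Or A B \<in> G \<longleftrightarrow> A \<in> G \<or> B \<in> G"
proof -
  have 1: "derives T ({|A|} \<turnstile> {|Or A B|})" "derives T ({|B|} \<turnstile> {|Or A B|})"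
    by (rule derives.intros(2)[OF fol_step.intros(11)]; auto intro: derives_Id)+
  have 2: "derives T ({|Or A B|} \<turnstile> {|A, B|})"
    by (rule derives.intros(2)[OF fol_step.intros(10)[of A "{||}" _ B]]) (auto intro: derives_Id)
  have "A \<in> G \<Longrightarrow> Or A B \<in> G" "B \<in> G \<Longrightarrow> Or A B \<in> G" using mem_succ[OF 1(1)] mem_succ[OF 1(2)] by simp_all
  moreover have "Or A B \<in> G \<Longrightarrow> A \<in> G \<or> B \<in> G" using mem_succ[OF 2] by simp
  ultimately show ?thesis by blast
qed

lemma All_mem: "All A \<in> G \<longleftrightarrow> (\<forall>t. inst A t \<in> G)"
proof -
  have *: "derives T ({|All A|} \<turnstile> {|inst A t|})" for t
    by (rule derives.intros(2)[OF fol_step.intros(12)]) (auto intro: derives_Id)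
  have "All A \<in> G \<Longrightarrow> inst A t \<in> G" for t using mem_succ[OF *[of t]] by auto
  then show ?thesis using witness_All D_iff by blast
qed

lemma Ex_mem: "Ex A \<in> G \<longleftrightarrow> (\<exists>t. inst A t \<in> G)"
proof -
  have *: "derives T ({|inst A t|} \<turnstile> {|Ex A|})" for t
    by (rule derives.intros(2)[OF fol_step.intros(15)]) (auto intro: derives_Id)
  have "inst A t \<in> G \<Longrightarrow> Ex A \<in> G" for t using mem_succ[OF *[of t]] by auto
  then show ?thesis using witness_Ex by blast
qed

lemma closure_mem:
  assumes "closure A \<in> G"
  shows "subst_fm \<theta> A \<in> G"
proof -
  \<comment> \<open>The outermost of the \<open>k + 1\<close> quantifiers binds index
    \<open>k\<close> of \<open>A\<close>, so it is instantiated with \<open>\<theta> k\<close>; the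
    induction then continues with \<open>case_nat (\<theta> k) \<sigma>\<close>.\<close>
  have *: "subst_fm \<sigma> ((All ^^ k) A) \<in> G \<Longrightarrow> subst_fm (\<lambda>i. if i < k then \<theta> i else \<sigma> (i - k)) A \<in> G"
    for k \<sigma>
  proof (induction k arbitrary: \<sigma>)
    case (Suc k)
    have "inst (subst_fm (up \<sigma>) ((All ^^ k) A)) (\<theta> k) \<in> G"
      using Suc.prems All_mem by auto
    then have "subst_fm (\<lambda>i. if i < k then \<theta> i else case_nat (\<theta> k) \<sigma> (i - k)) A \<in> G"
      using Suc.IH by (simp add: inst_subst_up)
    moreover have "(\<lambda>i. if i < k then \<theta> i else case_nat (\<theta> k) \<sigma> (i - k)) =
        (\<lambda>i. if i < Suc k then \<theta> i else \<sigma> (i - Suc k))"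
    proof
      fix i
      consider "i < k" | "i = k" | j where "i = Suc (k + j)" by (metis less_imp_Suc_add linorder_neqE_nat)
      then show "(if i < k then \<theta> i else case_nat (\<theta> k) \<sigma> (i - k)) =
          (if i < Suc k then \<theta> i else \<sigma> (i - Suc k))"
        by cases (auto simp: Suc_diff_le)
    qed
    ultimately show ?case by simp
  qed simp
  define k where "k = (LEAST k. fv_fm A \<subseteq> {..<k})"
  have "\<exists>k. fv_fm A \<subseteq> {..<k}" using finite_nat_iff_bounded finite_fv_fm by blast
  then have k: "fv_fm A \<subseteq> {..<k}" unfolding k_def by (rule LeastI_ex)
  have "subst_fm (\<lambda>i. if i < k then \<theta> i else Var (i - k)) A \<in> G"
    by (rule *) (use assms in \<open>simp add: closure_def k_def\<close>)
  moreover have "subst_fm (\<lambda>i. if i < k then \<theta> i else Var (i - k)) A = subst_fm \<theta> A"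
    by (rule subst_fm_cong) (use k in auto)
  ultimately show ?thesis by simp
qed

definition eqv :: "trm \<Rightarrow> trm \<Rightarrow> bool" where
  "eqv t u \<longleftrightarrow> Pos (Eq t u) \<in> G"

lemma eqv_refl [simp]: "eqv t t"
proof -
  have *: "derives T ({||} \<turnstile> {|Pos (Eq t t)|})"
    by (rule derives.intros(2)[OF fol_step.intros(2)]) auto
  show ?thesis using mem_succ[OF *] by (simp add: eqv_def)
qed

lemma eqv_replace:
  assumes "eqv t u" and "inst A t \<in> G"
  shows "inst A u \<in> G"
proof -
  have *: "derives T ({|Pos (Eq t u), inst A t|} \<turnstile> {|inst A u|})"
    by (rule derives.intros(2)[OF fol_step.intros(3)]) auto
  show ?thesis using mem_succ[OF *] assms by (simp add: eqv_def)
qed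

lemma eqv_sym: "eqv t u \<Longrightarrow> eqv u t"
  using eqv_replace[of t u "Pos (Eq (Var 0) (lift_trm t))"] eqv_refl[of t, unfolded eqv_def]
  by (simp add: inst_def eqv_def)

lemma eqv_trans: "eqv s t \<Longrightarrow> eqv t u \<Longrightarrow> eqv s u"
  using eqv_replace[of t u "Pos (Eq (lift_trm s) (Var 0))"] by (simp add: inst_def eqv_def)

lemma eqv_Succ: "eqv t u \<Longrightarrow> eqv (Succ t) (Succ u)"
  using eqv_replace[of t u "Pos (Eq (Succ (lift_trm t)) (Succ (Var 0)))"] eqv_refl[of "Succ t", unfolded eqv_def]
  by (simp add: inst_def eqv_def)

lemma eqv_Add:
  assumes "eqv t u" and "eqv t' u'"
  shows "eqv (Add t t') (Add u u')"
proof -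
  have "eqv (Add t t') (Add u t')"
    using eqv_replace[of t u "Pos (Eq (Add (lift_trm t) (lift_trm t')) (Add (Var 0) (lift_trm t')))"]
      eqv_refl[of "Add t t'", unfolded eqv_def] assms by (simp add: inst_def eqv_def)
  moreover have "eqv (Add u t') (Add u u')"
    using eqv_replace[of t' u' "Pos (Eq (Add (lift_trm u) (lift_trm t')) (Add (lift_trm u) (Var 0)))"]
      eqv_refl[of "Add u t'", unfolded eqv_def] assms by (simp add: inst_def eqv_def)
  ultimately show ?thesis by (rule eqv_trans)
qed

lemma eqv_Mul:
  assumes "eqv t u" and "eqv t' u'"
  shows "eqv (Mul t t') (Mul u u')"
proof -
  have "eqv (Mul t t') (Mul u t')"
    using eqv_replace[of t u "Pos (Eq (Mul (lift_trm t) (lift_trm t')) (Mul (Var 0) (lift_trm t')))"]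
      eqv_refl[of "Mul t t'", unfolded eqv_def] assms by (simp add: inst_def eqv_def)
  moreover have "eqv (Mul u t') (Mul u u')"
    using eqv_replace[of t' u' "Pos (Eq (Mul (lift_trm u) (lift_trm t')) (Mul (lift_trm u) (Var 0)))"]
      eqv_refl[of "Mul u t'", unfolded eqv_def] assms by (simp add: inst_def eqv_def)
  ultimately show ?thesis by (rule eqv_trans)
qed

lemma Less_replace:
  assumes "eqv t u" and "eqv t' u'" and "Pos (Less t t') \<in> G"
  shows "Pos (Less u u') \<in> G"
proof -
  have "Pos (Less u t') \<in> G"
    using eqv_replace[of t u "Pos (Less (Var 0) (lift_trm t'))"] assms by (simp add: inst_def)
  then show ?thesis
    using eqv_replace[of t' u' "Pos (Less (lift_trm u) (Var 0))"] assms by (simp add: inst_def)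
qed

text \<open>The successor axioms keep the numerals pairwise inequivalent. With infinitely many
  classes, \<open>to_nat_on\<close> identifies the quotient of the terms with all of
  \<open>nat\<close>.\<close>

lemma infinite_classes:
  assumes "Q \<subseteq> T"
  shows "infinite (range (\<lambda>t. {u. eqv t u}))"
proof -
  have S0: "\<not> eqv (Succ t) Zero" for t
  proof -
    have "closure (Neg (Eq (Succ (Var 0)) Zero)) \<in> G"
      by (rule axiom_mem) (use assms in \<open>auto simp: Q_def Q_axioms_def\<close>)
    from closure_mem[OF this, of "\<lambda>_. t"] show ?thesis by (simp add: Neg_mem eqv_def)
  qed
  have SS: "eqv t u" if "eqv (Succ t) (Succ u)" for t u
  proof -
    have "closure (Imp (Pos (Eq (Succ (Var 0)) (Succ (Var 1)))) (Pos (Eq (Var 0) (Var 1)))) \<in> G"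
      by (rule axiom_mem) (use assms in \<open>auto simp: Q_def Q_axioms_def\<close>)
    from closure_mem[OF this, of "case_nat t (\<lambda>_. u)"] show ?thesis
      using that by (simp add: Neg_mem Or_mem Imp_def eqv_def)
  qed
  have num: "eqv ((Succ ^^ m) Zero) ((Succ ^^ n) Zero) \<Longrightarrow> m = n" for m n
  proof (induction m arbitrary: n)
    case 0
    then show ?case using S0 eqv_sym by (cases n) auto
  next
    case (Suc m)
    then show ?case using S0 SS by (cases n) auto
  qed
  have "inj (\<lambda>n. {u. eqv ((Succ ^^ n) Zero) u})"
  proof (rule injI)
    fix m n assume "{u. eqv ((Succ ^^ m) Zero) u} = {u. eqv ((Succ ^^ n) Zero) u}"
    then have "(Succ ^^ n) Zero \<in> {u. eqv ((Succ ^^ m) Zero) u}" using eqv_refl by blast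
    then have "eqv ((Succ ^^ m) Zero) ((Succ ^^ n) Zero)" by (rule CollectD)
    then show "m = n" by (rule num)
  qed
  then have "infinite (range (\<lambda>n. {u. eqv ((Succ ^^ n) Zero) u}))" by (rule range_inj_infinite)
  then show ?thesis by (rule contrapos_nn) (erule finite_subset[rotated], auto)
qed

lemma model:
  assumes "Q \<subseteq> T" and closed: "\<And>A. A \<in> T \<Longrightarrow> fv_fm A = {}"
  shows "\<exists>(M :: nat interp) \<rho>. (\<forall>A \<in> T. valid M A) \<and> (\<forall>A. sat M \<rho> A \<longleftrightarrow> A \<in> G)"
proof -
  define S where "S = range (\<lambda>t. {u. eqv t u})"
  define \<pi> where "\<pi> t = to_nat_on S {u. eqv t u}" for t
  have bij: "bij_betw (to_nat_on S) S UNIV"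
    by (rule to_nat_on_infinite) (use infinite_classes[OF assms(1)] in \<open>auto simp: S_def\<close>)
  have \<pi>_eq: "\<pi> t = \<pi> u \<longleftrightarrow> eqv t u" for t u
  proof -
    have "\<pi> t = \<pi> u \<longleftrightarrow> {s. eqv t s} = {s. eqv u s}"
      unfolding \<pi>_def by (rule inj_on_eq_iff[OF bij_betw_imp_inj_on[OF bij]]) (auto simp: S_def)
    also have "\<dots> \<longleftrightarrow> (\<forall>s. eqv t s \<longleftrightarrow> eqv u s)" by (simp add: set_eq_iff)
    also have "\<dots> \<longleftrightarrow> eqv t u" using eqv_sym eqv_trans eqv_refl by meson
    finally show ?thesis .
  qed
  define r where "r n = (SOME t. \<pi> t = n)" for n
  have \<pi>_r [simp]: "\<pi> (r n) = n" for n
  proof -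
    have "n \<in> to_nat_on S ` S" using bij by (simp add: bij_betw_def)
    then have "\<exists>t. \<pi> t = n" by (auto simp: S_def \<pi>_def)
    then show ?thesis unfolding r_def by (rule someI_ex)
  qed
  have r_\<pi>: "eqv (r (\<pi> t)) t" for t by (simp flip: \<pi>_eq)
  define M where "M = Interp (\<pi> Zero) (\<lambda>n. \<pi> (Succ (r n))) (\<lambda>m n. \<pi> (Add (r m) (r n)))
    (\<lambda>m n. \<pi> (Mul (r m) (r n))) (\<lambda>m n. Pos (Less (r m) (r n)) \<in> G)"
  have eval: "eval M (\<lambda>i. \<pi> (\<theta> i)) t = \<pi> (subst_trm \<theta> t)" for \<theta> t
    by (induction t) (auto simp: M_def \<pi>_eq r_\<pi> intro: eqv_Succ eqv_Add eqv_Mul)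
  have Less: "Less_rel M (\<pi> t) (\<pi> u) \<longleftrightarrow> Pos (Less t u) \<in> G" for t u
    using Less_replace[OF r_\<pi>[of t] r_\<pi>[of u]]
      Less_replace[OF eqv_sym[OF r_\<pi>[of t]] eqv_sym[OF r_\<pi>[of u]]]
    by (auto simp: M_def)
  have atm: "sat_atm M (\<lambda>i. \<pi> (\<theta> i)) a \<longleftrightarrow> Pos (subst_atm \<theta> a) \<in> G" for \<theta> a
    by (cases a) (auto simp: eval Less \<pi>_eq eqv_def)
  have case_nat_\<pi>: "case_nat (\<pi> t) (\<lambda>i. \<pi> (\<theta> i)) = (\<lambda>i. \<pi> (case_nat t \<theta> i))" for t \<theta>
    by (auto simp: fun_eq_iff split: nat.split)
  \<comment> \<open>A general \<open>\<theta>\<close> is required by the quantifier cases, which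
    extend it. As \<open>\<pi>\<close> is onto, every assignment has the form
    \<open>\<pi> (\<theta> i)\<close>, which gives validity of the closed axioms below.\<close>
  have truth: "sat M (\<lambda>i. \<pi> (\<theta> i)) A \<longleftrightarrow> subst_fm \<theta> A \<in> G" for \<theta> A
  proof (induction A arbitrary: \<theta>)
    case (All A)
    have "sat M (\<lambda>i. \<pi> (\<theta> i)) (All A) \<longleftrightarrow> (\<forall>t. sat M (case_nat (\<pi> t) (\<lambda>i. \<pi> (\<theta> i))) A)"
      by (auto, metis \<pi>_r)
    also have "\<dots> \<longleftrightarrow> (\<forall>t. subst_fm (case_nat t \<theta>) A \<in> G)" by (simp only: case_nat_\<pi> All.IH)
    also have "\<dots> \<longleftrightarrow> subst_fm \<theta> (All A) \<in> G" by (simp add: All_mem inst_subst_up)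
    finally show ?case .
  next
    case (Ex A)
    have "sat M (\<lambda>i. \<pi> (\<theta> i)) (Ex A) \<longleftrightarrow> (\<exists>t. sat M (case_nat (\<pi> t) (\<lambda>i. \<pi> (\<theta> i))) A)"
      by (auto, metis \<pi>_r)
    also have "\<dots> \<longleftrightarrow> (\<exists>t. subst_fm (case_nat t \<theta>) A \<in> G)" by (simp only: case_nat_\<pi> Ex.IH)
    also have "\<dots> \<longleftrightarrow> subst_fm \<theta> (Ex A) \<in> G" by (simp add: Ex_mem inst_subst_up)
    finally show ?case .
  qed (auto simp: atm Neg_mem And_mem Or_mem)
  have "valid M A" if "A \<in> T" for A
    unfolding valid_def
  proof
    fix \<rho>
    have "A \<in> G" using that by (rule axiom_mem)
    then show "sat M \<rho> A" using truth[of "\<lambda>i. r (\<rho> i)" A] closed[OF that] by (simp add: subst_fm_closed)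
  qed
  moreover have "sat M (\<lambda>i. \<pi> (Var i)) A \<longleftrightarrow> A \<in> G" for A using truth[of Var A] by simp
  ultimately show ?thesis by blast
qed

end

definition seq_le :: "sequent \<Rightarrow> sequent \<Rightarrow> bool" where
  "seq_le s s' \<longleftrightarrow> ante s |\<subseteq>| ante s' \<and> succ s |\<subseteq>| succ s'"

text \<open>A formula enters together with its witness, so a single enumeration of the formulae
  completes the construction.\<close>

definition decides :: "sequent \<Rightarrow> fm \<Rightarrow> bool" where
  "decides s A \<longleftrightarrow>
     A |\<in>| ante s \<and> (\<forall>B. A = Ex B \<longrightarrow> (\<exists>a. inst B (Var a) |\<in>| ante s)) \<or>
     A |\<in>| succ s \<and> (\<forall>B. A = All B \<longrightarrow> (\<exists>a. inst B (Var a) |\<in>| succ s))"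

lemma extend_to_decide:
  assumes "\<not> derives T s"
  shows "\<exists>s'. \<not> derives T s' \<and> seq_le s s' \<and> decides s' A"
proof -
  obtain \<Gamma> \<Delta> where s: "s = (\<Gamma> \<turnstile> \<Delta>)" by (cases s)
  have fresh: "\<exists>a. a \<notin> fv_seq s'" for s'
    using finite_fv_seq[of s'] by (metis ex_new_if_finite infinite_UNIV_nat)
  have "\<not> derives T (\<Gamma> \<turnstile> finsert A \<Delta>) \<or> \<not> derives T (finsert A \<Gamma> \<turnstile> \<Delta>)"
    using assms derives.intros(2)[OF fol_step.intros(7)[of \<Gamma> A \<Delta>]] s by auto
  then show ?thesis
  proof
    assume nd: "\<not> derives T (\<Gamma> \<turnstile> finsert A \<Delta>)"
    show ?thesis
    proof (cases "\<exists>B. A = All B")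
      case True
      then obtain B where B: "A = All B" by blast
      \<comment> \<open>The principal formula is listed twice so that a copy stays in the side
        cedent: by implicit contraction, the premise of the rule still contains
        \<open>All B\<close>.\<close>
      obtain a where a: "a \<notin> fv_seq (\<Gamma> \<turnstile> finsert (All B) (finsert (All B) \<Delta>))" using fresh by blast
      have "\<not> derives T (\<Gamma> \<turnstile> finsert (inst B (Var a)) (finsert (All B) \<Delta>))"
        using nd derives.intros(2)[OF fol_step.intros(13)[OF a]] B by auto
      then show ?thesis using B s
        by (intro exI[of _ "\<Gamma> \<turnstile> finsert (inst B (Var a)) (finsert (All B) \<Delta>)"])
          (auto simp: seq_le_def decides_def)
    next
      case False
      then show ?thesis using nd s
        by (intro exI[of _ "\<Gamma> \<turnstile> finsert A \<Delta>"]) (auto simp: seq_le_def decides_def)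
    qed
  next
    assume nd: "\<not> derives T (finsert A \<Gamma> \<turnstile> \<Delta>)"
    show ?thesis
    proof (cases "\<exists>B. A = Ex B")
      case True
      then obtain B where B: "A = Ex B" by blast
      obtain a where a: "a \<notin> fv_seq (finsert (Ex B) (finsert (Ex B) \<Gamma>) \<turnstile> \<Delta>)" using fresh by blast
      have "\<not> derives T (finsert (inst B (Var a)) (finsert (Ex B) \<Gamma>) \<turnstile> \<Delta>)"
        using nd derives.intros(2)[OF fol_step.intros(14)[OF a]] B by auto
      then show ?thesis using B s
        by (intro exI[of _ "finsert (inst B (Var a)) (finsert (Ex B) \<Gamma>) \<turnstile> \<Delta>"])
          (auto simp: seq_le_def decides_def)
    next
      case False
      then show ?thesis using nd s
        by (intro exI[of _ "finsert A \<Gamma> \<turnstile> \<Delta>"]) (auto simp: seq_le_def decides_def)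
    qed
  qed
qed

text \<open>The compactness step: a finite cedent inside the union of a chain already lies in one
  stage and in all later ones.\<close>

lemma fset_subset_chain:
  assumes "\<And>i. f i |\<subseteq>| f (Suc i)" and "fset X \<subseteq> (\<Union>i. fset (f i))"
  shows "\<exists>k. \<forall>j \<ge> k. X |\<subseteq>| f j"
  using assms(2)
proof (induction X)
  case empty
  then show ?case by auto
next
  case (insert A X)
  have mono: "f i |\<subseteq>| f j" if "i \<le> j" for i j
    using that assms(1) by (induction j) (auto simp: le_Suc_eq)
  from insert obtain k where k: "\<forall>j \<ge> k. X |\<subseteq>| f j" by auto
  from insert.prems obtain i where i: "A |\<in>| f i" by auto
  have "finsert A X |\<subseteq>| f j" if "j \<ge> max i k" for j
    using that k i mono[of i j] by auto
  then show ?case by blast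
qed

lemma saturated_extension:
  assumes "\<not> derives T s"
  shows "\<exists>G D. saturated T G D \<and> fset (ante s) \<subseteq> G \<and> fset (succ s) \<subseteq> D"
proof -
  \<comment> \<open>Stage \<open>n + 1\<close> decides the \<open>n\<close>-th formula. The clause
    for \<open>n = 0\<close> makes the chain given by dependent choice start at
    \<open>s\<close>.\<close>
  have "\<exists>f. \<forall>n. (\<not> derives T (f n) \<and> (n = 0 \<longrightarrow> f n = s)) \<and>
      (seq_le (f n) (f (Suc n)) \<and> decides (f (Suc n)) (from_nat n))"
  proof (rule dependent_nat_choice)
    show "\<exists>x. \<not> derives T x \<and> (0 = 0 \<longrightarrow> x = s)" using assms by blast
    show "\<exists>y. (\<not> derives T y \<and> (Suc n = 0 \<longrightarrow> y = s)) \<and> seq_le x y \<and> decides y (from_nat n)"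
      if "\<not> derives T x \<and> (n = 0 \<longrightarrow> x = s)" for x n
      using extend_to_decide[of T x "from_nat n"] that by blast
  qed
  then obtain f where f: "\<And>n. \<not> derives T (f n)" "f 0 = s" "\<And>n. seq_le (f n) (f (Suc n))"
    "\<And>n. decides (f (Suc n)) (from_nat n)" by metis
  define G D where "G = (\<Union>i. fset (ante (f i)))" and "D = (\<Union>i. fset (succ (f i)))"
  have dec: "\<exists>n. decides (f n) A" for A using f(4)[of "to_nat A"] by auto
  have cons: "\<not> derives T (\<Gamma> \<turnstile> \<Delta>)" if "fset \<Gamma> \<subseteq> G" "fset \<Delta> \<subseteq> D" for \<Gamma> \<Delta>
  proof -
    have "\<exists>k. \<forall>j \<ge> k. \<Gamma> |\<subseteq>| ante (f j)"
      by (rule fset_subset_chain) (use that f(3) in \<open>simp_all add: seq_le_def G_def\<close>)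
    then obtain k where k: "\<forall>j \<ge> k. \<Gamma> |\<subseteq>| ante (f j)" by blast
    have "\<exists>k. \<forall>j \<ge> k. \<Delta> |\<subseteq>| succ (f j)"
      by (rule fset_subset_chain) (use that f(3) in \<open>simp_all add: seq_le_def D_def\<close>)
    then obtain l where l: "\<forall>j \<ge> l. \<Delta> |\<subseteq>| succ (f j)" by blast
    have "\<Gamma> |\<subseteq>| ante (f (max k l))" "\<Delta> |\<subseteq>| succ (f (max k l))" using k l by auto
    then show ?thesis using f(1)[of "max k l"] derives_Wk by (metis sequent.collapse)
  qed
  have disj: "A \<notin> D" if "A \<in> G" for A
    using cons[of "{|A|}" "{|A|}"] that derives_Id[of A "{|A|}" "{|A|}"] by auto
  have "saturated T G D"
  proof
    show "\<not> derives T (\<Gamma> \<turnstile> \<Delta>)" if "fset \<Gamma> \<subseteq> G" "fset \<Delta> \<subseteq> D" for \<Gamma> \<Delta> using cons that .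
    show "A \<in> G \<or> A \<in> D" for A using dec[of A] by (auto simp: decides_def G_def D_def)
    show "\<exists>t. inst A t \<in> G" if "Ex A \<in> G" for A
      using dec[of "Ex A"] disj[OF that] by (auto simp: decides_def G_def D_def)
    show "\<exists>t. inst A t \<in> D" if "All A \<in> D" for A
      using dec[of "All A"] disj that by (force simp: decides_def G_def D_def)
  qed
  moreover have "fset (ante s) \<subseteq> G" "fset (succ s) \<subseteq> D" using f(2) by (auto simp: G_def D_def)
  ultimately show ?thesis by blast
qed

text \<open>Validity cannot be quantified over all carrier types inside one statement; the countable
  term model allows the hypothesis to range over models on \<open>nat\<close> only. Closedness of
  the axioms matches the presence of \<open>Sub\<close> in \<open>derives\<close>.\<close>

theorem completeness:
  assumes "Q \<subseteq> T" and "\<And>A. A \<in> T \<Longrightarrow> fv_fm A = {}"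
    and "\<And>M :: nat interp. (\<And>A. A \<in> T \<Longrightarrow> valid M A) \<Longrightarrow> valid M B"
  shows "theorem_of T B"
  unfolding theorem_of_def
proof (rule ccontr)
  assume "\<not> derives T ({||} \<turnstile> {|B|})"
  from saturated_extension[OF this] obtain G D where GD: "saturated T G D" "B \<in> D" by auto
  interpret saturated T G D by (rule GD(1))
  from model[OF assms(1,2)] obtain M :: "nat interp" and \<rho>
    where M: "\<forall>A \<in> T. valid M A" "\<forall>A. sat M \<rho> A \<longleftrightarrow> A \<in> G" by blast
  have "valid M B" by (rule assms(3)) (use M(1) in blast)
  then have "B \<in> G" using M(2) unfolding valid_def by blast
  then show False using GD(2) D_iff by simp
qed

section \<open>Definable predicates\<close>

lemma bounded_subst: "A \<in> bounded \<Longrightarrow> subst_fm \<theta> A \<in> bounded"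
proof (induction A arbitrary: \<theta> rule: bounded.induct)
  case (5 A t)
  then show ?case using bounded.intros(5) by (simp add: subst_trm_up_lift) (simp add: up_def bounded.intros)
next
  case (6 A t)
  then show ?case using bounded.intros(6) by (simp add: subst_trm_up_lift) (simp add: up_def bounded.intros)
qed (auto intro: bounded.intros)

lemma bounded_neg: "A \<in> bounded \<Longrightarrow> neg A \<in> bounded"
  by (induction A rule: bounded.induct) (auto intro: bounded.intros)

lemma subst_Ex_block: "\<exists>\<sigma>. subst_fm \<theta> ((Ex ^^ k) A) = (Ex ^^ k) (subst_fm \<sigma> A)"
  by (induction k arbitrary: \<theta>) auto

lemma subst_All_block: "\<exists>\<sigma>. subst_fm \<theta> ((All ^^ k) A) = (All ^^ k) (subst_fm \<sigma> A)"
  by (induction k arbitrary: \<theta>) auto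

lemma hierarchy_subst:
  "(A \<in> Sigma_fms n \<longrightarrow> subst_fm \<theta> A \<in> Sigma_fms n) \<and> (A \<in> Pi_fms n \<longrightarrow> subst_fm \<theta> A \<in> Pi_fms n)"
proof (induction n arbitrary: A \<theta>)
  case (Suc n)
  have "subst_fm \<theta> ((Ex ^^ k) B) \<in> Sigma_fms (Suc n)" if "B \<in> Pi_fms n" for k B
  proof -
    obtain \<sigma> where "subst_fm \<theta> ((Ex ^^ k) B) = (Ex ^^ k) (subst_fm \<sigma> B)"
      using subst_Ex_block by blast
    then show ?thesis using that Suc.IH[of B \<sigma>] by auto
  qed
  moreover have "subst_fm \<theta> ((All ^^ k) B) \<in> Pi_fms (Suc n)" if "B \<in> Sigma_fms n" for k B
  proof -
    obtain \<sigma> where "subst_fm \<theta> ((All ^^ k) B) = (All ^^ k) (subst_fm \<sigma> B)"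
      using subst_All_block by blast
    then show ?thesis using that Suc.IH[of B \<sigma>] by auto
  qed
  ultimately show ?case by auto
qed (auto intro: bounded_subst)

lemma neg_Ex_block: "neg ((Ex ^^ k) A) = (All ^^ k) (neg A)"
  by (induction k) auto

lemma neg_All_block: "neg ((All ^^ k) A) = (Ex ^^ k) (neg A)"
  by (induction k) auto

lemma hierarchy_neg:
  "(A \<in> Sigma_fms n \<longrightarrow> neg A \<in> Pi_fms n) \<and> (A \<in> Pi_fms n \<longrightarrow> neg A \<in> Sigma_fms n)"
proof (induction n arbitrary: A)
  case (Suc n)
  have "neg ((Ex ^^ k) B) \<in> Pi_fms (Suc n)" if "B \<in> Pi_fms n" for k B
    using that Suc.IH[of B] by (auto simp: neg_Ex_block)
  moreover have "neg ((All ^^ k) B) \<in> Sigma_fms (Suc n)" if "B \<in> Sigma_fms n" for k B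
    using that Suc.IH[of B] by (auto simp: neg_All_block)
  ultimately show ?case by auto
qed (auto intro: bounded_neg)

lemma bounded_subset_hierarchy: "bounded \<subseteq> Sigma_fms n \<and> bounded \<subseteq> Pi_fms n"
proof (induction n)
  case (Suc n)
  have "A \<in> Sigma_fms (Suc n)" "A \<in> Pi_fms (Suc n)" if "A \<in> bounded" for A
    using that Suc funpow_0[of Ex A] funpow_0[of All A] by (auto, metis subsetD, metis subsetD)
  then show ?case by blast
qed auto

section \<open>The hierarchy of sets definable with parameters\<close>

text \<open>Variables of a formula are mapped either to coordinates of the assignment or to parameters.\<close>

definition env :: "(nat \<Rightarrow> nat + 'a) \<Rightarrow> (nat \<Rightarrow> 'a) \<Rightarrow> nat \<Rightarrow> 'a" where
  "env g \<rho> i = (case g i of Inl j \<Rightarrow> \<rho> j | Inr c \<Rightarrow> c)"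

inductive_set ex_closure :: "((nat \<Rightarrow> 'a) \<Rightarrow> bool) set \<Rightarrow> ((nat \<Rightarrow> 'a) \<Rightarrow> bool) set" for C where
  base: "P \<in> C \<Longrightarrow> P \<in> ex_closure C"
| ex: "P \<in> ex_closure C \<Longrightarrow> (\<lambda>\<rho>. \<exists>x. P (case_nat x \<rho>)) \<in> ex_closure C"

abbreviation complements :: "((nat \<Rightarrow> 'a) \<Rightarrow> bool) set \<Rightarrow> ((nat \<Rightarrow> 'a) \<Rightarrow> bool) set" where
  "complements C \<equiv> (\<lambda>P \<rho>. \<not> P \<rho>) ` C"

text \<open>Membership includes parameters, and quantifier blocks absorb conjunctions and disjunctions, so no
  pairing function or collection principle is needed.\<close>

primrec Sigma_def :: "'a interp \<Rightarrow> nat \<Rightarrow> ((nat \<Rightarrow> 'a) \<Rightarrow> bool) set" where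
  "Sigma_def M 0 = {\<lambda>\<rho>. sat M (env g \<rho>) A | g A. A \<in> bounded}"
| "Sigma_def M (Suc n) = ex_closure (complements (Sigma_def M n))"

lemma complements_iff: "P \<in> complements C \<longleftrightarrow> (\<lambda>\<rho>. \<not> P \<rho>) \<in> C"
proof
  assume "(\<lambda>\<rho>. \<not> P \<rho>) \<in> C"
  then have "(\<lambda>\<rho>. \<not> (\<lambda>\<rho>. \<not> P \<rho>) \<rho>) \<in> complements C" by (rule imageI)
  then show "P \<in> complements C" by simp
qed auto

definition reindex_closed :: "((nat \<Rightarrow> 'a) \<Rightarrow> bool) set \<Rightarrow> bool" where
  "reindex_closed C \<longleftrightarrow> (\<forall>P \<in> C. \<forall>g. (\<lambda>\<rho>. P (env g \<rho>)) \<in> C)"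

definition conj_closed :: "((nat \<Rightarrow> 'a) \<Rightarrow> bool) set \<Rightarrow> bool" where
  "conj_closed C \<longleftrightarrow> (\<forall>P \<in> C. \<forall>R \<in> C. (\<lambda>\<rho>. P \<rho> \<and> R \<rho>) \<in> C)"

definition disj_closed :: "((nat \<Rightarrow> 'a) \<Rightarrow> bool) set \<Rightarrow> bool" where
  "disj_closed C \<longleftrightarrow> (\<forall>P \<in> C. \<forall>R \<in> C. (\<lambda>\<rho>. P \<rho> \<or> R \<rho>) \<in> C)"

lemma env_env: "env g (env h \<rho>) = env (\<lambda>i. case g i of Inl j \<Rightarrow> h j | Inr c \<Rightarrow> Inr c) \<rho>"
  by (auto simp: env_def fun_eq_iff split: sum.split)

lemma env_shift: "env (\<lambda>i. Inl (Suc i)) (case_nat x \<rho>) = \<rho>"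
  by (auto simp: env_def)

lemma case_nat_env:
  "case_nat x (env g \<rho>) = env (case_nat (Inl 0) (\<lambda>i. map_sum Suc id (g i))) (case_nat x \<rho>)"
  by (auto simp: env_def fun_eq_iff split: nat.split sum.split)

lemma ex_closure_reindex:
  assumes "reindex_closed C"
  shows "reindex_closed (ex_closure C)"
  unfolding reindex_closed_def
proof (intro ballI allI)
  fix P g assume "P \<in> ex_closure C"
  then show "(\<lambda>\<rho>. P (env g \<rho>)) \<in> ex_closure C"
  proof (induction arbitrary: g)
    case (base P)
    then show ?case using assms by (auto simp: reindex_closed_def intro: ex_closure.base)
  next
    case (ex P)
    from ex_closure.ex[OF ex.IH] show ?case by (subst case_nat_env)
  qed
qed

text \<open>Prenexing for a connective \<open>J\<close> that commutes with \<open>\<exists>\<close>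
  on both sides, as conjunction does, and disjunction too because carriers are nonempty. When a
  quantifier of one predicate is pulled out, the coordinates of the other are shifted past the new
  coordinate 0.\<close>

lemma ex_closure_conj_gen:
  assumes C: "reindex_closed C" and J: "\<And>P R. P \<in> C \<Longrightarrow> R \<in> C \<Longrightarrow> (\<lambda>\<rho>. J (P \<rho>) (R \<rho>)) \<in> C"
    and J1: "\<And>f b. J (\<exists>x :: 'a. f x) b \<longleftrightarrow> (\<exists>x. J (f x) b)"
    and J2: "\<And>f b. J b (\<exists>x :: 'a. f x) \<longleftrightarrow> (\<exists>x. J b (f x))"
    and "P \<in> ex_closure C" and "R \<in> ex_closure C"
  shows "(\<lambda>\<rho> :: nat \<Rightarrow> 'a. J (P \<rho>) (R \<rho>)) \<in> ex_closure C"
  using assms(5,6)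
proof (induction arbitrary: R)
  case (base P)
  from base(2,1) show ?case
  proof (induction arbitrary: P)
    case (base R)
    then show ?case using J by (auto intro: ex_closure.base)
  next
    case (ex R)
    have "(\<lambda>\<rho>. P (env (\<lambda>i. Inl (Suc i)) \<rho>)) \<in> C" using ex C by (auto simp: reindex_closed_def)
    from ex_closure.ex[OF ex.IH[OF this]] show ?case by (simp add: env_shift J2)
  qed
next
  case (ex P)
  have "(\<lambda>\<rho>. R (env (\<lambda>i. Inl (Suc i)) \<rho>)) \<in> ex_closure C"
    using ex.prems ex_closure_reindex[OF C] by (auto simp: reindex_closed_def)
  from ex_closure.ex[OF ex.IH[OF this]] show ?case by (simp add: env_shift J1)
qed

text \<open>Two predicates given by formulae over different environments are merged into one formula
  by moving the variables of the first to even and those of the second to odd indices.\<close>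

lemma even_odd_env:
  "(\<lambda>i. env (\<lambda>i. if even i then g (i div 2) else h (i div 2)) \<rho> (2 * i)) = env g \<rho>"
  "(\<lambda>i. env (\<lambda>i. if even i then g (i div 2) else h (i div 2)) \<rho> (Suc (2 * i))) = env h \<rho>"
  by (auto simp: env_def fun_eq_iff)

lemma bounded_closed:
  "reindex_closed (Sigma_def M 0) \<and> conj_closed (Sigma_def M 0) \<and> disj_closed (Sigma_def M 0)
    \<and> (\<forall>P \<in> Sigma_def M 0. (\<lambda>\<rho>. \<not> P \<rho>) \<in> Sigma_def M 0)"
proof (intro conjI)
  show "reindex_closed (Sigma_def M 0)"
    unfolding reindex_closed_def
  proof (intro ballI allI)
    fix P g assume "P \<in> Sigma_def M 0"
    then obtain h A where "P = (\<lambda>\<rho>. sat M (env h \<rho>) A)" "A \<in> bounded" by auto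
    then show "(\<lambda>\<rho>. P (env g \<rho>)) \<in> Sigma_def M 0"
      unfolding Sigma_def.simps(1) by (simp only: env_env) blast
  qed
  have J: "(\<lambda>\<rho>. J (sat M (env g \<rho>) A) (sat M (env h \<rho>) B)) \<in> Sigma_def M 0"
    if "A \<in> bounded" "B \<in> bounded" and F: "\<And>A B. A \<in> bounded \<Longrightarrow> B \<in> bounded \<Longrightarrow> F A B \<in> bounded"
      "\<And>\<rho> A B. sat M \<rho> (F A B) = J (sat M \<rho> A) (sat M \<rho> B)" for A B g h J F
  proof -
    let ?A = "subst_fm (\<lambda>i. Var (2 * i)) A" and ?B = "subst_fm (\<lambda>i. Var (Suc (2 * i))) B"
    have "F ?A ?B \<in> bounded" using that by (intro F(1) bounded_subst)
    then have "(\<lambda>\<rho>. sat M (env (\<lambda>i. if even i then g (i div 2) else h (i div 2)) \<rho>) (F ?A ?B)) \<in> Sigma_def M 0"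
      unfolding Sigma_def.simps(1) by blast
    then show ?thesis by (simp add: F(2) sat_subst_fm even_odd_env)
  qed
  show "conj_closed (Sigma_def M 0)"
    unfolding conj_closed_def
  proof (intro ballI)
    fix P R assume "P \<in> Sigma_def M 0" "R \<in> Sigma_def M 0"
    then obtain g A h B where "P = (\<lambda>\<rho>. sat M (env g \<rho>) A)" "R = (\<lambda>\<rho>. sat M (env h \<rho>) B)"
      and AB: "A \<in> bounded" "B \<in> bounded" by auto
    then show "(\<lambda>\<rho>. P \<rho> \<and> R \<rho>) \<in> Sigma_def M 0"
      using J[OF AB, of And "(\<and>)" g h] bounded.intros(3) by (simp del: Sigma_def.simps)
  qed
  show "disj_closed (Sigma_def M 0)"
    unfolding disj_closed_def
  proof (intro ballI)
    fix P R assume "P \<in> Sigma_def M 0" "R \<in> Sigma_def M 0"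
    then obtain g A h B where "P = (\<lambda>\<rho>. sat M (env g \<rho>) A)" "R = (\<lambda>\<rho>. sat M (env h \<rho>) B)"
      and AB: "A \<in> bounded" "B \<in> bounded" by auto
    then show "(\<lambda>\<rho>. P \<rho> \<or> R \<rho>) \<in> Sigma_def M 0"
      using J[OF AB, of Or "(\<or>)" g h] bounded.intros(4) by (simp del: Sigma_def.simps)
  qed
  have "(\<lambda>\<rho>. \<not> sat M (env g \<rho>) A) \<in> Sigma_def M 0" if "A \<in> bounded" for g A
  proof -
    have "(\<lambda>\<rho>. sat M (env g \<rho>) (neg A)) \<in> Sigma_def M 0"
      using bounded_neg[OF that] unfolding Sigma_def.simps by blast
    then show ?thesis by simp
  qed
  then show "\<forall>P \<in> Sigma_def M 0. (\<lambda>\<rho>. \<not> P \<rho>) \<in> Sigma_def M 0" by auto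
qed

lemma complements_closed:
  fixes C :: "((nat \<Rightarrow> 'a) \<Rightarrow> bool) set"
  assumes "reindex_closed C" "conj_closed C" "disj_closed C"
  shows "reindex_closed (complements C)" "conj_closed (complements C)" "disj_closed (complements C)"
proof -
  have 1: "(\<lambda>\<rho>. \<not> (P \<rho> \<and> R \<rho>)) = (\<lambda>\<rho>. \<not> P \<rho> \<or> \<not> R \<rho>)"
    "(\<lambda>\<rho>. \<not> (P \<rho> \<or> R \<rho>)) = (\<lambda>\<rho>. \<not> P \<rho> \<and> \<not> R \<rho>)" for P R :: "(nat \<Rightarrow> 'a) \<Rightarrow> bool"
    by auto
  show "reindex_closed (complements C)" "conj_closed (complements C)" "disj_closed (complements C)"
    using assms by (auto simp only: reindex_closed_def conj_closed_def disj_closed_def complements_iff 1 not_not)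
qed

lemma Sigma_def_closed:
  "reindex_closed (Sigma_def M n) \<and> conj_closed (Sigma_def M n) \<and> disj_closed (Sigma_def M n)"
proof (induction n)
  case 0
  then show ?case using bounded_closed by blast
next
  case (Suc n)
  let ?C = "complements (Sigma_def M n)"
  note C = complements_closed[of "Sigma_def M n"]
  have "reindex_closed (ex_closure ?C)" using ex_closure_reindex C(1) Suc by blast
  moreover have "conj_closed (ex_closure ?C)"
    using C Suc unfolding conj_closed_def[of "ex_closure ?C"]
    by (intro ballI ex_closure_conj_gen[where J = "(\<and>)"]) (auto simp: conj_closed_def)
  moreover have "disj_closed (ex_closure ?C)"
    using C Suc unfolding disj_closed_def[of "ex_closure ?C"]
    by (intro ballI ex_closure_conj_gen[where J = "(\<or>)"]) (auto simp: disj_closed_def)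
  ultimately show ?case by simp
qed

lemma Sigma_def_reindex: "P \<in> Sigma_def M n \<Longrightarrow> (\<lambda>\<rho>. P (env g \<rho>)) \<in> Sigma_def M n"
  using Sigma_def_closed[of M n] by (auto simp: reindex_closed_def)

lemma Sigma_def_conj:
  "P \<in> Sigma_def M n \<Longrightarrow> R \<in> Sigma_def M n \<Longrightarrow> (\<lambda>\<rho>. P \<rho> \<and> R \<rho>) \<in> Sigma_def M n"
  using Sigma_def_closed[of M n] by (auto simp: conj_closed_def)

lemma Sigma_def_disj:
  "P \<in> Sigma_def M n \<Longrightarrow> R \<in> Sigma_def M n \<Longrightarrow> (\<lambda>\<rho>. P \<rho> \<or> R \<rho>) \<in> Sigma_def M n"
  using Sigma_def_closed[of M n] by (auto simp: disj_closed_def)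

lemma Sigma_def_ex:
  "P \<in> Sigma_def M (Suc n) \<Longrightarrow> (\<lambda>\<rho>. \<exists>x. P (case_nat x \<rho>)) \<in> Sigma_def M (Suc n)"
  by (simp add: ex_closure.ex)

lemma ex_closure_mono: "C \<subseteq> D \<Longrightarrow> ex_closure C \<subseteq> ex_closure D"
proof
  fix P assume "C \<subseteq> D" "P \<in> ex_closure C"
  from this(2,1) show "P \<in> ex_closure D" by induction (auto intro: ex_closure.intros)
qed

text \<open>Closure of bounded formulae under negation gives the first inclusion; complementation
  and existential closure are monotone and propagate it upwards.\<close>

lemma Sigma_def_Suc: "Sigma_def M n \<subseteq> Sigma_def M (Suc n)"
proof (induction n)
  case 0
  have "P \<in> ex_closure (complements (Sigma_def M 0))" if "P \<in> Sigma_def M 0" for P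
    by (rule ex_closure.base) (use that bounded_closed[of M] in \<open>unfold complements_iff, blast\<close>)
  then show ?case unfolding Sigma_def.simps(2)[of M 0] by blast
next
  case (Suc n)
  then show ?case unfolding Sigma_def.simps(2)[of M "Suc n"] Sigma_def.simps(2)[of M n]
    by (intro ex_closure_mono image_mono) (simp add: Sigma_def.simps(2))
qed

lemma Sigma_def_not: "P \<in> Sigma_def M n \<Longrightarrow> (\<lambda>\<rho>. \<not> P \<rho>) \<in> Sigma_def M (Suc n)"
  by (auto intro: ex_closure.base)

lemma Sigma_def_bounded: "A \<in> bounded \<Longrightarrow> (\<lambda>\<rho>. sat M (env g \<rho>) A) \<in> Sigma_def M n"
proof (induction n)
  case 0
  then show ?case by auto
next
  case (Suc n)
  then show ?case using Sigma_def_Suc[of M n] by blast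
qed

lemma env_Inl [simp]: "env Inl \<rho> = \<rho>"
  by (auto simp: env_def fun_eq_iff)

lemma Sigma_def_sat: "A \<in> Sigma_fms n \<Longrightarrow> (\<lambda>\<rho>. sat M \<rho> A) \<in> Sigma_def M n"
  and Pi_def_sat: "A \<in> Pi_fms n \<Longrightarrow> (\<lambda>\<rho>. \<not> sat M \<rho> A) \<in> Sigma_def M n"
proof (induction n arbitrary: A)
  case 0
  { case 1
    then show ?case using Sigma_def_bounded[of A M Inl 0] by simp
  next
    case 2
    then show ?case using Sigma_def_bounded[of "neg A" M Inl 0] bounded_neg by simp
  }
next
  case (Suc n)
  { case 1
    then obtain k B where B: "A = (Ex ^^ k) B" "B \<in> Pi_fms n" by auto
    have "(\<lambda>\<rho>. sat M \<rho> ((Ex ^^ k) B)) \<in> Sigma_def M (Suc n)"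
    proof (induction k)
      case 0
      then show ?case using Suc.IH(2)[OF B(2)] Sigma_def_not by fastforce
    next
      case (Suc k)
      from Sigma_def_ex[OF this] show ?case by simp
    qed
    then show ?case using B by simp
  next
    case 2
    then obtain k B where B: "A = (All ^^ k) B" "B \<in> Sigma_fms n" by auto
    have "(\<lambda>\<rho>. \<not> sat M \<rho> ((All ^^ k) B)) \<in> Sigma_def M (Suc n)"
    proof (induction k)
      case 0
      then show ?case using Suc.IH(1)[OF B(2)] Sigma_def_not by fastforce
    next
      case (Suc k)
      from Sigma_def_ex[OF this] show ?case by simp
    qed
    then show ?case using B by simp
  }
qed

text \<open>Several variables may be sent to coordinate 0 by \<open>g\<close>. They are merged into
  index 0, so that a single quantifier of the syntax binds this coordinate; all others make room for
  it.\<close>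

definition bind_zero :: "(nat \<Rightarrow> nat + 'a) \<Rightarrow> fm \<Rightarrow> fm" where
  "bind_zero g = subst_fm (\<lambda>i. if g i = Inl 0 then Var 0 else Var (Suc i))"

text \<open>The environment left after binding coordinate 0. The value \<open>undefined\<close> goes
  only to variables which \<open>bind_zero\<close> has redirected to index 0, so it is never
  read.\<close>

definition drop_zero :: "(nat \<Rightarrow> nat + 'a) \<Rightarrow> nat \<Rightarrow> nat + 'a" where
  "drop_zero g i = (case g i of Inl 0 \<Rightarrow> Inr undefined | Inl (Suc j) \<Rightarrow> Inl j | Inr c \<Rightarrow> Inr c)"

lemma sat_bind_zero:
  "sat M (case_nat x (env (drop_zero g) \<rho>)) (bind_zero g A) = sat M (env g (case_nat x \<rho>)) A"
proof -
  have "eval M (case_nat x (env (drop_zero g) \<rho>)) (if g i = Inl 0 then Var 0 else Var (Suc i)) =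
      env g (case_nat x \<rho>) i" for i
    by (auto simp: env_def drop_zero_def split: sum.split nat.split)
  then show ?thesis by (simp add: bind_zero_def sat_subst_fm)
qed

text \<open>The way back from sets to syntax: the induction axioms speak of formulae, so closure
  properties proved for sets become usable only through a representing formula with
  parameters.\<close>

lemma Sigma_def_imp_sat:
  "P \<in> Sigma_def M n \<Longrightarrow> \<exists>A \<in> Sigma_fms n. \<exists>g. P = (\<lambda>\<rho>. sat M (env g \<rho>) A)"
proof (induction n arbitrary: P)
  case (Suc n)
  from Suc.prems show ?case unfolding Sigma_def.simps(2)
  proof (induction rule: ex_closure.induct)
    case (base P)
    then obtain A g where A: "A \<in> Sigma_fms n" "(\<lambda>\<rho>. \<not> P \<rho>) = (\<lambda>\<rho>. sat M (env g \<rho>) A)"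
      using Suc.IH[of "\<lambda>\<rho>. \<not> P \<rho>"] by (auto simp: complements_iff)
    have "(Ex ^^ 0) (neg A) \<in> Sigma_fms (Suc n)"
      unfolding Sigma_fms.simps(2) using hierarchy_neg[of A n] A(1) by blast
    then have "neg A \<in> Sigma_fms (Suc n)" by simp
    moreover have "P = (\<lambda>\<rho>. sat M (env g \<rho>) (neg A))"
      using A(2) by (auto simp: fun_eq_iff)
    ultimately show ?case by blast
  next
    case (ex P)
    then obtain A g where A: "A \<in> Sigma_fms (Suc n)" "P = (\<lambda>\<rho>. sat M (env g \<rho>) A)" by blast
    have "bind_zero g A \<in> Sigma_fms (Suc n)"
      using A(1) hierarchy_subst unfolding bind_zero_def by blast
    then obtain k B where "bind_zero g A = (Ex ^^ k) B" "B \<in> Pi_fms n" by auto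
    then have "Ex (bind_zero g A) = (Ex ^^ Suc k) B" "B \<in> Pi_fms n" by auto
    then have "Ex (bind_zero g A) \<in> Sigma_fms (Suc n)" unfolding Sigma_fms.simps(2) by blast
    moreover have "(\<lambda>\<rho>. \<exists>x. P (case_nat x \<rho>)) = (\<lambda>\<rho>. sat M (env (drop_zero g) \<rho>) (Ex (bind_zero g A)))"
      by (simp add: A(2) sat_bind_zero)
    ultimately show ?case by blast
  qed
qed auto

lemma Sigma_def_finite_support:
  assumes "P \<in> Sigma_def M n"
  shows "\<exists>N. \<forall>\<rho> \<sigma>. (\<forall>i<N. \<rho> i = \<sigma> i) \<longrightarrow> P \<rho> = P \<sigma>"
proof -
  obtain A g where P: "P = (\<lambda>\<rho>. sat M (env g \<rho>) A)" using Sigma_def_imp_sat[OF assms] by blast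
  have "finite ((\<lambda>i. case g i of Inl j \<Rightarrow> j | Inr _ \<Rightarrow> 0) ` fv_fm A)" by simp
  then obtain N where N: "(\<lambda>i. case g i of Inl j \<Rightarrow> j | Inr _ \<Rightarrow> 0) ` fv_fm A \<subseteq> {..<N}"
    using finite_nat_iff_bounded by blast
  have "P \<rho> = P \<sigma>" if "\<forall>i<N. \<rho> i = \<sigma> i" for \<rho> \<sigma>
    unfolding P
  proof (rule sat_cong)
    fix i assume "i \<in> fv_fm A"
    then have "(case g i of Inl j \<Rightarrow> j | Inr _ \<Rightarrow> 0) < N" using N by blast
    then show "env g \<rho> i = env g \<sigma> i" using that by (auto simp: env_def split: sum.splits)
  qed
  then show ?thesis by blast
qed

text \<open>Quantifying over a whole assignment is not first-order, but \<open>R\<close> depends on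
  finitely many coordinates only. \<open>E j\<close> quantifies away the coordinates 1 to
  \<open>j\<close> one after another.\<close>

lemma Sigma_def_ex_assignment:
  assumes "R \<in> Sigma_def M (Suc n)"
  shows "(\<lambda>\<sigma>. \<exists>\<rho>. R (case_nat (\<sigma> 0) \<rho>)) \<in> Sigma_def M (Suc n)"
proof -
  define E where "E j \<sigma> \<longleftrightarrow> (\<exists>\<rho>. (\<forall>i. (i = 0 \<or> i > j) \<longrightarrow> \<rho> i = \<sigma> i) \<and> R \<rho>)" for j \<sigma>
  have E: "E j \<in> Sigma_def M (Suc n)" for j
  proof (induction j)
    case 0
    have "E 0 = R" by (auto simp: E_def fun_eq_iff) (metis neq0_conv ext)
    then show ?case using assms by simp
  next
    case (Suc j)
    \<comment> \<open>Coordinate \<open>Suc j\<close> reads the newly quantified value at 0; every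
      other coordinate is shifted by one to find its old value.\<close>
    let ?g = "\<lambda>i. if i = Suc j then Inl 0 else Inl (Suc i)"
    have eq: "E (Suc j) \<sigma> \<longleftrightarrow> (\<exists>x. E j (\<sigma>(Suc j := x)))" for \<sigma>
    proof
      assume "E (Suc j) \<sigma>"
      then obtain \<rho> where \<rho>: "\<And>i. i = 0 \<or> i > Suc j \<Longrightarrow> \<rho> i = \<sigma> i" "R \<rho>" by (auto simp: E_def)
      have "\<rho> i = (\<sigma>(Suc j := \<rho> (Suc j))) i" if "i = 0 \<or> i > j" for i
        using \<rho>(1)[of i] that by (cases "i = Suc j") auto
      then show "\<exists>x. E j (\<sigma>(Suc j := x))" using \<rho>(2) unfolding E_def by blast
    next
      assume "\<exists>x. E j (\<sigma>(Suc j := x))"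
      then obtain x \<rho> where \<rho>: "\<And>i. i = 0 \<or> i > j \<Longrightarrow> \<rho> i = (\<sigma>(Suc j := x)) i" "R \<rho>"
        unfolding E_def by blast
      have "\<rho> i = \<sigma> i" if "i = 0 \<or> i > Suc j" for i
        using \<rho>(1)[of i] that by (cases "i = Suc j") auto
      then show "E (Suc j) \<sigma>" using \<rho>(2) unfolding E_def by blast
    qed
    have "env ?g (case_nat x \<sigma>) = \<sigma>(Suc j := x)" for x :: 'a and \<sigma>
      by (auto simp: env_def fun_eq_iff)
    then have "E (Suc j) = (\<lambda>\<sigma>. \<exists>x. E j (env ?g (case_nat x \<sigma>)))" using eq by presburger
    then show ?case using Sigma_def_ex[OF Sigma_def_reindex[OF Suc, of ?g]] by simp
  qed
  obtain N where N: "\<And>\<rho> \<sigma>. \<forall>i<N. \<rho> i = \<sigma> i \<Longrightarrow> R \<rho> = R \<sigma>"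
    using Sigma_def_finite_support[OF assms] by blast
  have "E N \<sigma> \<longleftrightarrow> (\<exists>\<rho>. R (case_nat (\<sigma> 0) \<rho>))" for \<sigma>
  proof
    assume "E N \<sigma>"
    then obtain \<rho> where \<rho>: "\<rho> 0 = \<sigma> 0" "R \<rho>" unfolding E_def by blast
    have "R (case_nat (\<sigma> 0) (\<lambda>i. \<rho> (Suc i)))"
      by (rule N[THEN iffD1, OF _ \<rho>(2)]) (auto simp: \<rho>(1) split: nat.split)
    then show "\<exists>\<rho>. R (case_nat (\<sigma> 0) \<rho>)" by blast
  next
    assume "\<exists>\<rho>. R (case_nat (\<sigma> 0) \<rho>)"
    then obtain \<rho> where \<rho>: "R (case_nat (\<sigma> 0) \<rho>)" by blast
    \<comment> \<open>\<open>E N\<close> demands agreement with \<open>\<sigma>\<close> beyond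
      \<open>N\<close>; changing the tail is invisible to \<open>R\<close>.\<close>
    let ?\<rho> = "\<lambda>i. if i \<le> N then case_nat (\<sigma> 0) \<rho> i else \<sigma> i"
    have "R ?\<rho>" by (rule N[THEN iffD1, OF _ \<rho>]) auto
    then show "E N \<sigma>" unfolding E_def by (intro exI[of _ ?\<rho>]) auto
  qed
  then have "(\<lambda>\<sigma>. \<exists>\<rho>. R (case_nat (\<sigma> 0) \<rho>)) = E N" by (simp add: fun_eq_iff)
  then show ?thesis using E by simp
qed

section \<open>The least number principle\<close>

locale induction_model =
  fixes M :: "'a interp" and n :: nat
  assumes axioms: "A \<in> I_Sigma (Suc n) \<Longrightarrow> valid M A"
begin

abbreviation (input) "Z \<equiv> Zer M"
abbreviation (input) "S \<equiv> Suc_op M"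
abbreviation (input) "pl \<equiv> Add_op M"
abbreviation lt :: "'a \<Rightarrow> 'a \<Rightarrow> bool" where "lt \<equiv> Less_rel M"
definition le :: "'a \<Rightarrow> 'a \<Rightarrow> bool" where "le x y \<longleftrightarrow> lt x y \<or> x = y"

lemma Q_axiom: "A \<in> Q_axioms \<Longrightarrow> sat M \<rho> A"
  using axioms[of "closure A"] valid_closure[of M A] unfolding I_Sigma_def Q_def valid_def by blast

lemma Suc_not_zero: "S x \<noteq> Z"
  using Q_axiom[of "Neg (Eq (Succ (Var 0)) Zero)" "\<lambda>_. x"] by (simp add: Q_axioms_def)

lemma Suc_inj: "S x = S y \<Longrightarrow> x = y"
  using Q_axiom[of "Imp (Pos (Eq (Succ (Var 0)) (Succ (Var 1)))) (Pos (Eq (Var 0) (Var 1)))"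
      "case_nat x (\<lambda>_. y)"] by (simp add: Q_axioms_def)

lemma zero_or_Suc: "x = Z \<or> (\<exists>y. x = S y)"
  using Q_axiom[of "Imp (Neg (Eq (Var 0) Zero)) (Ex (Pos (Eq (Var 1) (Succ (Var 0)))))" "\<lambda>_. x"]
  by (auto simp: Q_axioms_def)

lemma add_zero: "pl x Z = x"
  using Q_axiom[of "Pos (Eq (Add (Var 0) Zero) (Var 0))" "\<lambda>_. x"] by (simp add: Q_axioms_def)

lemma add_Suc: "pl x (S y) = S (pl x y)"
  using Q_axiom[of "Pos (Eq (Add (Var 0) (Succ (Var 1))) (Succ (Add (Var 0) (Var 1))))"
      "case_nat x (\<lambda>_. y)"] by (simp add: Q_axioms_def)

lemma lt_iff: "lt x y \<longleftrightarrow> (\<exists>z. pl x (S z) = y)"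
  using Q_axiom[of "Iff (Pos (Less (Var 0) (Var 1)))
         (Ex (Pos (Eq (Add (Var 1) (Succ (Var 0))) (Var 2))))" "case_nat x (\<lambda>_. y)"]
  by (simp add: Q_axioms_def numeral_2_eq_2)

lemma fm_induct:
  assumes "A \<in> Sigma_fms (Suc n)" and "sat M (case_nat Z \<rho>) A"
    and "\<And>x. sat M (case_nat x \<rho>) A \<Longrightarrow> sat M (case_nat (S x) \<rho>) A"
  shows "sat M (case_nat x \<rho>) A"
proof -
  have "valid M (closure (induction A))"
    by (rule axioms) (use assms(1) in \<open>unfold I_Sigma_def, blast\<close>)
  then have "sat M \<rho> (induction A)" using valid_closure[of M "induction A"] unfolding valid_def by blast
  moreover have "(\<lambda>i. eval M (case_nat x \<rho>) (case_nat (Succ (Var 0)) (\<lambda>i. Var (Suc i)) i)) =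
      case_nat (S x) \<rho>" for x
    by (auto simp: fun_eq_iff split: nat.split)
  ultimately show ?thesis using assms(2,3) by (simp add: induction_def sat_inst sat_subst_fm)
qed

lemmas open_induct = fm_induct[OF subsetD[OF conjunct1[OF bounded_subset_hierarchy]]]

section \<open>Addition and order from open induction\<close>

lemma zero_add: "pl Z y = y"
  using open_induct[of "Pos (Eq (Add Zero (Var 0)) (Var 0))"]
  by (simp add: bounded.intros add_zero add_Suc)

lemma Suc_add: "pl (S x) y = S (pl x y)"
  using open_induct[of "Pos (Eq (Add (Succ (Var 1)) (Var 0)) (Succ (Add (Var 1) (Var 0))))" "\<lambda>_. x" y]
  by (simp add: bounded.intros add_zero add_Suc)

lemma add_assoc: "pl (pl x y) z = pl x (pl y z)"
  using open_induct[of "Pos (Eq (Add (Add (Var 1) (Var 2)) (Var 0)) (Add (Var 1) (Add (Var 2) (Var 0))))"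
      "case_nat x (\<lambda>_. y)" z]
  by (simp add: bounded.intros add_zero add_Suc numeral_2_eq_2)

lemma lt_irrefl: "\<not> lt x x"
  using open_induct[of "Neg (Less (Var 0) (Var 0))" "\<lambda>_. x" x] Suc_inj
  by (auto simp: bounded.intros lt_iff zero_add Suc_not_zero Suc_add)

lemma lt_trans: "lt x y \<Longrightarrow> lt y z \<Longrightarrow> lt x z"
  unfolding lt_iff by (metis add_Suc add_assoc)

lemma lt_Suc_iff: "lt x (S y) \<longleftrightarrow> le x y"
  unfolding le_def lt_iff by (metis Suc_inj add_Suc add_zero zero_or_Suc)

lemma Suc_lt_Suc: "lt x y \<Longrightarrow> lt (S x) (S y)"
  unfolding lt_iff by (metis Suc_add)

lemma Suc_le: "lt x y \<Longrightarrow> le (S x) y"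
  using Suc_lt_Suc lt_Suc_iff by blast

lemma lt_linear: "lt x y \<or> x = y \<or> lt y x"
proof -
  have 0: "lt x Z \<or> x = Z \<or> lt Z x" for x
    using zero_or_Suc[of x] zero_add unfolding lt_iff by metis
  have S: "lt x (S y) \<or> x = S y \<or> lt (S y) x" if "lt x y \<or> x = y \<or> lt y x" for x y
    using that lt_Suc_iff[of x y] Suc_le[of y x] unfolding le_def by blast
  show ?thesis
    using open_induct[of "Or (Pos (Less (Var 1) (Var 0))) (Or (Pos (Eq (Var 1) (Var 0))) (Pos (Less (Var 0) (Var 1))))"
        "\<lambda>_. x" y] 0 S
    by (simp add: bounded.intros)
qed

lemma le_trans: "le x y \<Longrightarrow> le y z \<Longrightarrow> le x z"
  unfolding le_def using lt_trans by blast

lemma le_lt_trans: "le x y \<Longrightarrow> lt y z \<Longrightarrow> lt x z"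
  unfolding le_def using lt_trans by blast

lemma lt_le_trans: "lt x y \<Longrightarrow> le y z \<Longrightarrow> lt x z"
  unfolding le_def using lt_trans by blast

lemma not_lt_zero: "\<not> lt x Z"
  unfolding lt_iff by (metis Suc_not_zero add_Suc)

lemma le_add: "le x (pl x y)"
  unfolding le_def lt_iff by (metis add_zero zero_or_Suc)

lemma add_lt_mono: "lt y z \<Longrightarrow> lt (pl x y) (pl x z)"
  unfolding lt_iff by (metis add_assoc)

text \<open>After passing to a formula, \<open>bind_zero\<close> turns coordinate 0 into the
  induction variable, and \<open>drop_zero\<close> turns both the other coordinates and the
  parameters into an assignment for the parameters of the induction axiom.\<close>

lemma Sigma_def_induct:
  assumes "P \<in> Sigma_def M (Suc n)" and "P (case_nat Z \<rho>)"
    and "\<And>x. P (case_nat x \<rho>) \<Longrightarrow> P (case_nat (S x) \<rho>)"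
  shows "P (case_nat x \<rho>)"
proof -
  obtain A g where A: "A \<in> Sigma_fms (Suc n)" "P = (\<lambda>\<rho>. sat M (env g \<rho>) A)"
    using Sigma_def_imp_sat[OF assms(1)] by blast
  have "bind_zero g A \<in> Sigma_fms (Suc n)"
    using A(1) hierarchy_subst unfolding bind_zero_def by blast
  from fm_induct[OF this, of "env (drop_zero g) \<rho>"] show ?thesis
    using assms(2,3) by (simp add: sat_bind_zero A(2))
qed

text \<open>Without a least element, induction on \<open>x\<close> would yield some \<open>u\<close> in \<open>P\<close> with \<open>x + u \<le> c\<close>, for
  every \<open>x\<close>.\<close>

lemma least_number:
  assumes "P \<in> Sigma_def M (Suc n)" and "P (case_nat c \<rho>)"
  shows "\<exists>a. P (case_nat a \<rho>) \<and> (\<forall>b. lt b a \<longrightarrow> \<not> P (case_nat b \<rho>))"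
proof (rule ccontr)
  assume nl: "\<not> ?thesis"
  define g1 :: "nat \<Rightarrow> nat + 'a" where "g1 = case_nat (Inl 0) (\<lambda>i. Inr (\<rho> i))"
  \<comment> \<open>Under the quantifier of \<open>E\<close>, coordinate 0 is \<open>u\<close> and
    coordinate 1 is the induction variable \<open>x\<close>. The swap makes \<open>B\<close> express
    \<open>x + u \<le> c\<close>.\<close>
  define g2 :: "nat \<Rightarrow> nat + 'a" where "g2 = case_nat (Inl 1) (case_nat (Inl 0) (\<lambda>_. Inr c))"
  define B where "B = Or (Pos (Less (Add (Var 0) (Var 1)) (Var 2))) (Pos (Eq (Add (Var 0) (Var 1)) (Var 2)))"
  define E where "E \<sigma> \<longleftrightarrow> (\<exists>u. P (env g1 (case_nat u \<sigma>)) \<and> sat M (env g2 (case_nat u \<sigma>)) B)" for \<sigma>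
  have "E \<in> Sigma_def M (Suc n)"
    unfolding E_def[abs_def]
    by (intro Sigma_def_ex[where P = "\<lambda>\<tau>. P (env g1 \<tau>) \<and> sat M (env g2 \<tau>) B"] Sigma_def_conj
        Sigma_def_reindex Sigma_def_bounded assms) (auto simp: B_def intro: bounded.intros)
  note ind = Sigma_def_induct[OF this, of \<rho>]
  have g1: "env g1 (case_nat u \<sigma>) = case_nat u \<rho>" for u \<sigma>
    by (auto simp: env_def g1_def fun_eq_iff split: nat.split)
  have g2: "sat M (env g2 (case_nat u (case_nat x \<sigma>))) B \<longleftrightarrow> le (pl x u) c" for u x \<sigma>
    by (auto simp: env_def g2_def B_def le_def numeral_2_eq_2)
  have E: "E (case_nat x \<rho>) \<longleftrightarrow> (\<exists>u. P (case_nat u \<rho>) \<and> le (pl x u) c)" for x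
    by (simp add: E_def g1 g2)
  have "E (case_nat x \<rho>)" for x
  proof (rule ind)
    show "E (case_nat Z \<rho>)" using assms(2) by (auto simp: E zero_add le_def)
  next
    fix x assume "E (case_nat x \<rho>)"
    then obtain u where u: "P (case_nat u \<rho>)" "le (pl x u) c" by (auto simp: E)
    then obtain v where v: "P (case_nat v \<rho>)" "lt v u" using nl by blast
    \<comment> \<open>Raising \<open>x\<close> by one is paid for by the smaller element
      \<open>v\<close>: \<open>S x + v = S (x + v) \<le> x + u \<le> c\<close>.\<close>
    have "le (S (pl x v)) (pl x u)" using Suc_le add_lt_mono v(2) by blast
    then have "le (pl (S x) v) c" using u(2) le_trans by (simp add: Suc_add)
    then show "E (case_nat (S x) \<rho>)" using v by (auto simp: E)
  qed
  \<comment> \<open>At \<open>x = S c\<close> the invariant would give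
    \<open>S c \<le> c\<close>.\<close>
  then obtain u where "le (pl (S c) u) c" by (auto simp: E)
  moreover have "lt c (S c)" by (simp add: lt_Suc_iff le_def)
  ultimately show False using le_add le_lt_trans lt_le_trans lt_irrefl by blast
qed

end

section \<open>Determinisation of traces\<close>

text \<open>This is Safra's construction with the tree encoded by the set of names of the nodes containing a
  term. Names are ordered by age, so that names below \<open>p\<close> in a set containing \<open>p\<close> are the ancestors
  of \<open>p\<close>, and a term moves to the oldest sibling, or else to a proper descendant.\<close>

definition better :: "nat set \<Rightarrow> nat set \<Rightarrow> bool" where
  "better U W \<longleftrightarrow> (\<exists>p. p \<in> U \<and> p \<notin> W \<and> (\<forall>q<p. q \<in> U \<longleftrightarrow> q \<in> W))"

text \<open>Sets are compared at the oldest name on which they differ, as characteristic sequences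
  in lexicographic order; without such a name, induction on names shows equality.\<close>

lemma better_linear: "U = W \<or> better U W \<or> better W U"
proof (rule disjCI)
  assume *: "\<not> (better U W \<or> better W U)"
  have "p \<in> U \<longleftrightarrow> p \<in> W" for p
    by (induction p rule: less_induct) (use * in \<open>auto simp: better_def\<close>)
  then show "U = W" by blast
qed

lemma better_trans:
  assumes "better U V" and "better V W"
  shows "better U W"
proof -
  obtain p where p: "p \<in> U" "p \<notin> V" "\<And>q. q < p \<Longrightarrow> q \<in> U \<longleftrightarrow> q \<in> V"
    using assms(1) by (auto simp: better_def)
  obtain r where r: "r \<in> V" "r \<notin> W" "\<And>q. q < r \<Longrightarrow> q \<in> V \<longleftrightarrow> q \<in> W"
    using assms(2) by (auto simp: better_def)
  have "p \<noteq> r" using p r by auto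
  then have "min p r \<in> U \<and> min p r \<notin> W \<and> (\<forall>q < min p r. q \<in> U \<longleftrightarrow> q \<in> W)"
    using p r by (cases "p < r") (auto simp: min_def)
  then show ?thesis unfolding better_def by blast
qed

lemma best_exists:
  assumes "finite A" and "A \<noteq> {}"
  shows "\<exists>U \<in> A. \<forall>W \<in> A. U = W \<or> better U W"
  using assms
proof (induction rule: finite_ne_induct)
  case (insert V A)
  then obtain U where U: "U \<in> A" "\<forall>W \<in> A. U = W \<or> better U W" by blast
  show ?case
  proof (cases "V = U \<or> better U V")
    case True
    then show ?thesis using U by blast
  next
    case False
    then have "better V U" using better_linear by blast
    then have "\<forall>W \<in> insert V A. V = W \<or> better V W" using U(2) better_trans[of V U] by auto
    then show ?thesis by blast
  qed
qed auto

definition best :: "nat set set \<Rightarrow> nat set" where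
  "best A = (SOME U. U \<in> A \<and> (\<forall>W \<in> A. U = W \<or> better U W))"

lemma best:
  assumes "finite A" and "A \<noteq> {}"
  shows "best A \<in> A" and "W \<in> A \<Longrightarrow> best A = W \<or> better (best A) W"
proof -
  have "best A \<in> A \<and> (\<forall>W \<in> A. best A = W \<or> better (best A) W)"
    unfolding best_def by (rule someI_ex) (use best_exists[OF assms] in blast)
  then show "best A \<in> A" and "W \<in> A \<Longrightarrow> best A = W \<or> better (best A) W" by blast+
qed

text \<open>One step of the automaton: \<open>T\<close> and \<open>T'\<close> are the terms before
  and after it, \<open>N\<close> and \<open>G\<close> the moves without and with progress, and
  \<open>m t\<close> the branch of Safra nodes that contain \<open>t\<close>. \<open>laminar\<close>
  says that a name has the same ancestors wherever it occurs. Fresh names, one for each source term,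
  start at \<open>K\<close> and so are younger than all old ones.\<close>

locale memory_step =
  fixes T T' :: "'t set" and N G :: "'t \<Rightarrow> 't \<Rightarrow> bool" and fresh :: "'t \<Rightarrow> nat" and K :: nat
    and m :: "'t \<Rightarrow> nat set"
  assumes finite_T: "finite T" and finite_T': "finite T'" and card_T': "card T' \<le> K"
    and fresh_inj: "fresh s = fresh t \<Longrightarrow> s = t" and fresh_ge: "K \<le> fresh t"
    and m_less: "t \<in> T \<Longrightarrow> p \<in> m t \<Longrightarrow> p < K"
    and laminar: "s \<in> T \<Longrightarrow> t \<in> T \<Longrightarrow> p \<in> m s \<Longrightarrow> p \<in> m t \<Longrightarrow> q < p \<Longrightarrow> q \<in> m s \<longleftrightarrow> q \<in> m t"
begin

text \<open>The empty set, the worst candidate, serves terms without predecessor; a trace may start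
  at any term. A progressing term passes the same fresh name to all its successors, which keeps
  memories laminar.\<close>

definition cand :: "'t \<Rightarrow> nat set set" where
  "cand t' = {{}} \<union> {m t | t. t \<in> T \<and> N t t'} \<union> {insert (fresh t) (m t) | t. t \<in> T \<and> G t t'}"

definition pre :: "'t \<Rightarrow> nat set" where
  "pre t' = best (cand t')"

definition used :: "nat set" where
  "used = (\<Union>t \<in> T'. pre t)"

text \<open>When every term bearing \<open>p\<close> also bears a younger name, each of them has progressed since \<open>p\<close>
  was created or last flashed; the descendants of \<open>p\<close> are then collapsed into \<open>p\<close>.\<close>

definition flash :: "nat \<Rightarrow> bool" where
  "flash p \<longleftrightarrow> p \<in> used \<and> (\<forall>t \<in> T'. p \<in> pre t \<longrightarrow> (\<exists>q \<in> pre t. p < q))"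

definition cut :: "'t \<Rightarrow> nat set" where
  "cut t' = {q \<in> pre t'. \<forall>p \<in> pre t'. p < q \<longrightarrow> \<not> flash p}"

definition alive :: "nat set" where
  "alive = (\<Union>t \<in> T'. cut t)"

definition rank :: "nat \<Rightarrow> nat" where
  "rank p = card {q \<in> alive. q < p}"

definition nxt :: "'t \<Rightarrow> nat set" where
  "nxt t' = (if t' \<in> T' then rank ` cut t' else {})"

definition gap :: nat where
  "gap = (LEAST i. i \<notin> alive)"

text \<open>Surviving names are renumbered by \<open>rank\<close>. The names from \<open>gap\<close> on change, so a step is bad
  (even) at \<open>gap\<close> unless an older name flashes.\<close>

definition prio :: nat where
  "prio = (if \<exists>j < gap. flash j then 2 * (LEAST j. flash j) + 1 else 2 * gap)"

section \<open>Memories stay laminar and small\<close>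

lemma finite_cand: "finite (cand t')"
proof -
  have "cand t' \<subseteq> {{}} \<union> m ` T \<union> (\<lambda>t. insert (fresh t) (m t)) ` T" by (auto simp: cand_def)
  then show ?thesis by (rule finite_subset) (use finite_T in auto)
qed

lemma pre_cand: "pre t' \<in> cand t'" and pre_best: "W \<in> cand t' \<Longrightarrow> pre t' = W \<or> better (pre t') W"
proof -
  have "cand t' \<noteq> {}" by (auto simp: cand_def)
  then show "pre t' \<in> cand t'" and "W \<in> cand t' \<Longrightarrow> pre t' = W \<or> better (pre t') W"
    using best[OF finite_cand[of t']] unfolding pre_def by auto
qed

lemma pre_cases:
  assumes "p \<in> pre t'"
  obtains t where "t \<in> T" "N t t'" "pre t' = m t" | t where "t \<in> T" "G t t'" "pre t' = insert (fresh t) (m t)"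
  using pre_cand[of t'] assms unfolding cand_def by blast

lemma finite_pre: "finite (pre t')"
proof -
  have "finite (m t)" if "t \<in> T" for t
    using m_less[OF that] by (meson finite_nat_set_iff_bounded)
  then show ?thesis using pre_cand[of t'] by (auto simp: cand_def)
qed

text \<open>What \<open>pre t\<close> contains below \<open>p\<close> stems from a source that bore
  \<open>p\<close> or created it. For an old \<open>p\<close> both sources bore it and laminarity is
  inherited; for a new \<open>p\<close> injectivity of \<open>fresh\<close> makes the sources
  equal.\<close>

lemma pre_laminar:
  assumes "p \<in> pre t" and "p \<in> pre u" and "q < p"
  shows "q \<in> pre t \<longleftrightarrow> q \<in> pre u"
proof -
  have tail: "\<exists>s \<in> T. (p \<in> m s \<or> p = fresh s) \<and> (\<forall>q < p. q \<in> pre t' \<longleftrightarrow> q \<in> m s)" if "p \<in> pre t'" for t'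
    using that
  proof (cases rule: pre_cases)
    case (1 s)
    then show ?thesis using that by auto
  next
    case (2 s)
    have "p \<le> fresh s" using that 2 m_less[of s p] fresh_ge[of s] by auto
    then show ?thesis using that 2 by auto
  qed
  obtain s where s: "s \<in> T" "p \<in> m s \<or> p = fresh s" "\<forall>q < p. q \<in> pre t \<longleftrightarrow> q \<in> m s"
    using tail[OF assms(1)] by blast
  obtain r where r: "r \<in> T" "p \<in> m r \<or> p = fresh r" "\<forall>q < p. q \<in> pre u \<longleftrightarrow> q \<in> m r"
    using tail[OF assms(2)] by blast
  have "q \<in> m s \<longleftrightarrow> q \<in> m r"
  proof (cases "p < K")
    case True
    then have "p \<in> m s" "p \<in> m r" using s r fresh_ge not_le by blast+
    then show ?thesis using laminar s(1) r(1) assms(3) by blast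
  next
    case False
    then have "fresh s = fresh r" using s r m_less by blast
    then show ?thesis using fresh_inj by blast
  qed
  then show ?thesis using s r assms(3) by blast
qed

lemma cut_subset: "cut t \<subseteq> pre t"
  by (auto simp: cut_def)

lemma finite_alive: "finite alive"
  unfolding alive_def using finite_T' finite_subset[OF cut_subset finite_pre] by blast

lemma cut_below: "p \<in> cut t \<Longrightarrow> q < p \<Longrightarrow> q \<in> cut t \<longleftrightarrow> q \<in> pre t"
  by (auto simp: cut_def)

lemma cut_laminar:
  assumes "p \<in> cut t" and "p \<in> cut u" and "q < p"
  shows "q \<in> cut t \<longleftrightarrow> q \<in> cut u"
  using cut_below[OF assms(1,3)] cut_below[OF assms(2,3)] pre_laminar[of p t u q] assms cut_subset
  by blast

text \<open>Where a flashing name survives, the cut has removed everything younger; a name that does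
  not flash has a bearer with nothing younger. Choosing such a bearer for each surviving name is
  injective, which bounds the number of names by the number of terms.\<close>

lemma alive_max:
  assumes "p \<in> alive"
  shows "\<exists>t \<in> T'. p \<in> cut t \<and> (\<forall>q \<in> cut t. q \<le> p)"
proof -
  obtain t where t: "t \<in> T'" "p \<in> cut t" using assms by (auto simp: alive_def)
  show ?thesis
  proof (cases "flash p")
    case True
    have "\<forall>q \<in> cut t. q \<le> p" using True t(2) unfolding cut_def by (auto simp: not_less[symmetric])
    then show ?thesis using t by blast
  next
    case False
    have "p \<in> used" using t by (auto simp: used_def cut_def)
    then obtain u where u: "u \<in> T'" "p \<in> pre u" "\<forall>q \<in> pre u. \<not> p < q"
      using False unfolding flash_def by blast
    have "\<not> flash q" if "q \<in> pre u" "q < p" for q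
      using t(2) that pre_laminar[of p t u q] u(2) unfolding cut_def by blast
    then have "p \<in> cut u" using u(2) by (auto simp: cut_def)
    moreover have "\<forall>q \<in> cut u. q \<le> p" using u(3) cut_subset not_less by blast
    ultimately show ?thesis using u(1) by blast
  qed
qed

lemma card_alive: "card alive \<le> K"
proof -
  obtain h where h: "\<And>p. p \<in> alive \<Longrightarrow> h p \<in> T' \<and> p \<in> cut (h p) \<and> (\<forall>q \<in> cut (h p). q \<le> p)"
    using alive_max by metis
  have "inj_on h alive"
  proof (rule inj_onI)
    fix p q assume "p \<in> alive" "q \<in> alive" "h p = h q"
    then show "p = q" using h[of p] h[of q] by (metis order_antisym)
  qed
  then have "card alive \<le> card T'" by (rule card_inj_on_le) (use h finite_T' in auto)
  then show ?thesis using card_T' by simp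
qed

lemma rank_less: "p \<in> alive \<Longrightarrow> p < q \<Longrightarrow> rank p < rank q"
  unfolding rank_def by (rule psubset_card_mono) (use finite_alive in auto)

lemma rank_less_iff: "p \<in> alive \<Longrightarrow> q \<in> alive \<Longrightarrow> rank p < rank q \<longleftrightarrow> p < q"
  using rank_less by (metis less_asym linorder_neqE_nat)

lemma rank_eq_iff: "p \<in> alive \<Longrightarrow> q \<in> alive \<Longrightarrow> rank p = rank q \<longleftrightarrow> p = q"
  using rank_less_iff by (metis less_irrefl linorder_neqE_nat)

lemma rank_bound: "p \<in> alive \<Longrightarrow> rank p < K"
proof -
  assume "p \<in> alive"
  then have "rank p < card alive"
    unfolding rank_def by (intro psubset_card_mono) (use finite_alive in auto)
  then show ?thesis using card_alive by simp
qed

lemma rank_le: "rank p \<le> p"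
proof -
  have "card {q \<in> alive. q < p} \<le> card {..<p}" by (rule card_mono) auto
  then show ?thesis by (simp add: rank_def)
qed

lemma rank_less_self: "i \<notin> alive \<Longrightarrow> i < p \<Longrightarrow> rank p < p"
proof -
  assume "i \<notin> alive" "i < p"
  then have "card {q \<in> alive. q < p} < card {..<p}" by (intro psubset_card_mono) auto
  then show ?thesis by (simp add: rank_def)
qed

lemma rank_id:
  assumes "{..<i} \<subseteq> alive" and "p \<le> i"
  shows "rank p = p"
proof -
  have "{q \<in> alive. q < p} = {..<p}" using assms by auto
  then show ?thesis by (simp add: rank_def)
qed

lemma rank_ge:
  assumes "{..<i} \<subseteq> alive" and "i \<le> p"
  shows "i \<le> rank p"
proof -
  have "card {..<i} \<le> card {q \<in> alive. q < p}"
    by (rule card_mono) (use assms finite_alive in auto)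
  then show ?thesis by (simp add: rank_def)
qed

lemma cut_alive: "t \<in> T' \<Longrightarrow> p \<in> cut t \<Longrightarrow> p \<in> alive"
  by (auto simp: alive_def)

lemma nxt_less: "p \<in> nxt t \<Longrightarrow> p < K"
  using rank_bound cut_alive by (auto simp: nxt_def split: if_splits)

lemma nxt_outside: "t \<notin> T' \<Longrightarrow> nxt t = {}"
  by (simp add: nxt_def)

lemma nxt_laminar:
  assumes "p \<in> nxt s" and "p \<in> nxt t" and "q < p"
  shows "q \<in> nxt s \<longleftrightarrow> q \<in> nxt t"
proof -
  have sub: "q \<in> nxt t" if h: "p \<in> nxt s" "p \<in> nxt t" "q \<in> nxt s" for s t
  proof -
    have st: "s \<in> T'" "t \<in> T'" using h by (auto simp: nxt_def split: if_splits)
    obtain p' where p': "p' \<in> cut s" "p = rank p'" using h st by (auto simp: nxt_def)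
    obtain p'' where p'': "p'' \<in> cut t" "p = rank p''" using h st by (auto simp: nxt_def)
    obtain q' where q': "q' \<in> cut s" "q = rank q'" using h st by (auto simp: nxt_def)
    have "p' = p''" using p' p'' rank_eq_iff cut_alive st by metis
    moreover have "q' < p'" using q' p' rank_less_iff cut_alive st assms(3) by metis
    ultimately have "q' \<in> cut t" using cut_laminar[of p' s t q'] p' p'' q' by blast
    then show ?thesis using q'(2) st by (auto simp: nxt_def)
  qed
  show ?thesis using sub assms by blast
qed

lemma gap: "{..<gap} \<subseteq> alive" "gap \<notin> alive"
proof -
  have "\<exists>i. i \<notin> alive" using finite_alive ex_new_if_finite infinite_UNIV_nat by blast
  then show "gap \<notin> alive" unfolding gap_def by (rule LeastI_ex)
  show "{..<gap} \<subseteq> alive" unfolding gap_def using not_less_Least by blast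
qed

lemma gap_le: "gap \<le> K"
proof -
  have "card {..<gap} \<le> card alive" by (rule card_mono) (use gap finite_alive in auto)
  then show ?thesis using card_alive by simp
qed

lemma least_flash:
  assumes "\<exists>j < gap. flash j"
  shows "flash (LEAST j. flash j)" "(LEAST j. flash j) < gap"
proof -
  obtain j where "j < gap" "flash j" using assms by blast
  then show "flash (LEAST j. flash j)" "(LEAST j. flash j) < gap"
    by (auto intro: LeastI le_less_trans[OF Least_le])
qed

lemma prio_flash: "\<exists>j < gap. flash j \<Longrightarrow> prio = 2 * (LEAST j. flash j) + 1"
  unfolding prio_def by (simp only: if_True)

lemma prio_gap: "\<not> (\<exists>j < gap. flash j) \<Longrightarrow> prio = 2 * gap"
  unfolding prio_def by (simp only: if_False)

lemma prio_le: "prio \<le> 2 * K"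
proof (cases "\<exists>j < gap. flash j")
  case True
  then show ?thesis using least_flash(2)[OF True] gap_le prio_flash[OF True] by simp
next
  case False
  then show ?thesis using gap_le prio_gap[OF False] by simp
qed

text \<open>The threshold \<open>2 * i\<close> protects the names below \<open>i\<close>: none of
  them dies, is renumbered or flashes.\<close>

lemma prio_ge:
  assumes "2 * i \<le> prio"
  shows "i \<le> gap" "{..<i} \<subseteq> alive" "p < i \<Longrightarrow> \<not> flash p"
proof -
  have *: "i \<le> gap \<and> (\<forall>p<i. \<not> flash p)"
  proof (cases "\<exists>j < gap. flash j")
    case True
    then have i: "i \<le> (LEAST j. flash j)" using assms prio_flash[OF True] by simp
    have "\<not> flash p" if "p < i" for p by (rule not_less_Least) (use i that in simp)
    then show ?thesis using i least_flash(2)[OF True] by simp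
  next
    case False
    then have "i \<le> gap" using assms prio_gap[OF False] by simp
    then show ?thesis using False by (meson less_le_trans)
  qed
  then show "i \<le> gap" "p < i \<Longrightarrow> \<not> flash p" by auto
  show "{..<i} \<subseteq> alive" using * gap(1) by auto
qed

text \<open>Odd values are reserved for flashes, so an even one is twice the first hole.\<close>

lemma prio_even:
  assumes "prio = 2 * i"
  shows "i \<notin> alive"
proof -
  have "\<not> (\<exists>j < gap. flash j)" using assms prio_flash by (metis even_Suc even_mult_iff even_numeral Suc_eq_plus1)
  then have "gap = i" using assms prio_gap by simp
  then show ?thesis using gap(2) by simp
qed

text \<open>The strict bound admits \<open>prio = 2 * p + 1\<close>, where \<open>p\<close> itself
  flashes but survives under its old number.\<close>

lemma prio_odd:
  assumes "2 * p < prio"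
  shows "p < gap" "{..p} \<subseteq> alive"
proof -
  show "p < gap"
  proof (cases "\<exists>j < gap. flash j")
    case True
    then show ?thesis using assms least_flash(2)[OF True] prio_flash[OF True] by simp
  next
    case False
    then show ?thesis using assms prio_gap[OF False] by simp
  qed
  then show "{..p} \<subseteq> alive" using gap(1) by auto
qed

section \<open>Effect of a step on the protected names\<close>

lemma nxt_iff_cut:
  assumes "{..p} \<subseteq> alive" and "t \<in> T'"
  shows "p \<in> nxt t \<longleftrightarrow> p \<in> cut t" "(\<exists>q \<in> nxt t. p < q) \<longleftrightarrow> (\<exists>q \<in> cut t. p < q)"
proof -
  have "{..<p} \<subseteq> alive" using assms(1) by auto
  then have p: "rank p = p" "p \<in> alive" using assms(1) rank_id[of p p] by auto
  show "p \<in> nxt t \<longleftrightarrow> p \<in> cut t"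
    using p assms(2) rank_eq_iff cut_alive by (auto simp: nxt_def image_iff) metis+
  show "(\<exists>q \<in> nxt t. p < q) \<longleftrightarrow> (\<exists>q \<in> cut t. p < q)"
    using p assms(2) rank_less_iff[OF p(2)] cut_alive by (auto simp: nxt_def)
qed

lemma pre_pred:
  assumes "p \<in> pre t'" and "p < K"
  shows "\<exists>s \<in> T. p \<in> m s \<and> (N s t' \<and> pre t' = m s \<or> G s t')"
  using assms(1)
proof (cases rule: pre_cases)
  case (1 s)
  then show ?thesis using assms by auto
next
  case (2 s)
  then show ?thesis using assms fresh_ge[of s] by auto
qed

text \<open>The protected name \<open>p\<close> is old, so each bearer inherits it. A younger name
  is either inherited from the same source or arises with progress; this is what transports the
  strict part of the bound in \<open>below\<close>.\<close>

lemma nxt_pred: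
  assumes "2 * p < prio" and "t' \<in> T'" and "p \<in> nxt t'"
  shows "\<exists>s \<in> T. p \<in> m s \<and>
    (N s t' \<and> ((\<exists>q \<in> nxt t'. p < q) \<longrightarrow> (\<exists>q \<in> m s. p < q)) \<or> G s t')"
proof -
  have al: "{..p} \<subseteq> alive" using prio_odd(2) assms(1) .
  then have "p \<in> pre t'" using nxt_iff_cut(1) assms cut_subset by blast
  moreover have "p < K" using prio_odd(1)[OF assms(1)] gap_le by simp
  ultimately obtain s where s: "s \<in> T" "p \<in> m s" "N s t' \<and> pre t' = m s \<or> G s t'"
    using pre_pred by blast
  have "(\<exists>q \<in> nxt t'. p < q) \<longrightarrow> (\<exists>q \<in> pre t'. p < q)"
    using nxt_iff_cut(2)[OF al assms(2)] cut_subset by blast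
  then show ?thesis using s by metis
qed

text \<open>At a flash every bearer of \<open>p\<close> had a younger name in \<open>pre\<close>.
  That name was already borne by the source unless the move progressed, so each bearer has
  progressed at some time; afterwards the cut leaves no younger name.\<close>

lemma nxt_flash:
  assumes "prio = 2 * p + 1"
  shows "\<exists>t' \<in> T'. p \<in> nxt t'"
    and "t' \<in> T' \<Longrightarrow> p \<in> nxt t' \<Longrightarrow> (\<forall>q \<in> nxt t'. q \<le> p) \<and>
      (\<exists>s \<in> T. p \<in> m s \<and> (N s t' \<and> (\<exists>q \<in> m s. p < q) \<or> G s t'))"
proof -
  have lt: "2 * p < prio" using assms by simp
  have al: "{..p} \<subseteq> alive" using prio_odd(2)[OF lt] .
  have ex: "\<exists>j < gap. flash j"
    using assms prio_gap by (metis even_Suc even_mult_iff even_numeral Suc_eq_plus1)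
  then have fl: "flash p" using assms least_flash[OF ex] prio_flash[OF ex] by simp
  have "p \<in> alive" using al by auto
  then show "\<exists>t' \<in> T'. p \<in> nxt t'" using nxt_iff_cut(1)[OF al] by (auto simp: alive_def)
  assume t': "t' \<in> T'" "p \<in> nxt t'"
  then have cut: "p \<in> cut t'" using nxt_iff_cut(1)[OF al] by blast
  have "\<not> (\<exists>q \<in> cut t'. p < q)" using fl cut unfolding cut_def by blast
  then have 1: "\<forall>q \<in> nxt t'. q \<le> p" using nxt_iff_cut(2)[OF al t'(1)] not_less by blast
  have "p < K" using prio_odd(1)[OF lt] gap_le by simp
  then obtain s where s: "s \<in> T" "p \<in> m s" "N s t' \<and> pre t' = m s \<or> G s t'"
    using pre_pred cut cut_subset by blast
  have "\<exists>q \<in> pre t'. p < q" using fl t'(1) cut cut_subset unfolding flash_def by blast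
  then have "N s t' \<and> (\<exists>q \<in> m s. p < q) \<or> G s t'" using s(3) by metis
  then show "(\<forall>q \<in> nxt t'. q \<le> p) \<and>
      (\<exists>s \<in> T. p \<in> m s \<and> (N s t' \<and> (\<exists>q \<in> m s. p < q) \<or> G s t'))" using 1 s by blast
qed

lemma nxt_below:
  assumes "2 * i \<le> prio" and "t' \<in> T'" and "p < i"
  shows "p \<in> nxt t' \<longleftrightarrow> p \<in> pre t'"
proof -
  have al: "{..p} \<subseteq> alive" using prio_ge(2)[OF assms(1)] assms(3) by auto
  show ?thesis
    using nxt_iff_cut(1)[OF al assms(2)] prio_ge(3)[OF assms(1)] assms(3) by (auto simp: cut_def)
qed

lemma step_cand:
  assumes "t \<in> T" and "N t t' \<or> G t t'"
  obtains W where "W \<in> cand t'" "m t \<subseteq> W" "\<And>q. q < K \<Longrightarrow> q \<in> W \<longleftrightarrow> q \<in> m t"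
    "G t t' \<Longrightarrow> \<exists>q \<in> W. K \<le> q"
proof (cases "G t t'")
  case True
  have "insert (fresh t) (m t) \<in> cand t'" using True assms(1) by (auto simp: cand_def)
  moreover have "q < K \<Longrightarrow> q \<in> insert (fresh t) (m t) \<longleftrightarrow> q \<in> m t" for q
    using fresh_ge[of t] by auto
  ultimately show ?thesis using that fresh_ge by blast
next
  case False
  then have "m t \<in> cand t'" using assms by (auto simp: cand_def)
  then show ?thesis using that False by blast
qed

text \<open>The memory of \<open>t\<close>, possibly with a fresh name, is among the candidates of
  \<open>t'\<close>. The chosen one is lexicographically at least as good, so it cannot lose
  \<open>p\<close> while agreeing on all older names.\<close>

lemma nxt_lex:
  assumes "2 * i \<le> prio" and "t \<in> T" and "t' \<in> T'" and "N t t' \<or> G t t'" and "p < i"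
    and "\<And>q. q < p \<Longrightarrow> q \<in> m t \<longleftrightarrow> q \<in> nxt t'" and "p \<in> m t"
  shows "p \<in> nxt t'"
proof -
  obtain W where W: "W \<in> cand t'" "m t \<subseteq> W" "\<And>q. q < K \<Longrightarrow> q \<in> W \<longleftrightarrow> q \<in> m t"
    using step_cand[OF assms(2,4)] by metis
  have pK: "p < K" using m_less assms by blast
  have same: "q \<in> pre t' \<longleftrightarrow> q \<in> W" if "q < p" for q
    using assms(6)[OF that] nxt_below[OF assms(1,3), of q] W(3)[of q] that assms(5) pK by simp
  have pW: "p \<in> W" using W assms by blast
  from pre_best[OF W(1)] have "p \<in> pre t'"
  proof
    assume "better (pre t') W"
    then obtain r where r: "r \<in> pre t'" "r \<notin> W" "\<forall>q < r. q \<in> pre t' \<longleftrightarrow> q \<in> W"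
      by (auto simp: better_def)
    then have "p < r" using same pW by (metis linorder_neqE_nat)
    then show ?thesis using r pW by blast
  qed (use pW in simp)
  then show ?thesis using nxt_below[OF assms(1,3,5)] by blast
qed

text \<open>The choice is at least as good as the candidate from \<open>t\<close>, so its first name
  from \<open>i\<close> on is no younger, and renumbering only lowers it. If the priority is
  \<open>2 * i\<close>, then \<open>i\<close> is a hole and the renumbering is strict. A fresh name
  is at least \<open>K\<close>, hence at least \<open>i\<close>.\<close>

lemma nxt_next_name:
  assumes "2 * i \<le> prio" and "t \<in> T" and "t' \<in> T'" and "N t t' \<or> G t t'"
    and same: "\<And>q. q < i \<Longrightarrow> q \<in> m t \<longleftrightarrow> q \<in> nxt t'"
  shows "G t t' \<Longrightarrow> \<exists>q \<in> nxt t'. i \<le> q"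
    and "p \<in> m t \<Longrightarrow> i \<le> p \<Longrightarrow> \<exists>q \<in> nxt t'. i \<le> q \<and> q \<le> p \<and> (prio = 2 * i \<longrightarrow> q < p)"
proof -
  obtain W where W: "W \<in> cand t'" "m t \<subseteq> W" "\<And>q. q < K \<Longrightarrow> q \<in> W \<longleftrightarrow> q \<in> m t"
      "G t t' \<Longrightarrow> \<exists>q \<in> W. K \<le> q"
    using step_cand[OF assms(2,4)] by metis
  have iK: "i \<le> K" using prio_ge(1)[OF assms(1)] gap_le by simp
  have sameW: "q \<in> pre t' \<longleftrightarrow> q \<in> W" if "q < i" for q
    using same[OF that] nxt_below[OF assms(1,3) that] W(3)[of q] that iK by simp
  have main: "\<exists>q \<in> nxt t'. i \<le> q \<and> q \<le> p \<and> (prio = 2 * i \<longrightarrow> q < p)" if "p \<in> W" "i \<le> p" for p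
  proof -
    have ex: "\<exists>q. q \<in> pre t' \<and> i \<le> q \<and> q \<le> p"
      using pre_best[OF W(1)]
    proof
      assume "better (pre t') W"
      then obtain r where r: "r \<in> pre t'" "r \<notin> W" "\<forall>q < r. q \<in> pre t' \<longleftrightarrow> q \<in> W"
        by (auto simp: better_def)
      then have "i \<le> r" using sameW not_less by blast
      then show ?thesis using r that by (cases "p < r") auto
    qed (use that in auto)
    define q where "q = (LEAST q. q \<in> pre t' \<and> i \<le> q)"
    have q: "q \<in> pre t'" "i \<le> q" using LeastI_ex[of "\<lambda>q. q \<in> pre t' \<and> i \<le> q"] ex unfolding q_def by blast+
    have least: "q \<le> r" if "r \<in> pre t'" "i \<le> r" for r
      unfolding q_def by (rule Least_le) (use that in blast)
    have "q \<le> p" using ex least by force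
    \<comment> \<open>By minimality of \<open>q\<close>, older names of \<open>pre t'\<close> lie
      below \<open>i\<close>, where the priority excludes flashes; so \<open>q\<close> survives the
      cut.\<close>
    have "\<not> flash r" if "r \<in> pre t'" "r < q" for r
      using prio_ge(3)[OF assms(1), of r] least[OF that(1)] that by linarith
    then have cut: "q \<in> cut t'" using q by (auto simp: cut_def)
    then have alive: "q \<in> alive" using cut_alive assms(3) by blast
    have "rank q \<in> nxt t'" using cut assms(3) by (auto simp: nxt_def)
    moreover have "i \<le> rank q" using rank_ge[OF prio_ge(2)[OF assms(1)] q(2)] .
    moreover have "rank q \<le> p" using rank_le[of q] \<open>q \<le> p\<close> by simp
    moreover have "rank q < p" if "prio = 2 * i"
    proof -
      have "i \<notin> alive" using prio_even[OF that] .
      then have "i < q" using alive q(2) by (metis le_neq_implies_less)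
      then show ?thesis using rank_less_self[OF \<open>i \<notin> alive\<close>] \<open>q \<le> p\<close> by (meson less_le_trans)
    qed
    ultimately show ?thesis by blast
  qed
  show "\<exists>q \<in> nxt t'. i \<le> q" if "G t t'"
  proof -
    obtain p where "p \<in> W" "K \<le> p" using W(4)[OF \<open>G t t'\<close>] by blast
    then show ?thesis using main[of p] iK by auto
  qed
  show "\<exists>q \<in> nxt t'. i \<le> q \<and> q \<le> p \<and> (prio = 2 * i \<longrightarrow> q < p)" if "p \<in> m t" "i \<le> p"
    using main that W(2) by blast
qed

end

lemma no_infinite_descent:
  fixes f :: "nat \<Rightarrow> nat"
  assumes "\<And>j. j \<ge> J \<Longrightarrow> f (Suc j) \<le> f j" and "infinite {j. j \<ge> J \<and> f (Suc j) < f j}"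
  shows False
proof -
  have mono: "f l \<le> f j" if "J \<le> j" "j \<le> l" for j l
    using that(2,1) by (induction l rule: dec_induct) (auto intro: order_trans[OF assms(1)])
  have "\<forall>j \<ge> J. f j \<noteq> k" for k
  proof (induction k rule: less_induct)
    case (less k)
    show ?case
    proof (intro allI impI notI)
      fix j assume j: "J \<le> j" "f j = k"
      obtain l where l: "j \<le> l" "f (Suc l) < f l"
        using assms(2) unfolding infinite_nat_iff_unbounded_le by blast
      then have "f (Suc l) < k" using mono[of j l] j by simp
      moreover have "J \<le> Suc l" using j l by simp
      ultimately show False using less by blast
    qed
  qed
  then show False by blast
qed

text \<open>Below \<open>i\<close> the names of the terms on a trace stabilise. After the next progress the trace always
  bears a name that is at least \<open>i\<close>; the least such name never grows and drops at each priority
  \<open>2 * i\<close>.\<close>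

lemma even_priority_no_trace:
  fixes T :: "nat \<Rightarrow> 't set" and \<tau> :: "nat \<Rightarrow> 't"
  assumes step: "\<And>j. memory_step (T j) (T (Suc j)) fresh K (m j)"
    and nxt: "\<And>j. m (Suc j) = memory_step.nxt (T j) (T (Suc j)) (N j) (G j) fresh (m j)"
    and pr: "\<And>j. 2 * i \<le> memory_step.prio (T j) (T (Suc j)) (N j) (G j) fresh (m j)"
    and inf: "infinite {j. memory_step.prio (T j) (T (Suc j)) (N j) (G j) fresh (m j) = 2 * i}"
    and mem: "\<And>j. j \<ge> J \<Longrightarrow> \<tau> j \<in> T j"
    and tr: "\<And>j. j \<ge> J \<Longrightarrow> N j (\<tau> j) (\<tau> (Suc j)) \<or> G j (\<tau> j) (\<tau> (Suc j))"
    and infG: "infinite {j. j \<ge> J \<and> G j (\<tau> j) (\<tau> (Suc j))}"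
  shows False
proof -
  define w where "w j = m j (\<tau> j)" for j
  have lex: "p \<in> w (Suc j)" if "j \<ge> J" "p < i" "\<And>q. q < p \<Longrightarrow> q \<in> w j \<longleftrightarrow> q \<in> w (Suc j)" "p \<in> w j" for j p
  proof -
    interpret memory_step "T j" "T (Suc j)" "N j" "G j" fresh K "m j" by (rule step)
    show ?thesis
      using nxt_lex[OF pr mem[OF that(1)] mem tr[OF that(1)] that(2)] that unfolding w_def nxt by simp
  qed
  \<comment> \<open>Once the names below \<open>p\<close> are constant along the trace,
    \<open>lex\<close> makes \<open>p\<close> permanent from its first appearance; if it never
    appears, it is constantly absent.\<close>
  have stable: "\<exists>J' \<ge> J. \<forall>j \<ge> J'. \<forall>q < p. q \<in> w j \<longleftrightarrow> q \<in> w J'" if "p \<le> i" for p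
    using that
  proof (induction p)
    case (Suc p)
    then obtain J1 where J1: "J1 \<ge> J" "\<And>j q. j \<ge> J1 \<Longrightarrow> q < p \<Longrightarrow> q \<in> w j \<longleftrightarrow> q \<in> w J1" by auto
    show ?case
    proof (cases "\<exists>j0 \<ge> J1. p \<in> w j0")
      case True
      then obtain j0 where j0: "j0 \<ge> J1" "p \<in> w j0" by blast
      have "p \<in> w j" if "j \<ge> j0" for j
        using that
      proof (induction j rule: dec_induct)
        case (step j)
        show ?case
        proof (rule lex[OF _ _ _ step.IH])
          show "q \<in> w j \<longleftrightarrow> q \<in> w (Suc j)" if "q < p" for q
            using J1(2)[of j q] J1(2)[of "Suc j" q] that step j0 by simp
        qed (use step j0 J1 Suc.prems in auto)
      qed (use j0 in simp)
      then have "\<forall>j \<ge> j0. \<forall>q < Suc p. q \<in> w j \<longleftrightarrow> q \<in> w j0"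
        using J1(2) j0 by (metis dual_order.trans less_antisym order_refl)
      then show ?thesis using j0 J1 by (meson dual_order.trans)
    next
      case False
      then have "\<forall>j \<ge> J1. \<forall>q < Suc p. q \<in> w j \<longleftrightarrow> q \<in> w J1"
        using J1(2) by (metis less_antisym order_refl)
      then show ?thesis using J1 by blast
    qed
  qed auto
  obtain J1 where J1: "J1 \<ge> J" "\<And>j q. j \<ge> J1 \<Longrightarrow> q < i \<Longrightarrow> q \<in> w j \<longleftrightarrow> q \<in> w J1"
    using stable[of i] by auto
  have same: "q \<in> w j \<longleftrightarrow> q \<in> w (Suc j)" if "j \<ge> J1" "q < i" for j q
    using J1(2)[of j q] J1(2)[of "Suc j" q] that by simp
  have next1: "\<exists>q \<in> w (Suc j). i \<le> q" if "j \<ge> J1" "G j (\<tau> j) (\<tau> (Suc j))" for j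
  proof -
    interpret memory_step "T j" "T (Suc j)" "N j" "G j" fresh K "m j" by (rule step)
    show ?thesis
      using nxt_next_name(1)[OF pr mem mem tr] that J1(1) same[OF that(1)]
      unfolding w_def nxt by simp
  qed
  have next2: "\<exists>q \<in> w (Suc j). i \<le> q \<and> q \<le> p \<and>
      (memory_step.prio (T j) (T (Suc j)) (N j) (G j) fresh (m j) = 2 * i \<longrightarrow> q < p)"
    if "j \<ge> J1" "p \<in> w j" "i \<le> p" for j p
  proof -
    interpret memory_step "T j" "T (Suc j)" "N j" "G j" fresh K "m j" by (rule step)
    show ?thesis
      using nxt_next_name(2)[OF pr mem mem tr] that J1(1) same[OF that(1)] unfolding w_def nxt by simp
  qed
  obtain J2 where J2: "J2 \<ge> J1" "G J2 (\<tau> J2) (\<tau> (Suc J2))"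
    using infG unfolding infinite_nat_iff_unbounded_le by blast
  have ne: "\<exists>q \<in> w j. i \<le> q" if "j \<ge> Suc J2" for j
    using that
  proof (induction j rule: dec_induct)
    case base
    then show ?case using next1 J2 by blast
  next
    case (step j)
    then show ?case using next2[of j] J2(1) by (meson Suc_leD dual_order.trans)
  qed
  define e where "e j = (LEAST q. q \<in> w j \<and> i \<le> q)" for j
  have e: "e j \<in> w j" "i \<le> e j" if "j \<ge> Suc J2" for j
    using LeastI_ex[of "\<lambda>q. q \<in> w j \<and> i \<le> q"] ne[OF that] unfolding e_def by blast+
  have e_le: "e j \<le> q" if "q \<in> w j" "i \<le> q" for j q
    unfolding e_def by (rule Least_le) (use that in blast)
  have e_step: "e (Suc j) \<le> e j \<and>
      (memory_step.prio (T j) (T (Suc j)) (N j) (G j) fresh (m j) = 2 * i \<longrightarrow> e (Suc j) < e j)"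
    if h: "j \<ge> Suc J2" for j
  proof -
    have "j \<ge> J1" using h J2(1) by simp
    then obtain q where "q \<in> w (Suc j)" "i \<le> q" "q \<le> e j"
      "memory_step.prio (T j) (T (Suc j)) (N j) (G j) fresh (m j) = 2 * i \<longrightarrow> q < e j"
      using next2[OF _ e(1)[OF h] e(2)[OF h]] \<open>j \<ge> J1\<close> by blast
    then show ?thesis using e_le[of q "Suc j"] by auto
  qed
  show False
  proof (rule no_infinite_descent[of "Suc J2" e])
    show "infinite {j. Suc J2 \<le> j \<and> e (Suc j) < e j}"
    proof
      assume "finite {j. Suc J2 \<le> j \<and> e (Suc j) < e j}"
      then have "finite ({j. Suc J2 \<le> j \<and> e (Suc j) < e j} \<union> {..J2})" by simp
      moreover have "{j. memory_step.prio (T j) (T (Suc j)) (N j) (G j) fresh (m j) = 2 * i} \<subseteq>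
          {j. Suc J2 \<le> j \<and> e (Suc j) < e j} \<union> {..J2}"
        using e_step by (auto simp: not_le)
      ultimately show False using inf finite_subset by blast
    qed
  qed (use e_step in blast)
qed

section \<open>Descent along a cyclic proof\<close>

lemma finite_subterms [simp]: "finite (subterms t)"
  by (induction t) auto

lemma inj_lift_trm: "inj lift_trm"
  by (rule inj_on_inverseI[where g = "subst_trm (case_nat Zero Var)"]) simp

lemma finite_terms_fm [simp]: "finite (terms_fm A)"
proof (induction A)
  case (Pos a) then show ?case by (cases a) auto
next
  case (Neg a) then show ?case by (cases a) auto
next
  case (All A)
  then show ?case using finite_vimageI[OF All inj_lift_trm] by (simp add: vimage_def)
next
  case (Ex A)
  then show ?case using finite_vimageI[OF Ex inj_lift_trm] by (simp add: vimage_def)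
qed auto

lemma finite_terms_seq [simp]: "finite (terms_seq s)"
  by (simp add: terms_seq_def)

lemma fv_lift_trm: "fv_trm (lift_trm t) = Suc ` fv_trm t"
  unfolding lift_trm_def by (induction t) auto

lemma fv_subterms: "s \<in> subterms t \<Longrightarrow> fv_trm s \<subseteq> fv_trm t"
  by (induction t) auto

lemma fv_terms_atm: "t \<in> terms_atm a \<Longrightarrow> fv_trm t \<subseteq> fv_atm a"
  using fv_subterms by (cases a) fastforce+

lemma fv_terms_fm: "t \<in> terms_fm A \<Longrightarrow> fv_trm t \<subseteq> fv_fm A"
proof (induction A arbitrary: t)
  case (All A)
  then have "fv_trm (lift_trm t) \<subseteq> fv_fm A" by simp
  then show ?case by (auto simp: fv_lift_trm)
next
  case (Ex A)
  then have "fv_trm (lift_trm t) \<subseteq> fv_fm A" by simp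
  then show ?case by (auto simp: fv_lift_trm)
next
  case (Pos a) then show ?case using fv_terms_atm by simp
next
  case (Neg a) then show ?case using fv_terms_atm by simp
qed fastforce+

text \<open>Makes the value of a trace term depend only on those variables of the sequent on which
  \<open>successor\<close> forces agreement.\<close>

lemma fv_terms_seq: "t \<in> terms_seq s \<Longrightarrow> fv_trm t \<subseteq> fv_seq s"
  using fv_terms_fm by (fastforce simp: terms_seq_def fv_seq_def)

text \<open>The trace condition is stated for branches from the root. A branch from a subtree is
  prolonged by its parent, and the trace found there is shifted by one.\<close>

lemma branch_trace:
  assumes "cyclic_proof P" and "S \<in> subtrees P" and "branch S b"
  shows "\<exists>m \<tau>. trace b m \<tau> \<and> infinite {i. m \<le> i \<and> progress b \<tau> i}"
  using assms(2,3)
proof (induction arbitrary: b rule: subtrees.induct)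
  case 1
  then show ?case using assms(1) unfolding cyclic_proof_def by blast
next
  case (2 S S')
  let ?c = "case_nat S b"
  have "branch S ?c" using 2(2,4) by (auto simp: branch_def split: nat.split)
  then obtain m \<tau> where \<tau>: "trace ?c m \<tau>" "infinite {i. m \<le> i \<and> progress ?c \<tau> i}"
    using 2(3) by blast
  have pr: "progress b (\<lambda>i. \<tau> (Suc i)) i \<longleftrightarrow> progress ?c \<tau> (Suc i)" for i
    by (simp add: progress_def)
  have "trace b m (\<lambda>i. \<tau> (Suc i))"
    unfolding trace_def
  proof (intro allI impI)
    fix i assume "m \<le> i"
    then have "m \<le> Suc i" by simp
    then show "\<tau> (Suc i) \<in> terms_seq (root (b i)) \<and>
        (precursor (b i) (\<tau> (Suc (Suc i))) (\<tau> (Suc i)) \<or> progress b (\<lambda>i. \<tau> (Suc i)) i)"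
      using \<tau>(1) unfolding trace_def pr by (metis old.nat.simps(5))
  qed
  moreover have "infinite {i. m \<le> i \<and> progress b (\<lambda>i. \<tau> (Suc i)) i}"
    unfolding infinite_nat_iff_unbounded_le
  proof
    fix k
    obtain l where l: "Suc (max k m) \<le> l" "progress ?c \<tau> l"
      using \<tau>(2) unfolding infinite_nat_iff_unbounded_le by blast
    obtain j where j: "l = Suc j" using l(1) by (cases l) auto
    then have "max k m \<le> j" "progress b (\<lambda>i. \<tau> (Suc i)) j" using l pr by auto
    then show "\<exists>j \<ge> k. j \<in> {i. m \<le> i \<and> progress b (\<lambda>i. \<tau> (Suc i)) i}" by auto
  qed
  ultimately show ?case by blast
qed

primrec reaches :: "('z \<Rightarrow> 'z \<Rightarrow> bool) \<Rightarrow> ('z \<Rightarrow> 'z \<Rightarrow> bool) \<Rightarrow> nat \<Rightarrow> 'z \<Rightarrow> bool" where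
  "reaches E F 0 z \<longleftrightarrow> (\<exists>z'. F z z')"
| "reaches E F (Suc k) z \<longleftrightarrow> (\<exists>z'. E z z' \<and> reaches E F k z')"

text \<open>Always moving to a vertex closer to an \<open>F\<close>-edge reaches one after finitely
  many moves, and then again from wherever it leads.\<close>

lemma recurrent_path:
  assumes FE: "\<And>z z'. F z z' \<Longrightarrow> E z z'" and closed: "\<And>z z'. E z z' \<Longrightarrow> z' \<in> A"
    and reach: "\<And>z. z \<in> A \<Longrightarrow> \<exists>k. reaches E F k z" and "z0 \<in> A"
  shows "\<exists>f. f 0 = z0 \<and> (\<forall>j. E (f j) (f (Suc j))) \<and> infinite {j. F (f j) (f (Suc j))}"
proof -
  define d where "d z = (LEAST k. reaches E F k z)" for z
  have "\<exists>z'. E z z' \<and> (F z z' \<or> d z' < d z)" if "z \<in> A" for z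
  proof -
    have "reaches E F (d z) z" unfolding d_def using reach[OF that] by (rule LeastI_ex)
    then show ?thesis
    proof (cases "d z")
      case 0
      then show ?thesis using \<open>reaches E F (d z) z\<close> FE by auto
    next
      case (Suc k)
      then obtain z' where "E z z'" "reaches E F k z'" using \<open>reaches E F (d z) z\<close> by auto
      moreover from this(2) have "d z' \<le> k" unfolding d_def by (rule Least_le)
      ultimately show ?thesis using Suc by auto
    qed
  qed
  then obtain nx where nx: "\<And>z. z \<in> A \<Longrightarrow> E z (nx z) \<and> (F z (nx z) \<or> d (nx z) < d z)" by metis
  define f where "f j = (nx ^^ j) z0" for j
  have fA: "f j \<in> A" for j
  proof (induction j)
    case 0 then show ?case using assms(4) by (simp add: f_def)
  next
    case (Suc j) then show ?case using nx closed by (simp add: f_def) blast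
  qed
  have fS: "f (Suc j) = nx (f j)" for j by (simp add: f_def)
  have "\<exists>l \<ge> j. F (f l) (f (Suc l))" for j
  proof (induction "d (f j)" arbitrary: j rule: less_induct)
    case less
    show ?case
    proof (cases "F (f j) (f (Suc j))")
      case False
      then have "d (f (Suc j)) < d (f j)" using nx[OF fA[of j]] fS by simp
      from less[OF this] show ?thesis using Suc_leD by blast
    qed blast
  qed
  then have "infinite {j. F (f j) (f (Suc j))}" unfolding infinite_nat_iff_unbounded_le by blast
  moreover have "f 0 = z0" by (simp add: f_def)
  ultimately show ?thesis using nx fA fS by metis
qed

context induction_model
begin

lemma Sigma_def_True: "(\<lambda>_. True) \<in> Sigma_def M k"
  using Sigma_def_bounded[of "Pos (Eq Zero Zero)" M Inl k] by (simp add: bounded.intros)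

lemma Sigma_def_False: "(\<lambda>_. False) \<in> Sigma_def M k"
  using Sigma_def_bounded[of "Neg (Eq Zero Zero)" M Inl k] by (simp add: bounded.intros)

lemma Sigma_def_ball:
  assumes "finite X" and "\<And>x. x \<in> X \<Longrightarrow> R x \<in> Sigma_def M k"
  shows "(\<lambda>\<rho>. \<forall>x \<in> X. R x \<rho>) \<in> Sigma_def M k"
  using assms
proof (induction X)
  case (insert x X)
  then have "(\<lambda>\<rho>. R x \<rho> \<and> (\<forall>x \<in> X. R x \<rho>)) \<in> Sigma_def M k" by (intro Sigma_def_conj) auto
  then show ?case by simp
qed (simp add: Sigma_def_True)

lemma Sigma_def_bex:
  assumes "finite X" and "\<And>x. x \<in> X \<Longrightarrow> R x \<in> Sigma_def M k"
  shows "(\<lambda>\<rho>. \<exists>x \<in> X. R x \<rho>) \<in> Sigma_def M k"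
  using assms
proof (induction X)
  case (insert x X)
  then have "(\<lambda>\<rho>. R x \<rho> \<or> (\<exists>x \<in> X. R x \<rho>)) \<in> Sigma_def M k" by (intro Sigma_def_disj) auto
  then show ?case by simp
qed (simp add: Sigma_def_False)

lemma falsified_definable:
  assumes "fms s \<subseteq> Sigma_fms n"
  shows "(\<lambda>\<rho>. \<not> sat_seq M \<rho> s) \<in> Sigma_def M (Suc n)"
proof -
  have "(\<lambda>\<rho>. (\<forall>A \<in> fset (ante s). sat M \<rho> A) \<and> (\<forall>A \<in> fset (succ s). \<not> sat M \<rho> A)) \<in> Sigma_def M (Suc n)"
  proof (intro Sigma_def_conj Sigma_def_ball)
    fix A assume "A \<in> fset (ante s)"
    then have "A \<in> Sigma_fms n" using assms by (auto simp: fms_def)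
    then show "(\<lambda>\<rho>. sat M \<rho> A) \<in> Sigma_def M (Suc n)" using Sigma_def_sat Sigma_def_Suc by blast
  next
    fix A assume "A \<in> fset (succ s)"
    then have "A \<in> Sigma_fms n" using assms by (auto simp: fms_def)
    then show "(\<lambda>\<rho>. \<not> sat M \<rho> A) \<in> Sigma_def M (Suc n)" by (intro Sigma_def_not Sigma_def_sat)
  qed auto
  moreover have "(\<lambda>\<rho>. (\<forall>A \<in> fset (ante s). sat M \<rho> A) \<and> (\<forall>A \<in> fset (succ s). \<not> sat M \<rho> A)) =
      (\<lambda>\<rho>. \<not> sat_seq M \<rho> s)" by (auto simp: sat_seq_def fun_eq_iff)
  ultimately show ?thesis by simp
qed

lemma Q_initial_sat: "Q_initial s \<Longrightarrow> sat_seq M \<rho> s"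
proof (induction rule: Q_initial.induct)
  case (1 A \<theta>)
  then show ?case using Q_axiom by (simp add: sat_seq_def sat_subst_fm)
next
  case (2 t)
  then show ?case using zero_or_Suc by (auto simp: sat_seq_def)
next
  case (3 t u)
  then show ?case using lt_iff by (auto simp: sat_seq_def)
next
  case (4 t r u)
  then show ?case using lt_iff by (auto simp: sat_seq_def)
qed

text \<open>Supplies the initial bound which shows that the set of bounds to be minimised is
  nonempty.\<close>

lemma strict_upper_bound:
  assumes "finite X"
  shows "\<exists>a. \<forall>x \<in> X. lt x a"
  using assms
proof (induction X)
  case (insert x X)
  then obtain a where a: "\<forall>y \<in> X. lt y a" by blast
  show ?case
  proof (cases "lt x a")
    case False
    then have "le a x" using lt_linear by (auto simp: le_def)
    then have "\<forall>y \<in> X. lt y (Suc_op M x)" using a lt_Suc_iff le_def lt_le_trans by blast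
    then show ?thesis using lt_Suc_iff le_def by blast
  qed (use a in blast)
qed auto

end

type_synonym memory = "trm \<Rightarrow> nat set"

text \<open>Progress as a property of a single edge, so that it can label a finite graph
  independently of a branch.\<close>

definition progresses :: "tree \<Rightarrow> tree \<Rightarrow> trm \<Rightarrow> trm \<Rightarrow> bool" where
  "progresses v w t t' \<longleftrightarrow> (\<exists>s. precursor v s t \<and> Pos (Less t' s) |\<in>| ante (root w))"

lemma progress_iff: "progress b \<tau> i \<longleftrightarrow> progresses (b i) (b (Suc i)) (\<tau> i) (\<tau> (Suc i))"
  by (simp add: progress_def progresses_def)

locale cyclic_in_model = induction_model M n for M :: "'a interp" and n +
  fixes P :: tree
  assumes cyclic: "cyclic_proof P" and level: "\<And>S. S \<in> subtrees P \<Longrightarrow> fms (root S) \<subseteq> Sigma_fms n"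
begin

abbreviation terms_at :: "tree \<Rightarrow> trm set" where
  "terms_at v \<equiv> terms_seq (root v)"

text \<open>Counting the terms of the whole proof, rather than of one sequent, gives all steps the
  same range of names and priorities.\<close>

definition names :: nat where
  "names = card (\<Union>v \<in> subtrees P. terms_at v)"

definition fresh_name :: "trm \<Rightarrow> nat" where
  "fresh_name t = names + to_nat t"

text \<open>Fixing the value outside the terms of the sequent leaves only finitely many memories.
  The other two clauses are the invariants that \<open>memory_step\<close> requires.\<close>

definition memories :: "tree \<Rightarrow> memory set" where
  "memories v = {m. (\<forall>t. t \<notin> terms_at v \<longrightarrow> m t = {}) \<and> (\<forall>t. m t \<subseteq> {..<names}) \<and>
    (\<forall>s t p q. p \<in> m s \<longrightarrow> p \<in> m t \<longrightarrow> q < p \<longrightarrow> (q \<in> m s \<longleftrightarrow> q \<in> m t))}"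

definition states :: "(tree \<times> memory) set" where
  "states = (SIGMA v : subtrees P. memories v)"

definition update :: "tree \<Rightarrow> tree \<Rightarrow> memory \<Rightarrow> memory" where
  "update v w = memory_step.nxt (terms_at v) (terms_at w) (\<lambda>t t'. precursor v t' t) (progresses v w) fresh_name"

definition priority :: "tree \<Rightarrow> tree \<Rightarrow> memory \<Rightarrow> nat" where
  "priority v w = memory_step.prio (terms_at v) (terms_at w) (\<lambda>t t'. precursor v t' t) (progresses v w) fresh_name"

lemma finite_subtrees: "finite (subtrees P)"
  using cyclic by (simp add: cyclic_proof_def regular_def)

lemma finite_states: "finite states"
proof -
  have "finite (memories v)" for v
  proof (rule finite_subset)
    show "memories v \<subseteq> {m. \<forall>t. (t \<in> terms_at v \<longrightarrow> m t \<in> Pow {..<names}) \<and> (t \<notin> terms_at v \<longrightarrow> m t = {})}"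
      by (auto simp: memories_def)
    show "finite {m. \<forall>t. (t \<in> terms_at v \<longrightarrow> m t \<in> Pow {..<names}) \<and> (t \<notin> terms_at v \<longrightarrow> m t = {})}"
      by (rule finite_set_of_finite_funs) auto
  qed
  then show ?thesis unfolding states_def using finite_subtrees by blast
qed

lemma card_terms: "v \<in> subtrees P \<Longrightarrow> card (terms_at v) \<le> names"
  unfolding names_def by (rule card_mono) (use finite_subtrees in auto)

lemma memory_stepI:
  assumes "m \<in> memories v" and "w \<in> subtrees P"
  shows "memory_step (terms_at v) (terms_at w) fresh_name names m"
proof
  show "card (terms_at w) \<le> names" using card_terms assms by blast
  show "s = t" if "fresh_name s = fresh_name t" for s t using that by (simp add: fresh_name_def)
  show "names \<le> fresh_name t" for t by (simp add: fresh_name_def)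
  show "p < names" if "p \<in> m t" for p t using assms(1) that by (auto simp: memories_def)
  show "q \<in> m s \<longleftrightarrow> q \<in> m t" if "p \<in> m s" "p \<in> m t" "q < p" for s t p q
    using assms(1) that unfolding memories_def by blast
qed auto

lemma update_memories:
  assumes "m \<in> memories v" and "w \<in> subtrees P"
  shows "update v w m \<in> memories w"
proof -
  interpret memory_step "terms_at v" "terms_at w" "\<lambda>t t'. precursor v t' t" "progresses v w" fresh_name names m
    by (rule memory_stepI[OF assms])
  have "\<forall>t. t \<notin> terms_at w \<longrightarrow> nxt t = {}" using nxt_outside by blast
  moreover have "\<forall>t. nxt t \<subseteq> {..<names}" using nxt_less by blast
  moreover have "\<forall>s t p q. p \<in> nxt s \<longrightarrow> p \<in> nxt t \<longrightarrow> q < p \<longrightarrow> (q \<in> nxt s \<longleftrightarrow> q \<in> nxt t)"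
    using nxt_laminar by blast
  ultimately show ?thesis unfolding memories_def update_def by blast
qed

definition descends :: "tree \<Rightarrow> tree \<Rightarrow> (nat \<Rightarrow> 'a) \<Rightarrow> (nat \<Rightarrow> 'a) \<Rightarrow> bool" where
  "descends v w \<rho> \<rho>' \<longleftrightarrow> (\<forall>t \<in> terms_at v. \<forall>t'.
     (precursor v t' t \<longrightarrow> eval M \<rho>' t' = eval M \<rho> t) \<and>
     (progresses v w t t' \<longrightarrow> lt (eval M \<rho>' t') (eval M \<rho> t)))"

text \<open>A falsified sequent has a true antecedent. Thus the equations behind precursors hold at
  the parent and the inequalities behind progress hold at the child. Initial sequents for
  \<open>Q\<close> are excluded, being true in the model.\<close>

lemma falsified_child:
  assumes "v \<in> subtrees P" and "\<not> sat_seq M \<rho> (root v)"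
  shows "\<exists>w \<in> set (children v). \<exists>\<rho>'. \<not> sat_seq M \<rho>' (root w) \<and> descends v w \<rho> \<rho>'"
proof -
  have "arith_step (label v) (map root (children v)) (root v)"
    using cyclic assms(1) by (auto simp: cyclic_proof_def preproof_def)
  then have "fol_step (label v) (map root (children v)) (root v)"
    using Q_initial_sat assms(2) by (auto elim: arith_step.cases)
  from fol_step_falsified[OF this assms(2)] obtain w \<rho>' where w: "w \<in> set (children v)"
    "\<not> sat_seq M \<rho>' (root w)" "successor M (label v) (root v) \<rho> \<rho>'" by auto
  have pre: "eval M \<rho>' s = eval M \<rho> t" if "t \<in> terms_at v" "precursor v s t" for s t
  proof (cases "\<exists>\<theta>. label v = Sub \<theta>")
    case True
    then show ?thesis using w(3) that(2) by (auto simp: successor_def precursor_def eval_subst_trm)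
  next
    case False
    then have agree: "\<forall>i \<in> fv_seq (root v). \<rho>' i = \<rho> i"
      using w(3) unfolding successor_def by (cases "label v") auto
    have "Pos (Eq s t) |\<in>| ante (root v) \<or> s = t"
      using False that(2) unfolding precursor_def by (cases "label v") auto
    then have "eval M \<rho> s = eval M \<rho> t \<and> fv_trm s \<subseteq> fv_seq (root v)"
    proof
      assume eq: "Pos (Eq s t) |\<in>| ante (root v)"
      then have "sat M \<rho> (Pos (Eq s t))" using assms(2) unfolding sat_seq_def by blast
      moreover have "fv_fm (Pos (Eq s t)) \<subseteq> fv_seq (root v)"
        using eq unfolding fv_seq_def fms_def by blast
      ultimately show ?thesis by simp
    qed (use fv_terms_seq that(1) in blast)
    moreover have "eval M \<rho>' s = eval M \<rho> s" if "fv_trm s \<subseteq> fv_seq (root v)"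
      by (rule eval_cong) (use agree that in blast)
    ultimately show ?thesis by simp
  qed
  have "lt (eval M \<rho>' t') (eval M \<rho> t)" if t: "t \<in> terms_at v" and p: "progresses v w t t'" for t t'
  proof -
    obtain s where s: "precursor v s t" "Pos (Less t' s) |\<in>| ante (root w)"
      using p by (auto simp: progresses_def)
    then have "sat M \<rho>' (Pos (Less t' s))" using w(2) unfolding sat_seq_def by blast
    then show ?thesis using pre[OF t s(1)] by simp
  qed
  then have "descends v w \<rho> \<rho>'" using pre unfolding descends_def by blast
  then show ?thesis using w by blast
qed

text \<open>A term that bears \<open>p\<close> and a younger name has progressed since \<open>p\<close> last
  flashed, so the bound is strict there. This is why the bound can be lowered at the next flash.\<close>

definition below :: "nat \<Rightarrow> tree \<times> memory \<Rightarrow> (nat \<Rightarrow> 'a) \<Rightarrow> 'a \<Rightarrow> bool" where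
  "below p z \<rho> a \<longleftrightarrow> (\<forall>t \<in> {t \<in> terms_at (fst z). p \<in> snd z t}. le (eval M \<rho> t) a) \<and>
     (\<forall>t \<in> {t \<in> terms_at (fst z). p \<in> snd z t \<and> (\<exists>q \<in> snd z t. p < q)}. lt (eval M \<rho> t) a)"

text \<open>Coordinate 0 holds the bound and the remaining ones the assignment, the format of
  \<open>Sigma_def_ex_assignment\<close>. As no quantifier occurs, the level is arbitrary.\<close>

lemma below_definable: "(\<lambda>\<sigma>. below p z (\<lambda>i. \<sigma> (Suc i)) (\<sigma> 0)) \<in> Sigma_def M k"
proof -
  have \<sigma>: "case_nat (\<sigma> 0) (\<lambda>i. \<sigma> (Suc i)) = \<sigma>" for \<sigma> :: "nat \<Rightarrow> 'a"
    by (auto simp: fun_eq_iff split: nat.split)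
  have lift: "eval M \<sigma> (lift_trm t) = eval M (\<lambda>i. \<sigma> (Suc i)) t" for \<sigma> t
    using eval_lift_trm[of M "\<sigma> 0" "\<lambda>i. \<sigma> (Suc i)" t] by (simp add: \<sigma>)
  have "(\<lambda>\<sigma>. le (eval M (\<lambda>i. \<sigma> (Suc i)) t) (\<sigma> 0)) \<in> Sigma_def M k" for t
    using Sigma_def_bounded[of "Or (Pos (Less (lift_trm t) (Var 0))) (Pos (Eq (lift_trm t) (Var 0)))" M Inl k]
    by (simp add: bounded.intros lift le_def)
  moreover have "(\<lambda>\<sigma>. lt (eval M (\<lambda>i. \<sigma> (Suc i)) t) (\<sigma> 0)) \<in> Sigma_def M k" for t
    using Sigma_def_bounded[of "Pos (Less (lift_trm t) (Var 0))" M Inl k]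
    by (simp add: bounded.intros lift)
  ultimately show ?thesis unfolding below_def by (intro Sigma_def_conj Sigma_def_ball) auto
qed

text \<open>No family of definable sets of assignments, one for each state, is nonempty and closed under
  steps of priority at least \<open>i\<close>. For odd \<open>i = 2p + 1\<close> the family is restricted to the assignments
  attaining the least bound on the terms named \<open>p\<close>, which excludes flashes of \<open>p\<close>; for even \<open>i\<close>
  to the states from which no step of priority \<open>i\<close> is reachable, which exist since otherwise there
  would be a branch without an infinitely progressing trace. Only priorities above \<open>i\<close> remain.\<close>

definition closed_under_steps :: "nat \<Rightarrow> (tree \<times> memory \<Rightarrow> (nat \<Rightarrow> 'a) \<Rightarrow> bool) \<Rightarrow> bool" where
  "closed_under_steps i D \<longleftrightarrow> (\<forall>z. D z \<in> Sigma_def M (Suc n)) \<and> (\<forall>v m \<rho>. D (v, m) \<rho> \<longrightarrow>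
     (v, m) \<in> states \<and> (\<exists>w \<in> set (children v). \<exists>\<rho>'. D (w, update v w m) \<rho>' \<and>
       i \<le> priority v w m \<and> descends v w \<rho> \<rho>'))"

lemma closed_under_stepsD:
  assumes "closed_under_steps i D" and "D (v, m) \<rho>"
  obtains w \<rho>' where "w \<in> set (children v)" "D (w, update v w m) \<rho>'" "i \<le> priority v w m"
    "descends v w \<rho> \<rho>'" "v \<in> subtrees P" "m \<in> memories v" "w \<in> subtrees P"
  using assms unfolding closed_under_steps_def states_def by (blast intro: subtrees.intros(2))

lemma update_below:
  assumes "m \<in> memories v" and "w \<in> subtrees P" and "descends v w \<rho> \<rho>'" and "below p (v, m) \<rho> a"
    and "2 * p < priority v w m"
  shows "below p (w, update v w m) \<rho>' a"
proof -
  interpret memory_step "terms_at v" "terms_at w" "\<lambda>t t'. precursor v t' t" "progresses v w" fresh_name names m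
    by (rule memory_stepI[OF assms(1,2)])
  have "le (eval M \<rho>' t') a \<and> ((\<exists>q \<in> update v w m t'. p < q) \<longrightarrow> lt (eval M \<rho>' t') a)"
    if t': "t' \<in> terms_at w" "p \<in> update v w m t'" for t'
  proof -
    obtain s where s: "s \<in> terms_at v" "p \<in> m s"
      "precursor v t' s \<and> ((\<exists>q \<in> update v w m t'. p < q) \<longrightarrow> (\<exists>q \<in> m s. p < q)) \<or> progresses v w s t'"
      using nxt_pred[of p t'] assms(5) t' unfolding update_def priority_def by blast
    have b: "le (eval M \<rho> s) a" "(\<exists>q \<in> m s. p < q) \<Longrightarrow> lt (eval M \<rho> s) a"
      using assms(4) s(1,2) unfolding below_def by auto
    from s(3) show ?thesis
    proof
      assume "progresses v w s t'"
      then have "lt (eval M \<rho>' t') (eval M \<rho> s)" using assms(3) s(1) unfolding descends_def by blast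
      then show ?thesis using b(1) lt_le_trans le_def by blast
    next
      assume *: "precursor v t' s \<and> ((\<exists>q \<in> update v w m t'. p < q) \<longrightarrow> (\<exists>q \<in> m s. p < q))"
      then have "eval M \<rho>' t' = eval M \<rho> s" using assms(3) s(1) unfolding descends_def by blast
      then show ?thesis using b * by simp
    qed
  qed
  then show ?thesis unfolding below_def by auto
qed

text \<open>All bearers of \<open>p\<close> are now strictly below \<open>a\<close> and bear no
  younger name, so the strict clause of \<open>below\<close> becomes empty and the predecessor of
  \<open>a\<close> is a bound.\<close>

lemma flash_below:
  assumes "m \<in> memories v" and "w \<in> subtrees P" and "descends v w \<rho> \<rho>'" and "below p (v, m) \<rho> a"
    and "priority v w m = 2 * p + 1"
  shows "\<exists>b. lt b a \<and> below p (w, update v w m) \<rho>' b"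
proof -
  interpret memory_step "terms_at v" "terms_at w" "\<lambda>t t'. precursor v t' t" "progresses v w" fresh_name names m
    by (rule memory_stepI[OF assms(1,2)])
  have pr: "prio = 2 * p + 1" using assms(5) unfolding priority_def .
  have *: "lt (eval M \<rho>' t') a \<and> (\<forall>q \<in> update v w m t'. q \<le> p)"
    if t': "t' \<in> terms_at w" "p \<in> update v w m t'" for t'
  proof -
    have up: "\<forall>q \<in> update v w m t'. q \<le> p"
      using nxt_flash(2)[OF pr, of t'] t' unfolding update_def by blast
    obtain s where s: "s \<in> terms_at v" "p \<in> m s"
      "precursor v t' s \<and> (\<exists>q \<in> m s. p < q) \<or> progresses v w s t'"
      using nxt_flash(2)[OF pr, of t'] t' unfolding update_def by blast
    have b: "le (eval M \<rho> s) a" "(\<exists>q \<in> m s. p < q) \<Longrightarrow> lt (eval M \<rho> s) a"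
      using assms(4) s(1,2) unfolding below_def by auto
    from s(3) have "lt (eval M \<rho>' t') a"
    proof
      assume "progresses v w s t'"
      then have "lt (eval M \<rho>' t') (eval M \<rho> s)" using assms(3) s(1) unfolding descends_def by blast
      then show ?thesis using b(1) lt_le_trans by blast
    next
      assume *: "precursor v t' s \<and> (\<exists>q \<in> m s. p < q)"
      then have "eval M \<rho>' t' = eval M \<rho> s" using assms(3) s(1) unfolding descends_def by blast
      then show ?thesis using b * by simp
    qed
    then show ?thesis using up by blast
  qed
  \<comment> \<open>Some bearer exists, so some value lies below \<open>a\<close>; hence
    \<open>a\<close> is not zero and has a predecessor.\<close>
  obtain t0 where "t0 \<in> terms_at w" "p \<in> update v w m t0"
    using nxt_flash(1)[OF pr] unfolding update_def by blast
  then have "lt (eval M \<rho>' t0) a" using * by blast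
  then obtain b where a: "a = Suc_op M b" using zero_or_Suc[of a] not_lt_zero by blast
  have "below p (w, update v w m) \<rho>' b"
    unfolding below_def using * by (fastforce simp: a lt_Suc_iff)
  moreover have "lt b a" by (simp add: a lt_Suc_iff le_def)
  ultimately show ?thesis by blast
qed

text \<open>Downward induction on \<open>i\<close>. By \<open>prio_le\<close> no step has priority
  above \<open>2 * names\<close>, so the top level admits no members; below it, a nonempty family at
  \<open>i\<close> is shrunk to a nonempty family at \<open>i + 1\<close>.\<close>

lemma no_descent:
  assumes "i \<le> Suc (2 * names)" and "closed_under_steps i D"
  shows "\<not> D z \<rho>"
  using assms
proof (induction i arbitrary: D z \<rho> rule: inc_induct)
  case base
  show ?case
  proof
    assume "D z \<rho>"
    obtain v m where z: "z = (v, m)" by (cases z)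
    then obtain w where w: "Suc (2 * names) \<le> priority v w m" "m \<in> memories v" "w \<in> subtrees P"
      using closed_under_stepsD[OF base] \<open>D z \<rho>\<close> by metis
    interpret memory_step "terms_at v" "terms_at w" "\<lambda>t t'. precursor v t' t" "progresses v w" fresh_name names m
      by (rule memory_stepI[OF w(2,3)])
    show False using prio_le w(1) unfolding priority_def by simp
  qed
next
  case (step i)
  note D = step.prems
  have D_def: "D z \<in> Sigma_def M (Suc n)" for z
    using D unfolding closed_under_steps_def by blast
  have D_states: "D z \<rho> \<Longrightarrow> z \<in> states" for z \<rho>
    using D unfolding closed_under_steps_def by (cases z) blast
  show ?case
  proof (cases "even i")
    case True
    then obtain p where i: "i = 2 * p" by (elim evenE)
    define A where "A = {z. \<exists>\<rho>. D z \<rho>}"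
    \<comment> \<open>Edges join inhabited states but forget the assignments. Consecutive edges of a
      path need not come from one chain of assignments; the trace condition only sees the
      branch.\<close>
    define E where "E z z' \<longleftrightarrow> z \<in> A \<and> z' \<in> A \<and> fst z' \<in> set (children (fst z)) \<and>
      snd z' = update (fst z) (fst z') (snd z) \<and> i \<le> priority (fst z) (fst z') (snd z)" for z z'
    define F where "F z z' \<longleftrightarrow> E z z' \<and> priority (fst z) (fst z') (snd z) = i" for z z'
    have "\<exists>z0 \<in> A. \<forall>k. \<not> reaches E F k z0" if ne: "A \<noteq> {}"
    proof (rule ccontr)
      assume "\<not> ?thesis"
      then have reach: "\<exists>k. reaches E F k z" if "z \<in> A" for z using that by blast
      obtain z0 where z0: "z0 \<in> A" using ne by blast
      have "\<exists>f. f 0 = z0 \<and> (\<forall>j. E (f j) (f (Suc j))) \<and> infinite {j. F (f j) (f (Suc j))}"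
      proof (rule recurrent_path[where A = A])
        show "E z z'" if "F z z'" for z z' using that by (simp add: F_def)
        show "z' \<in> A" if "E z z'" for z z' using that by (simp add: E_def)
      qed (fact reach z0)+
      then obtain f where f: "\<And>j. E (f j) (f (Suc j))" "infinite {j. F (f j) (f (Suc j))}"
        by blast
      define b where "b j = fst (f j)" for j
      have st: "b j \<in> subtrees P" "snd (f j) \<in> memories (b j)" for j
      proof -
        have "f j \<in> A" using f(1)[of j] by (simp add: E_def)
        then have "f j \<in> states" using D_states unfolding A_def by blast
        then show "b j \<in> subtrees P" "snd (f j) \<in> memories (b j)"
          by (auto simp: states_def b_def)
      qed
      have "branch (b 0) b" using f(1) unfolding branch_def E_def b_def by blast
      then obtain J \<tau> where \<tau>: "trace b J \<tau>" "infinite {i. J \<le> i \<and> progress b \<tau> i}"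
        using branch_trace[OF cyclic st(1)] by blast
      show False
      proof (rule even_priority_no_trace[where T = "\<lambda>j. terms_at (b j)" and fresh = fresh_name and K = names
            and m = "\<lambda>j. snd (f j)" and N = "\<lambda>j t t'. precursor (b j) t' t"
            and G = "\<lambda>j. progresses (b j) (b (Suc j))" and i = p and J = J and \<tau> = \<tau>])
        show "memory_step (terms_at (b j)) (terms_at (b (Suc j))) fresh_name names (snd (f j))" for j
          by (rule memory_stepI[OF st(2) st(1)])
        show "snd (f (Suc j)) = memory_step.nxt (terms_at (b j)) (terms_at (b (Suc j)))
            (\<lambda>t t'. precursor (b j) t' t) (progresses (b j) (b (Suc j))) fresh_name (snd (f j))" for j
          using f(1)[of j] by (simp add: E_def b_def update_def)
        show "2 * p \<le> memory_step.prio (terms_at (b j)) (terms_at (b (Suc j)))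
            (\<lambda>t t'. precursor (b j) t' t) (progresses (b j) (b (Suc j))) fresh_name (snd (f j))" for j
          using f(1)[of j] by (simp add: E_def b_def priority_def i)
        have "F (f j) (f (Suc j)) \<longleftrightarrow> memory_step.prio (terms_at (b j)) (terms_at (b (Suc j)))
            (\<lambda>t t'. precursor (b j) t' t) (progresses (b j) (b (Suc j))) fresh_name (snd (f j)) = 2 * p" for j
          using f(1)[of j] by (simp add: F_def b_def priority_def i)
        then show "infinite {j. memory_step.prio (terms_at (b j)) (terms_at (b (Suc j)))
            (\<lambda>t t'. precursor (b j) t' t) (progresses (b j) (b (Suc j))) fresh_name (snd (f j)) = 2 * p}"
          using f(2) by simp
        show "\<tau> j \<in> terms_at (b j)" if "J \<le> j" for j
          using \<tau>(1) that by (simp add: trace_def)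
        show "precursor (b j) (\<tau> (Suc j)) (\<tau> j) \<or> progresses (b j) (b (Suc j)) (\<tau> j) (\<tau> (Suc j))"
          if "J \<le> j" for j
          using \<tau>(1) that by (simp add: trace_def progress_iff)
        show "infinite {j. J \<le> j \<and> progresses (b j) (b (Suc j)) (\<tau> j) (\<tau> (Suc j))}"
          using \<tau>(2) by (simp add: progress_iff)
      qed
    qed
    moreover have "False" if z0: "z0 \<in> A" "\<forall>k. \<not> reaches E F k z0" for z0
    proof -
      \<comment> \<open>The new condition depends on the state alone, so each \<open>D' z\<close> is
        either \<open>D z\<close> or empty and stays definable.\<close>
      define D' where "D' z \<rho> \<longleftrightarrow> D z \<rho> \<and> (\<forall>k. \<not> reaches E F k z)" for z \<rho>
      have "closed_under_steps (Suc i) D'"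
        unfolding closed_under_steps_def
      proof (intro conjI allI impI)
        show "D' z \<in> Sigma_def M (Suc n)" for z
        proof (cases "\<forall>k. \<not> reaches E F k z")
          case True
          then have "D' z = D z" by (simp add: D'_def[abs_def])
          then show ?thesis using D_def by metis
        next
          case False
          then have "D' z = (\<lambda>_. False)" by (auto simp: D'_def[abs_def])
          then show ?thesis using Sigma_def_False by metis
        qed
      next
        fix v m \<rho> assume D': "D' (v, m) \<rho>"
        then have DD: "D (v, m) \<rho>" by (simp add: D'_def)
        show "(v, m) \<in> states" using D_states[OF DD] .
        obtain w \<rho>' where w: "w \<in> set (children v)" "D (w, update v w m) \<rho>'" "i \<le> priority v w m"
          "descends v w \<rho> \<rho>'" using closed_under_stepsD[OF D DD] by metis
        have E: "E (v, m) (w, update v w m)" using w DD by (auto simp: E_def A_def)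
        have "\<not> reaches E F 0 (v, m)" "\<not> reaches E F (Suc k) (v, m)" for k
          using D' unfolding D'_def by blast+
        then have "\<not> F (v, m) (w, update v w m)" "\<not> reaches E F k (w, update v w m)" for k
          using E by auto
        then have "Suc i \<le> priority v w m" "D' (w, update v w m) \<rho>'"
          using E w by (auto simp: F_def D'_def)
        then show "\<exists>w \<in> set (children v). \<exists>\<rho>'. D' (w, update v w m) \<rho>' \<and>
            Suc i \<le> priority v w m \<and> descends v w \<rho> \<rho>'" using w by blast
      qed
      then have "\<not> D' z0 \<rho>" for \<rho> by (rule step.IH)
      then show False using z0 by (auto simp: A_def D'_def)
    qed
    ultimately have "A = {}" by blast
    then show ?thesis unfolding A_def by blast
  next
    case False
    then obtain p where i: "i = 2 * p + 1" by (elim oddE)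
    show ?thesis
    proof
      assume "D z \<rho>"
      define R where "R z \<sigma> \<longleftrightarrow> D z (\<lambda>i. \<sigma> (Suc i)) \<and> below p z (\<lambda>i. \<sigma> (Suc i)) (\<sigma> 0)" for z \<sigma>
      have env_Suc: "env (\<lambda>i. Inl (Suc i)) \<sigma> = (\<lambda>i. \<sigma> (Suc i))" for \<sigma> :: "nat \<Rightarrow> 'a"
        by (auto simp: env_def)
      have R: "R z \<in> Sigma_def M (Suc n)" for z
        using Sigma_def_conj[OF Sigma_def_reindex[OF D_def[of z], of "\<lambda>i. Inl (Suc i)"] below_definable[of p z]]
        by (simp add: env_Suc R_def[abs_def])
      \<comment> \<open>The set of all bounds on terms named \<open>p\<close> at any state: a finite
        disjunction over states and a quantifier over assignments, hence still of level
        \<open>Suc n\<close>.\<close>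
      define B where "B \<sigma> \<longleftrightarrow> (\<exists>z \<in> states. \<exists>\<rho>. R z (case_nat (\<sigma> 0) \<rho>))" for \<sigma> :: "nat \<Rightarrow> 'a"
      have B_Sigma: "B \<in> Sigma_def M (Suc n)"
        unfolding B_def[abs_def] by (intro Sigma_def_bex finite_states Sigma_def_ex_assignment R)
      have B: "B (case_nat a \<sigma>) \<longleftrightarrow> (\<exists>z \<rho>. D z \<rho> \<and> below p z \<rho> a)" for a \<sigma>
        using D_states by (auto simp: B_def R_def)
      obtain c where "\<forall>x \<in> eval M \<rho> ` terms_at (fst z). lt x c"
        using strict_upper_bound[of "eval M \<rho> ` terms_at (fst z)"] by auto
      then have "below p z \<rho> c" by (auto simp: below_def le_def)
      then have "B (case_nat c \<rho>)" using \<open>D z \<rho>\<close> B by blast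
      from least_number[OF B_Sigma this] obtain a where "B (case_nat a \<rho>)"
        and least: "\<And>b. lt b a \<Longrightarrow> \<not> B (case_nat b \<rho>)" by blast
      then obtain z1 \<rho>1 where z1: "D z1 \<rho>1" "below p z1 \<rho>1 a" using B by blast
      \<comment> \<open>The least bound \<open>a\<close> becomes a parameter.\<close>
      define D' where "D' z \<rho> \<longleftrightarrow> D z \<rho> \<and> below p z \<rho> a" for z \<rho>
      have "closed_under_steps (Suc i) D'"
        unfolding closed_under_steps_def
      proof (intro conjI allI impI)
        fix z
        have "(\<lambda>\<rho>. R z (env (case_nat (Inr a) Inl) \<rho>)) \<in> Sigma_def M (Suc n)"
          by (rule Sigma_def_reindex[OF R])
        moreover have "(\<lambda>\<rho>. R z (env (case_nat (Inr a) Inl) \<rho>)) = D' z"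
          by (simp add: R_def D'_def[abs_def] env_def)
        ultimately show "D' z \<in> Sigma_def M (Suc n)" by simp
      next
        fix v m \<rho> assume D': "D' (v, m) \<rho>"
        then have DD: "D (v, m) \<rho>" by (simp add: D'_def)
        show "(v, m) \<in> states" using D_states[OF DD] .
        obtain w \<rho>' where w: "w \<in> set (children v)" "D (w, update v w m) \<rho>'" "i \<le> priority v w m"
          "descends v w \<rho> \<rho>'" "m \<in> memories v" "w \<in> subtrees P" using closed_under_stepsD[OF D DD] by metis
        have bel: "below p (v, m) \<rho> a" using D' by (simp add: D'_def)
        have "below p (w, update v w m) \<rho>' a"
          by (rule update_below[OF w(5,6,4) bel]) (use w(3) i in simp)
        then have "D' (w, update v w m) \<rho>'" using w by (simp add: D'_def)
        \<comment> \<open>At priority \<open>i = 2 * p + 1\<close> the name \<open>p\<close>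
          flashes, and the successor would provide a bound smaller than the least one.\<close>
        moreover have "priority v w m \<noteq> i"
          using flash_below[OF w(5,6,4) bel] least B w(2) i by blast
        ultimately show "\<exists>w \<in> set (children v). \<exists>\<rho>'. D' (w, update v w m) \<rho>' \<and>
            Suc i \<le> priority v w m \<and> descends v w \<rho> \<rho>'" using w by (metis Suc_leI le_neq_implies_less)
      qed
      then have "\<not> D' z1 \<rho>1" by (rule step.IH)
      then show False using z1 by (simp add: D'_def)
    qed
  qed
qed

lemma root_sat: "sat_seq M \<rho> (root P)"
proof (rule ccontr)
  assume false: "\<not> sat_seq M \<rho> (root P)"
  define D where "D z \<rho> \<longleftrightarrow> z \<in> states \<and> \<not> sat_seq M \<rho> (root (fst z))" for z \<rho>
  have "closed_under_steps 0 D"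
    unfolding closed_under_steps_def
  proof (intro conjI allI impI)
    fix z
    show "D z \<in> Sigma_def M (Suc n)"
    proof (cases "z \<in> states")
      case True
      then have "fst z \<in> subtrees P" by (auto simp: states_def)
      then show ?thesis using falsified_definable[OF level] True by (simp add: D_def[abs_def] del: Sigma_def.simps)
    next
      case False
      then show ?thesis using Sigma_def_False by (simp add: D_def[abs_def] del: Sigma_def.simps)
    qed
  next
    fix v m \<rho> assume D: "D (v, m) \<rho>"
    then show "(v, m) \<in> states" by (simp add: D_def)
    then have v: "v \<in> subtrees P" "m \<in> memories v" by (auto simp: states_def)
    obtain w \<rho>' where w: "w \<in> set (children v)" "\<not> sat_seq M \<rho>' (root w)" "descends v w \<rho> \<rho>'"
      using falsified_child[OF v(1), of \<rho>] D unfolding D_def by auto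
    have "w \<in> subtrees P" using v(1) w(1) by (rule subtrees.intros(2))
    then have "D (w, update v w m) \<rho>'" using update_memories[OF v(2)] w by (simp add: D_def states_def)
    then show "\<exists>w \<in> set (children v). \<exists>\<rho>'. D (w, update v w m) \<rho>' \<and>
        0 \<le> priority v w m \<and> descends v w \<rho> \<rho>'" using w by blast
  qed
  \<comment> \<open>The root starts with the memory that names nothing, which trivially satisfies
    the invariants.\<close>
  then have "\<not> D (P, \<lambda>_. {}) \<rho>" by (rule no_descent[rotated]) simp
  then show False using false by (simp add: D_def states_def memories_def subtrees.intros)
qed

end

lemma C_Sigma_valid:
  assumes "\<And>A. A \<in> I_Sigma (Suc n) \<Longrightarrow> valid M A" and "B \<in> C_Sigma n"
  shows "valid M B"
proof -
  obtain As Bs P where P: "cyclic_proof P" "\<forall>S \<in> subtrees P. fms (root S) \<subseteq> Sigma_fms n"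
    "root P = (fset_of_list As \<turnstile> fset_of_list Bs)" and B: "B = closure (Disj (map neg As @ Bs))"
    using assms(2) unfolding C_Sigma_def by blast
  interpret cyclic_in_model M n P
    by unfold_locales (use assms(1) P in auto)
  have "sat M \<rho> (Disj (map neg As @ Bs))" for \<rho>
  proof -
    have "(\<forall>A \<in> set As. sat M \<rho> A) \<longrightarrow> (\<exists>A \<in> set Bs. sat M \<rho> A)"
      using root_sat[of \<rho>] by (simp add: P(3) sat_seq_def fset_of_list.rep_eq)
    moreover have "sat M \<rho> (neg A) \<longleftrightarrow> \<not> sat M \<rho> A" for A by simp
    ultimately show ?thesis unfolding sat_Disj set_append set_map by blast
  qed
  then have "valid M (Disj (map neg As @ Bs))" by (simp add: valid_def)
  then show ?thesis by (simp add: B)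
qed

theorem theorem7p3:
  fixes n :: nat
  shows "{A. theorem_of (C_Sigma n) A} \<subseteq> {A. theorem_of (I_Sigma (n + 1)) A}"
proof (intro subsetI CollectI, drule CollectD)
  fix B assume B: "theorem_of (C_Sigma n) B"
  show "theorem_of (I_Sigma (n + 1)) B"
  proof (rule completeness)
    show "Q \<subseteq> I_Sigma (n + 1)" by (simp add: I_Sigma_def)
    show "fv_fm A = {}" if "A \<in> I_Sigma (n + 1)" for A
      using that unfolding I_Sigma_def Q_def by auto
  next
    fix M :: "nat interp" assume M: "\<And>A. A \<in> I_Sigma (n + 1) \<Longrightarrow> valid M A"
    have "\<forall>A \<in> C_Sigma n. valid M A" using C_Sigma_valid[of n M] M by simp
    from derives_sound[OF B[unfolded theorem_of_def] this] show "valid M B"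
      by (simp add: valid_def sat_seq_def)
  qed
qed

end
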